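(* Let $\beta>2$, $\kappa>0$, $\lambda_{\mathrm B}>0$, $\lambda_{\mathrm D}>0$, $r>0$, $\tau_{\mathrm D}>0$ and $0\le\delta\le 1$. Consider the device-to-device network model described in the context, with propagation constants $a_{\mathrm B},a_{\mathrm D}$, base-station coverage probability $\mathcal P_{\mathrm B}(\tau_{\mathrm B},p)$ and device-to-device coverage probability $\mathcal P_{\mathrm D}(\tau_{\mathrm D},p)$, where $p\in[0,1]$ is the proportion of active devices. Define the device spatial throughput $D(p)=p\,\lambda_{\mathrm D}\,\mathcal P_{\mathrm D}(\tau_{\mathrm D},p)$. Then, among all $p\in[0,1]$ satisfying the constraint $$\mathcal P_{\mathrm B}(\tau_{\mathrm B},p)\ \ge\ \delta\,\mathcal P_{\mathrm B}(\tau_{\mathrm B},0)\qquad\text{for all }\tau_{\mathrm B}\ge 1,$$ the throughput $D(p)$ is maximized by $$p^*=\min[1,\,p_1^*,\,p_2^*],$$ where $$p_1^*=\frac{\tau_{\mathrm D}^{-2/\beta}}{a_{\mathrm D}\,r^2\,\Gamma(1-2/\beta)},\qquad p_2^*=\frac{a_{\mathrm B}}{a_{\mathrm D}}\left(\frac1\delta-1\right)$$ (with $p_2^*=+\infty$ if $\delta=0$). The device spatial throughput $D(p^* )$ then takes one of three values, according to whether $p^*=1$, $p^*=p_1^*$ or $p^*=p_2^*$, respectively: $$D(1)=\lambda_{\mathrm D}\,e^{-(a_{\mathrm B}+a_{\mathrm D})r^2\Gamma(1-2/\beta)\tau_{\mathrm D}^{2/\beta}},$$ $$D(p_1^* )=\frac{\lambda_{\mathrm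 D}\,e^{-a_{\mathrm B}/a_{\mathrm D}}\,e^{-1}}{a_{\mathrm D}\,r^2\,\Gamma(1-2/\beta)\,\tau_{\mathrm D}^{2/\beta}},$$ $$D(p_2^* )=\frac{a_{\mathrm B}}{a_{\mathrm D}}\left(\frac1\delta-1\right)\lambda_{\mathrm D}\,e^{-a_{\mathrm B}r^2\Gamma(1-2/\beta)\tau_{\mathrm D}^{2/\beta}/\delta}.$$
   Context: Network model. $\Phi=\{X_i\}_{i\ge1}$ (base stations) is a homogeneous Poisson point process on $\mathbb R^2$ with density $\lambda_{\mathrm B}$. For $p\in[0,1]$, the active devices form a homogeneous Poisson point process $\Psi_p=\{Y_j\}$ on $\mathbb R^2$ with density $p\lambda_{\mathrm D}$ (each device of a Poisson process of density $\lambda_{\mathrm D}$ is active independently with probability $p$; $\Psi_0$ is empty), independent of $\Phi$. The path-loss function is $\ell(x)=(\kappa|x|)^{\beta}$ for $x\in\mathbb R^2$, and $\ell(r)=(\kappa r)^\beta$ for a distance $r>0$. The marks $F_i$ of base stations are i.i.d. copies of a positive random variable $F$ with $\mathbf E(F^{2/\beta})<\infty$; the marks $E_j$ of devices are i.i.d. exponential random variables with mean $1$. All marks and point processes are independent. Transmission powers are normalized to $1$. Propagation constants (with $\Gamma$ the gamma function): $$a_{\mathrm B}=\frac{\lambda_{\mathrm B}\pi\,\mathbf E(F^{2/\beta})}{\kappa^2},\qquad a_{\mathrm D}=\frac{\lambda_{\mathrm D}\pi\,\Gamma(1+2/\beta)}{\kappa^2}.$$ Interference at the origin: $I_{\mathrm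 B}=\sum_{i}F_i/\ell(X_i)$ and $I_{\mathrm D}(p)=\sum_{Y_j\in\Psi_p}E_j/\ell(Y_j)$, with $I_{\mathrm D}(0)=0$. Base-station coverage probability: $$\mathcal P_{\mathrm B}(\tau_{\mathrm B},p)=\mathbf P\left(\max_i\frac{F_i/\ell(X_i)}{I_{\mathrm D}(p)+[I_{\mathrm B}-F_i/\ell(X_i)]}>\tau_{\mathrm B}\right).$$ Device-to-device coverage probability (receiver at the origin, typical transmitting device at distance $r$, not belonging to $\Psi_p$): $$\mathcal P_{\mathrm D}(\tau_{\mathrm D},p)=\mathbf P\left(\frac{E/\ell(r)}{I_{\mathrm B}+I_{\mathrm D}(p)}>\tau_{\mathrm D}\right),$$ where $E$ is an exponential random variable with mean $1$ independent of $I_{\mathrm B}$ and $I_{\mathrm D}(p)$.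
   Formalization: r² is replaced by (κr)² in p₁* and in the three values of D(p* ), because P_D does not depend on κ while a_B, a_D carry 1/κ²; in D(p₁* ) the factor e^{-a_B/a_D} is replaced by e^{-a_B/(a_D p₁* )}. The printed formulas fail for κ≠1 and for p₁*≠1. *)

theory Defs
  imports "HOL-Probability.Probability"
begin

section \<open>Homogeneous Poisson point processes in the plane\<close>

text \<open>A point process is given by an enumeration \<open>X 0, X 1, \<dots>\<close> of its points (with multiplicity).
  Counts are extended nonnegative reals because a set may a priori contain infinitely many
  points.\<close>

definition point_count :: "(nat \<Rightarrow> 'w \<Rightarrow> real^2) \<Rightarrow> (real^2) set \<Rightarrow> 'w \<Rightarrow> ennreal" where
  "point_count X A \<omega> = (\<Sum>i. indicator A (X i \<omega>))"

locale homogeneous_ppp = prob_space M for M :: "'w measure" +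
  fixes dens :: real and X :: "nat \<Rightarrow> 'w \<Rightarrow> real^2"
  assumes point_measurable: "\<And>i. X i \<in> borel_measurable M"
    and poisson_count: "\<And>A k. A \<in> sets borel \<Longrightarrow> bounded A \<Longrightarrow>
      prob {\<omega> \<in> space M. point_count X A \<omega> = of_nat k}
        = (dens * measure lborel A) ^ k / fact k * exp (- (dens * measure lborel A))"
    and indep_counts: "\<And>(A :: nat \<Rightarrow> (real^2) set) n. (\<And>j. j < n \<Longrightarrow> A j \<in> sets borel \<and> bounded (A j)) \<Longrightarrow>
      disjoint_family_on A {..<n} \<Longrightarrow>
      indep_vars (\<lambda>_. borel) (\<lambda>j. point_count X (A j)) {..<n}"


section \<open>The network\<close>

text \<open>The random inputs have different types, so their mutual independence is expressed as
  independence of the families of events they generate, indexed by the following type.\<close>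

datatype component =
  Station_Points | Station_Mark nat | Device_Points | Device_Mark nat | Device_Active nat | Typical_Mark

definition generated_events :: "'w measure \<Rightarrow> 'b measure \<Rightarrow> ('w \<Rightarrow> 'b) \<Rightarrow> 'w set set" where
  "generated_events M N f = {f -` A \<inter> space M | A. A \<in> sets N}"

text \<open>
  \<open>X\<close>, \<open>F\<close>: base stations and their marks, of common law \<open>mark_law\<close>;
  \<open>Y\<close>, \<open>E\<close>: devices (active or not) and their marks;
  \<open>active p j\<close>: the event that device \<open>j\<close> is active when the proportion of active devices is \<open>p\<close>;
  \<open>E0\<close>: mark of the typical transmitting device.
  The process of active devices for the proportion \<open>p\<close> is \<open>{Y j | j. active p j}\<close>, the independent
  \<open>p\<close>-thinning of \<open>Y\<close>; it is almost surely empty for \<open>p = 0\<close>.  No relation is imposed between the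
  activities for different values of \<open>p\<close>.  Marks and activities are independent of the whole
  enumeration of the points, so that they are independent marks attached to the points.\<close>

locale d2d_network =
  stations: homogeneous_ppp M dens_B X + devices: homogeneous_ppp M dens_D Y
  for M :: "'w measure" and dens_B dens_D :: real and X Y :: "nat \<Rightarrow> 'w \<Rightarrow> real^2" +
  fixes \<beta> :: real
    and mark_law :: "real measure"
    and F E :: "nat \<Rightarrow> 'w \<Rightarrow> real"
    and active :: "real \<Rightarrow> nat \<Rightarrow> 'w \<Rightarrow> bool"
    and E0 :: "'w \<Rightarrow> real"
  assumes F_measurable: "\<And>i. F i \<in> borel_measurable M"
    and F_law: "\<And>i. distr M borel (F i) = mark_law"
    and F_pos: "AE x in mark_law. 0 < x"
    and F_moment: "integrable mark_law (\<lambda>x. x powr (2 / \<beta>))"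
    and E_exponential: "\<And>j. distributed M lborel (E j) (exponential_density 1)"
    and E0_exponential: "distributed M lborel E0 (exponential_density 1)"
    and active_measurable: "\<And>p j. p \<in> {0..1} \<Longrightarrow> active p j \<in> measurable M (count_space UNIV)"
    and active_prob: "\<And>p j. p \<in> {0..1} \<Longrightarrow> stations.prob {\<omega> \<in> space M. active p j \<omega>} = p"
    and independence: "\<And>p. p \<in> {0..1} \<Longrightarrow> stations.indep_sets
      (\<lambda>c. case c of
          Station_Points \<Rightarrow> generated_events M (\<Pi>\<^sub>M i\<in>UNIV. borel) (\<lambda>\<omega> i. X i \<omega>)
        | Station_Mark i \<Rightarrow> generated_events M borel (F i)
        | Device_Points \<Rightarrow> generated_events M (\<Pi>\<^sub>M i\<in>UNIV. borel) (\<lambda>\<omega> i. Y i \<omega>)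
        | Device_Mark j \<Rightarrow> generated_events M borel (E j)
        | Device_Active j \<Rightarrow> generated_events M (count_space UNIV) (active p j)
        | Typical_Mark \<Rightarrow> generated_events M borel E0) UNIV"


section \<open>Interference, coverage and throughput\<close>

definition path_loss :: "real \<Rightarrow> real \<Rightarrow> real \<Rightarrow> real" where
  "path_loss \<kappa> \<beta> d = (\<kappa> * d) powr \<beta>"

definition signal :: "real \<Rightarrow> real \<Rightarrow> (nat \<Rightarrow> 'w \<Rightarrow> real) \<Rightarrow> (nat \<Rightarrow> 'w \<Rightarrow> real^2) \<Rightarrow> nat \<Rightarrow> 'w \<Rightarrow> ennreal" where
  "signal \<kappa> \<beta> F X i \<omega> = ennreal (F i \<omega> / path_loss \<kappa> \<beta> (norm (X i \<omega>)))"

definition interference_B :: "real \<Rightarrow> real \<Rightarrow> (nat \<Rightarrow> 'w \<Rightarrow> real) \<Rightarrow> (nat \<Rightarrow> 'w \<Rightarrow> real^2) \<Rightarrow> 'w \<Rightarrow> ennreal" where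
  "interference_B \<kappa> \<beta> F X \<omega> = (\<Sum>i. signal \<kappa> \<beta> F X i \<omega>)"

definition interference_D ::
  "real \<Rightarrow> real \<Rightarrow> (nat \<Rightarrow> 'w \<Rightarrow> real) \<Rightarrow> (nat \<Rightarrow> 'w \<Rightarrow> real^2) \<Rightarrow> (real \<Rightarrow> nat \<Rightarrow> 'w \<Rightarrow> bool)
    \<Rightarrow> real \<Rightarrow> 'w \<Rightarrow> ennreal" where
  "interference_D \<kappa> \<beta> E Y active p \<omega> = (\<Sum>j. if active p j \<omega> then signal \<kappa> \<beta> E Y j \<omega> else 0)"

text \<open>The maximum over the infinitely many base stations is written as a supremum.  The
  subtraction is in \<^typ>\<open>ennreal\<close>; for \<open>\<beta> > 2\<close> the interference is almost surely finite.\<close>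

definition coverage_B ::
  "'w measure \<Rightarrow> real \<Rightarrow> real \<Rightarrow> (nat \<Rightarrow> 'w \<Rightarrow> real) \<Rightarrow> (nat \<Rightarrow> 'w \<Rightarrow> real^2)
    \<Rightarrow> (nat \<Rightarrow> 'w \<Rightarrow> real) \<Rightarrow> (nat \<Rightarrow> 'w \<Rightarrow> real^2) \<Rightarrow> (real \<Rightarrow> nat \<Rightarrow> 'w \<Rightarrow> bool) \<Rightarrow> real \<Rightarrow> real \<Rightarrow> real" where
  "coverage_B M \<kappa> \<beta> F X E Y active \<tau> p = measure M {\<omega> \<in> space M.
     (SUP i. signal \<kappa> \<beta> F X i \<omega> /
        (interference_D \<kappa> \<beta> E Y active p \<omega> + (interference_B \<kappa> \<beta> F X \<omega> - signal \<kappa> \<beta> F X i \<omega>)))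
     > ennreal \<tau>}"

definition coverage_D ::
  "'w measure \<Rightarrow> real \<Rightarrow> real \<Rightarrow> (nat \<Rightarrow> 'w \<Rightarrow> real) \<Rightarrow> (nat \<Rightarrow> 'w \<Rightarrow> real^2)
    \<Rightarrow> (nat \<Rightarrow> 'w \<Rightarrow> real) \<Rightarrow> (nat \<Rightarrow> 'w \<Rightarrow> real^2) \<Rightarrow> (real \<Rightarrow> nat \<Rightarrow> 'w \<Rightarrow> bool)
    \<Rightarrow> ('w \<Rightarrow> real) \<Rightarrow> real \<Rightarrow> real \<Rightarrow> real \<Rightarrow> real" where
  "coverage_D M \<kappa> \<beta> F X E Y active E0 r \<tau> p = measure M {\<omega> \<in> space M.
     ennreal (E0 \<omega> / path_loss \<kappa> \<beta> r) /
        (interference_B \<kappa> \<beta> F X \<omega> + interference_D \<kappa> \<beta> E Y active p \<omega>)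
     > ennreal \<tau>}"

definition prop_const_B :: "real \<Rightarrow> real \<Rightarrow> real \<Rightarrow> real measure \<Rightarrow> real" where
  "prop_const_B \<kappa> \<beta> dens_B mark_law = dens_B * pi * (LINT x|mark_law. x powr (2 / \<beta>)) / \<kappa>\<^sup>2"

definition prop_const_D :: "real \<Rightarrow> real \<Rightarrow> real \<Rightarrow> real" where
  "prop_const_D \<kappa> \<beta> dens_D = dens_D * pi * Gamma (1 + 2 / \<beta>) / \<kappa>\<^sup>2"

text \<open>The unconstrained optimum.  The factor \<open>(\<kappa> r)\<^sup>2\<close> is \<open>path_loss \<kappa> \<beta> r powr (2 / \<beta>)\<close>: the
  propagation constants carry \<open>1 / \<kappa>\<^sup>2\<close>, whereas the coverage probability of the typical device does
  not depend on \<open>\<kappa>\<close>, since \<open>\<kappa>\<close> cancels in its signal-to-interference ratio.\<close>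

definition p_opt1 :: "real \<Rightarrow> real \<Rightarrow> real \<Rightarrow> real \<Rightarrow> real \<Rightarrow> real" where
  "p_opt1 \<kappa> \<beta> aD r \<tau> = \<tau> powr (- 2 / \<beta>) / (aD * (\<kappa> * r)\<^sup>2 * Gamma (1 - 2 / \<beta>))"

definition p_opt2 :: "real \<Rightarrow> real \<Rightarrow> real \<Rightarrow> ereal" where
  "p_opt2 aB aD \<delta> = (if \<delta> = 0 then \<infinity> else ereal (aB / aD * (1 / \<delta> - 1)))"

definition p_opt :: "real \<Rightarrow> ereal \<Rightarrow> real" where
  "p_opt p1 p2 = real_of_ereal (min 1 (min (ereal p1) p2))"

end

theory Submission
  imports Defs
begin

text \<open>
  Put \<open>\<alpha> = 2 / \<beta>\<close>.  The Laplace functional of a Poisson process with independent marks shows that the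
  total interference \<open>T = I\<^sub>B + I\<^sub>D(p)\<close> is \<open>\<alpha>\<close>-stable: its Laplace transform at \<open>s\<close> is \<open>exp (- A * s powr \<alpha>)\<close>
  with \<open>A = (a\<^sub>B + p * a\<^sub>D) * Gamma (1 - \<alpha>)\<close>.  Since the mark of the typical device is exponential, its
  coverage probability is a value of this transform.

  For a threshold \<open>\<tau> \<ge> 1\<close> at most one station covers the origin, so the coverage probability is the
  expected number of covering stations.  Mecke's formula says that, for a station with signal \<open>S\<close>, the rest
  \<open>T - S\<close> is distributed as \<open>T\<close> and independent of \<open>S\<close>; since the signals exceed \<open>y\<close> with intensity
  \<open>a\<^sub>B * y powr (- \<alpha>)\<close>, this number is \<open>a\<^sub>B * \<tau> powr (- \<alpha>)\<close> times the expectation of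
  \<open>T powr (- \<alpha>)\<close>, and the latter is a constant over \<open>A\<close>.  Hence the coverage probability is
  proportional to \<open>1 / (a\<^sub>B + p * a\<^sub>D)\<close>, with a factor depending on \<open>\<tau>\<close> only, and the constraint becomes
  \<open>p \<le> p\<^sub>2\<close>.  What remains is to maximise \<open>p * exp (- p / p\<^sub>1)\<close> on an interval.

  Mecke's formula follows from the Laplace functional by differentiation and by uniqueness in the
  Hausdorff moment problem for \<open>exp (- T)\<close>.\<close>

subsection \<open>The negative exponential on extended nonnegative reals\<close>

text \<open>The points come as an enumeration of unknown joint law: only counts in bounded sets are
  prescribed, so one cannot condition on a station being at a given place. The Laplace functional
  can be computed from such counts, and the later formulas are extracted from it. Sums over
  infinitely many points may a priori be infinite, so exp (- x) is extended by
  \<open>nexp top = 0\<close>; identities then hold without summability conditions, and almost sure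
  finiteness of the interference becomes a consequence. Removing one station from T costs the factor
  exp (k * signal) in the k-th moment of exp (- T), and the tilt produced by Campbell's formula is
  exactly its inverse; this cancellation makes the rest distributed as T. It is available for
  exponentials of T, which is why a moment problem for a variable in [0,1] closes the
  argument.\<close>

definition nexp :: "ennreal \<Rightarrow> ennreal" where
  "nexp x = (if x = top then 0 else ennreal (exp (- enn2real x)))"

text \<open>Inverse of \<open>nexp\<close> on [0,1]. It turns an averaged factor of a product back
  into an exponent, and recovers an interference from its negative exponential; 0 goes to
  \<open>top\<close> to match \<open>nexp top = 0\<close>.\<close>

definition nlog :: "real \<Rightarrow> ennreal" where
  "nlog v = (if v \<le> 0 then top else ennreal (- ln v))"

lemma nexp_top [simp]: "nexp top = 0"
  by (simp add: nexp_def)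

lemma nexp_0 [simp]: "nexp 0 = 1"
  by (simp add: nexp_def)

lemma nexp_ennreal: "0 \<le> x \<Longrightarrow> nexp (ennreal x) = ennreal (exp (- x))"
  by (simp add: nexp_def)

lemma nexp_le_1: "nexp x \<le> 1"
  by (simp add: nexp_def ennreal_le_1)

lemma nexp_less_top [simp]: "nexp x < top"
  by (simp add: nexp_def)

lemma nexp_neq_top [simp]: "nexp x \<noteq> top"
  by (simp add: nexp_def)

lemma nexp_add: "nexp (x + y) = nexp x * nexp y"
  by (auto simp: nexp_def enn2real_plus less_top ennreal_mult[symmetric] mult_exp_exp)

lemma nexp_sum: "nexp (\<Sum>i\<in>A. f i) = (\<Prod>i\<in>A. nexp (f i))"
  by (induction A rule: infinite_finite_induct) (auto simp: nexp_add)

lemma nexp_of_nat_mult: "nexp (of_nat k * x) = nexp x ^ k"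
  by (induction k) (auto simp: nexp_add distrib_right)

lemma nexp_antimono: "x \<le> y \<Longrightarrow> nexp y \<le> nexp x"
  by (auto simp: nexp_def top_unique less_top intro!: ennreal_leI enn2real_mono)

lemma nexp_nlog: "0 \<le> v \<Longrightarrow> v \<le> 1 \<Longrightarrow> nexp (nlog v) = ennreal v"
  by (auto simp: nexp_def nlog_def)

lemma nlog_nexp: "nlog (enn2real (nexp x)) = x"
  by (cases x) (auto simp: nexp_def nlog_def)

lemma ennreal_enn2real_nexp [simp]: "ennreal (enn2real (nexp x)) = nexp x"
  by simp

lemma enn2real_nexp_bounds: "enn2real (nexp x) \<in> {0..1}"
  using nexp_le_1[of x] by (auto intro: enn2real_leI)

lemma nexp_measurable [measurable]: "nexp \<in> borel_measurable borel"
  unfolding nexp_def by measurable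

lemma nlog_measurable [measurable]: "nlog \<in> borel_measurable borel"
  unfolding nlog_def by measurable

text \<open>Continuity at \<open>top\<close> is included, so that limits of Laplace functionals can
  be taken before anything is known to be finite; there, antitonicity bounds \<open>nexp\<close> by
  its values at large integers.\<close>

lemma tendsto_nexp:
  assumes "(f \<longlongrightarrow> x) A"
  shows "((\<lambda>i. nexp (f i)) \<longlongrightarrow> nexp x) A"
proof (cases "x = top")
  case False
  then have ev: "eventually (\<lambda>i. f i < top) A"
    using assms by (intro order_tendstoD(2)) (auto simp: less_top)
  have "((\<lambda>i. enn2real (f i)) \<longlongrightarrow> enn2real x) A"
    using assms False by (intro tendsto_enn2real) (simp_all add: ennreal_enn2real_if)
  then have "((\<lambda>i. ennreal (exp (- enn2real (f i)))) \<longlongrightarrow> ennreal (exp (- enn2real x))) A"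
    by (intro tendsto_ennrealI tendsto_exp tendsto_minus)
  moreover have "eventually (\<lambda>i. ennreal (exp (- enn2real (f i))) = nexp (f i)) A"
    using ev by eventually_elim (auto simp: nexp_def)
  ultimately show ?thesis
    unfolding nexp_def[of x] using False by (simp only: if_False) (rule Lim_transform_eventually)
next
  case True
  show ?thesis
    unfolding True nexp_top
  proof (rule order_tendstoI)
    fix a :: ennreal assume "0 < a"
    have "((\<lambda>n. ennreal (exp (- real n))) \<longlongrightarrow> ennreal 0) sequentially"
      by (intro tendsto_ennrealI filterlim_compose[OF exp_at_bot] filterlim_compose[OF filterlim_uminus_at_bot_at_top] filterlim_real_sequentially)
    then have "eventually (\<lambda>n. ennreal (exp (- real n)) < a) sequentially"
      using \<open>0 < a\<close> by (auto dest: order_tendstoD(2))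
    then obtain n where n: "ennreal (exp (- real n)) < a"
      by (auto simp: eventually_sequentially)
    have "eventually (\<lambda>i. ennreal (real n) < f i) A"
      using order_tendstoD(1)[OF assms, of "ennreal (real n)"] True by simp
    then show "eventually (\<lambda>i. nexp (f i) < a) A"
    proof eventually_elim
      case (elim i)
      have "nexp (f i) \<le> nexp (ennreal (real n))"
        using elim by (intro nexp_antimono) simp
      then show ?case using n by (simp add: nexp_ennreal)
    qed
  qed auto
qed

lemma nexp_suminf: "(\<lambda>n. \<Prod>i<n. nexp (f i)) \<longlonglongrightarrow> nexp (\<Sum>i. f i)"
  unfolding nexp_sum[symmetric] by (intro tendsto_nexp summable_LIMSEQ) simp

subsection \<open>Uniqueness in the Hausdorff moment problem\<close>

text \<open>Equal moments give equal integrals of polynomials, hence by Stone-Weierstrass of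
  continuous functions, since both measures live on the compact \<open>{0..1}\<close>; rays
  \<open>{z<..}\<close> are then reached by bounded continuous approximation.\<close>

lemma finite_measure_eqI_moments:
  fixes \<mu> \<nu> :: "real measure"
  assumes fin: "finite_measure \<mu>" "finite_measure \<nu>"
    and sets [measurable_cong]: "sets \<mu> = sets borel" "sets \<nu> = sets borel"
    and supp: "AE x in \<mu>. x \<in> {0..1}" "AE x in \<nu>. x \<in> {0..1}"
    and mom: "\<And>k :: nat. (\<integral>\<^sup>+x. ennreal (x ^ k) \<partial>\<mu>) = (\<integral>\<^sup>+x. ennreal (x ^ k) \<partial>\<nu>)"
  shows "\<mu> = \<nu>"
proof -
  have integrable: "integrable m f" and bound: "\<bar>integral\<^sup>L m f\<bar> \<le> c * measure m UNIV"
    if "finite_measure m" and m[measurable_cong]: "sets m = sets borel" and "AE x in m. x \<in> {0..1}"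
      and [measurable]: "f \<in> borel_measurable borel" and "\<And>x. x \<in> {0..1} \<Longrightarrow> \<bar>f x\<bar> \<le> c"
    for m :: "real measure" and f :: "real \<Rightarrow> real" and c
  proof -
    interpret finite_measure m by fact
    have ae: "AE x in m. norm (f x) \<le> c" using that(3) by eventually_elim (use that(5) in auto)
    then show i: "integrable m f" by (intro integrable_const_bound[of _ c]) auto
    have "norm (integral\<^sup>L m f) \<le> (LINT x|m. norm (f x))" by (rule integral_norm_bound)
    also have "\<dots> \<le> (LINT x|m. c)" using i ae by (intro integral_mono_AE) auto
    finally show "\<bar>integral\<^sup>L m f\<bar> \<le> c * measure m UNIV"
      using sets_eq_imp_space_eq[OF m] by (simp add: mult.commute)
  qed
  have pow: "integral\<^sup>L \<mu> (\<lambda>x. x ^ k) = integral\<^sup>L \<nu> (\<lambda>x. x ^ k)" for k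
  proof -
    have "integral\<^sup>L m (\<lambda>x. x ^ k) = enn2real (\<integral>\<^sup>+x. ennreal (x ^ k) \<partial>m)"
      if "AE x in m. x \<in> {0..1}" and [measurable_cong]: "sets m = sets borel" for m :: "real measure"
    proof (rule integral_eq_nn_integral)
      show "AE x in m. 0 \<le> x ^ k" using that(1) by eventually_elim simp
    qed measurable
    then show ?thesis using supp sets mom[of k] by simp
  qed
  have poly: "integral\<^sup>L \<mu> (\<lambda>x. \<Sum>i\<le>n. a i * x ^ i) = integral\<^sup>L \<nu> (\<lambda>x. \<Sum>i\<le>n. a i * x ^ i)" for a and n :: nat
  proof -
    have i: "integrable m (\<lambda>x. x ^ k)" if "finite_measure m" "sets m = sets borel" "AE x in m. x \<in> {0..1}"
      for m :: "real measure" and k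
      using integrable[OF that, of "\<lambda>x. x ^ k" 1] by (auto simp: power_abs power_le_one)
    note i[OF fin(1) sets(1) supp(1), simp] i[OF fin(2) sets(2) supp(2), simp]
    show ?thesis by (simp add: pow)
  qed
  have cont: "integral\<^sup>L \<mu> f = integral\<^sup>L \<nu> f" if f: "continuous_on UNIV f" for f :: "real \<Rightarrow> real"
  proof -
    have [measurable]: "f \<in> borel_measurable borel" using f by (rule borel_measurable_continuous_onI)
    have cf: "continuous_on {0..1} f" using f by (rule continuous_on_subset) simp
    have "compact (f ` {0..1})" using cf by (intro compact_continuous_image) auto
    then obtain c where c: "\<And>x. x \<in> {0..1} \<Longrightarrow> \<bar>f x\<bar> \<le> c"
      by (metis (no_types, opaque_lifting) bounded_real compact_imp_bounded imageI)
    define K where "K = measure \<mu> UNIV + measure \<nu> UNIV"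
    have close: "\<bar>integral\<^sup>L \<mu> f - integral\<^sup>L \<nu> f\<bar> \<le> e * K" if e: "0 < e" for e
    proof -
      obtain g where g: "real_polynomial_function g" "\<And>x. x \<in> {0..1} \<Longrightarrow> \<bar>f x - g x\<bar> < e"
        using Stone_Weierstrass_real_polynomial_function[OF _ cf e] by auto
      then obtain a and n :: nat where ga: "g = (\<lambda>x. \<Sum>i\<le>n. a i * x ^ i)"
        by (auto simp: real_polynomial_function_iff_sum)
      have [measurable]: "g \<in> borel_measurable borel" unfolding ga by measurable
      have gb: "\<bar>g x\<bar> \<le> c + e" if "x \<in> {0..1}" for x using g(2)[OF that] c[OF that] by linarith
      have d: "\<bar>integral\<^sup>L m f - integral\<^sup>L m g\<bar> \<le> e * measure m UNIV"
        if m: "finite_measure m" "sets m = sets borel" "AE x in m. x \<in> {0..1}" for m :: "real measure"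
      proof -
        have "integrable m f" "integrable m g"
          by (rule integrable[OF m, of f c]; use c in simp)
            (rule integrable[OF m, of g "c + e"]; use gb in simp)
        then have "integral\<^sup>L m f - integral\<^sup>L m g = integral\<^sup>L m (\<lambda>x. f x - g x)"
          by simp
        also have "\<bar>\<dots>\<bar> \<le> e * measure m UNIV"
          using g(2) by (intro bound[OF m]) (auto intro: less_imp_le)
        finally show ?thesis .
      qed
      have "integral\<^sup>L \<mu> g = integral\<^sup>L \<nu> g" unfolding ga by (rule poly)
      with d[OF fin(1) sets(1) supp(1)] d[OF fin(2) sets(2) supp(2)] show ?thesis
        by (simp add: distrib_left K_def)
    qed
    show ?thesis
    proof (rule ccontr)
      assume "integral\<^sup>L \<mu> f \<noteq> integral\<^sup>L \<nu> f"
      then have p: "0 < \<bar>integral\<^sup>L \<mu> f - integral\<^sup>L \<nu> f\<bar>" (is "0 < ?d") by simp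
      have "K \<ge> 0" by (simp add: K_def)
      \<comment> \<open>The tolerance e = \<open>?d / (2 * (K + 1))\<close> is small enough that e *
        K stays below the supposed gap; the summand 1 covers K = 0.\<close>
      then have "?d / (2 * (K + 1)) * K < ?d"
        using p by (simp add: field_simps add_pos_nonneg add_strict_increasing2)
      moreover have "?d \<le> ?d / (2 * (K + 1)) * K"
        using p \<open>K \<ge> 0\<close> by (intro close) (auto intro!: divide_pos_pos)
      ultimately show False by simp
    qed
  qed
  show ?thesis
  proof (rule measure_eqI_lessThan)
    show "emeasure \<mu> {x<..} < \<infinity>" for x
      using finite_measure.emeasure_finite[OF fin(1)] by (simp add: less_top)
    show "emeasure \<mu> {z<..} = emeasure \<nu> {z<..}" for z
    proof -
      \<comment> \<open>Ramps of slope n starting at z, cut off at 1: they vanish at z itself, so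
        their limit is the indicator of the open ray.\<close>
      define f :: "nat \<Rightarrow> real \<Rightarrow> real" where "f n x = min 1 (real n * max 0 (x - z))" for n x
      have lim: "(\<lambda>n. f n x) \<longlonglongrightarrow> indicator {z<..} x" for x
      proof (cases "x > z")
        case True
        obtain N where N: "1 / (x - z) < real N" using reals_Archimedean2 by blast
        have "f n x = 1" if "N \<le> n" for n
        proof -
          have "1 / (x - z) < real n" using N that by linarith
          then show ?thesis using True by (simp add: f_def field_simps)
        qed
        then have "eventually (\<lambda>n. f n x = 1) sequentially"
          by (auto simp: eventually_sequentially)
        then show ?thesis using True by (simp add: tendsto_eventually)
      qed (simp add: f_def)
      have fb: "norm (f n x) \<le> 1" for n x by (auto simp: f_def)
      have cont_f: "continuous_on UNIV (f n)" for n unfolding f_def by (intro continuous_intros)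
      have fm: "f n \<in> borel_measurable borel" for n using cont_f by (rule borel_measurable_continuous_onI)
      have lim_int: "(\<lambda>n. integral\<^sup>L m (f n)) \<longlonglongrightarrow> measure m {z<..}"
        if m: "finite_measure m" and s[measurable_cong]: "sets m = sets borel" for m :: "real measure"
      proof -
        interpret finite_measure m by fact
        have [measurable]: "f n \<in> borel_measurable m" for n using fm[of n] s by measurable
        have "(\<lambda>n. integral\<^sup>L m (f n)) \<longlonglongrightarrow> integral\<^sup>L m (indicator {z<..})"
          using lim fb by (intro integral_dominated_convergence[where w="\<lambda>_. 1"]) auto
        then show ?thesis using sets_eq_imp_space_eq[OF s] by simp
      qed
      have "(\<lambda>n. integral\<^sup>L \<mu> (f n)) \<longlonglongrightarrow> measure \<nu> {z<..}"
        using lim_int[OF fin(2) sets(2)] cont[OF cont_f] by simp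
      then have "measure \<mu> {z<..} = measure \<nu> {z<..}"
        using lim_int[OF fin(1) sets(1)] LIMSEQ_unique by blast
      then show ?thesis
        using fin by (simp add: finite_measure.emeasure_eq_measure)
    qed
  qed (use sets in auto)
qed

subsection \<open>The Laplace functional of a Poisson point process\<close>

lemma point_count_measurable [measurable]:
  assumes "homogeneous_ppp M dens X" and [measurable]: "A \<in> sets borel"
  shows "point_count X A \<in> borel_measurable M"
proof -
  interpret homogeneous_ppp M dens X by fact
  note point_measurable[measurable]
  show ?thesis unfolding point_count_def by measurable
qed

context homogeneous_ppp
begin

text \<open>The probability generating function of the Poisson law, at h = \<open>nexp c\<close>.
  For c = \<open>top\<close> this is h = 0 and the formula becomes the void probability.\<close>

lemma nexp_point_count:
  assumes A [measurable]: "A \<in> sets borel" and bdd: "bounded A" and dens: "0 \<le> dens"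
  shows "(\<integral>\<^sup>+\<omega>. nexp (c * point_count X A \<omega>) \<partial>M)
    = nexp (ennreal dens * emeasure lborel A * (1 - nexp c))"
proof -
  note point_count_measurable[OF homogeneous_ppp_axioms, measurable]
  define m where "m = dens * measure lborel A"
  define h where "h = enn2real (nexp c)"
  have m: "0 \<le> m" by (simp add: m_def dens)
  have h: "0 \<le> h" "h \<le> 1" "nexp c = ennreal h"
    using enn2real_nexp_bounds[of c] by (auto simp: h_def)
  define N where "N k = {\<omega> \<in> space M. point_count X A \<omega> = of_nat k}" for k :: nat
  have [measurable]: "N k \<in> sets M" for k unfolding N_def by measurable
  have PN: "prob (N k) = m ^ k / fact k * exp (- m)" for k
    unfolding N_def m_def by (rule poisson_count[OF A bdd])
  have disj: "disjoint_family N"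
    by (auto simp: disjoint_family_on_def N_def)
  have pgf: "(\<lambda>k. x ^ k * prob (N k)) sums exp (x * m - m)" for x
    using sums_mult2[OF exp_converges[of "x * m"], of "exp (- m)"]
    by (simp add: PN field_simps exp_diff exp_minus power_mult_distrib)
  \<comment> \<open>The Poisson weights add up to 1, so the count is almost surely a natural number
    and its value \<open>top\<close> can be ignored.\<close>
  have "(\<lambda>k. prob (N k)) sums prob (\<Union>k. N k)"
    by (rule finite_measure_UNION) (use disj in auto)
  moreover have "(\<lambda>k. prob (N k)) sums 1"
    using pgf[of 1] by simp
  ultimately have "prob (\<Union>k. N k) = 1"
    by (rule sums_unique2)
  then have ae: "AE \<omega> in M. \<omega> \<in> (\<Union>k. N k)"
    by (intro AE_prob_1)
  have "(\<integral>\<^sup>+\<omega>. nexp (c * point_count X A \<omega>) \<partial>M) = (\<integral>\<^sup>+\<omega>. (\<Sum>k. ennreal (h ^ k) * indicator (N k) \<omega>) \<partial>M)"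
  proof (rule nn_integral_cong_AE, use ae in eventually_elim)
    fix \<omega> assume "\<omega> \<in> (\<Union>k. N k)"
    then obtain k where k: "\<omega> \<in> N k" by auto
    have "(\<Sum>j. ennreal (h ^ j) * indicator (N j) \<omega>) = (\<Sum>j\<in>{k}. ennreal (h ^ j) * indicator (N j) \<omega>)"
      using k by (intro suminf_finite) (auto simp: N_def indicator_def)
    also have "\<dots> = nexp (c * point_count X A \<omega>)"
      using k h by (simp add: N_def mult.commute[of c] nexp_of_nat_mult ennreal_power)
    finally show "nexp (c * point_count X A \<omega>) = (\<Sum>k. ennreal (h ^ k) * indicator (N k) \<omega>)" ..
  qed
  also have "\<dots> = (\<Sum>k. ennreal (h ^ k * prob (N k)))"
    by (simp add: nn_integral_suminf nn_integral_cmult emeasure_eq_measure ennreal_mult h)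
  also have "\<dots> = ennreal (exp (h * m - m))"
    using h pgf[of h] by (intro suminf_ennreal_eq) auto
  also have "\<dots> = nexp (ennreal (m * (1 - h)))"
    using m h by (subst nexp_ennreal) (auto simp: algebra_simps mult_left_le_one_le)
  also have "ennreal (m * (1 - h)) = ennreal dens * emeasure lborel A * (1 - nexp c)"
  proof -
    have "emeasure lborel A = ennreal (measure lborel A)"
      using emeasure_bounded_finite[OF bdd] by (simp add: emeasure_eq_ennreal_measure less_top)
    then show ?thesis
      using h dens by (simp add: m_def ennreal_mult ennreal_minus flip: ennreal_1)
  qed
  finally show ?thesis .
qed

lemma nexp_sum_point_count:
  fixes n :: nat
  assumes A: "\<And>j. j < n \<Longrightarrow> A j \<in> sets borel \<and> bounded (A j)" and disj: "disjoint_family_on A {..<n}"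
    and dens: "0 \<le> dens"
  shows "(\<integral>\<^sup>+\<omega>. nexp (\<Sum>j<n. c j * point_count X (A j) \<omega>) \<partial>M)
    = nexp (ennreal dens * (\<Sum>j<n. emeasure lborel (A j) * (1 - nexp (c j))))"
proof -
  have "indep_vars (\<lambda>_. borel) (\<lambda>j. point_count X (A j)) {..<n}"
    by (rule indep_counts[OF A disj])
  then have "indep_vars (\<lambda>_. borel) (\<lambda>j \<omega>. nexp (c j * point_count X (A j) \<omega>)) {..<n}"
    by (rule indep_vars_compose2[where Y="\<lambda>j x. nexp (c j * x)"]) auto
  then have "(\<integral>\<^sup>+\<omega>. (\<Prod>j<n. nexp (c j * point_count X (A j) \<omega>)) \<partial>M)
    = (\<Prod>j<n. \<integral>\<^sup>+\<omega>. nexp (c j * point_count X (A j) \<omega>) \<partial>M)"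
    by (intro indep_vars_nn_integral) auto
  then show ?thesis
    using A by (simp add: nexp_sum nexp_point_count dens sum_distrib_left mult.assoc)
qed

text \<open>A simple function with bounded support is constant on finitely many disjoint bounded
  level sets, and for these the process prescribes independent Poisson counts.\<close>

lemma laplace_functional_simple:
  fixes u :: "real^2 \<Rightarrow> ennreal"
  assumes u: "simple_function borel u" and supp: "\<And>x. x \<notin> cball 0 R \<Longrightarrow> u x = 0" and dens: "0 \<le> dens"
  shows "(\<integral>\<^sup>+\<omega>. nexp (\<Sum>i. u (X i \<omega>)) \<partial>M) = nexp (ennreal dens * (\<integral>\<^sup>+x. 1 - nexp (u x) \<partial>lborel))"
proof -
  define S where "S = range u - {0}"
  have fin: "finite S" using u by (auto simp: S_def simple_function_def)
  \<comment> \<open>Stated for every \<open>\<phi>\<close> vanishing at 0 because it is used twice: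
    with the identity for the sum over the points, and with 1 - \<open>nexp\<close> for the
    intensity integral.\<close>
  have expand: "\<phi> (u x) = (\<Sum>y\<in>S. \<phi> y * indicator (u -` {y}) x)" if "\<phi> 0 = 0" for \<phi> :: "ennreal \<Rightarrow> ennreal" and x
  proof (cases "u x = 0")
    case True
    then show ?thesis using that by (auto simp: S_def indicator_def intro!: sum.neutral)
  next
    case False
    then have "(\<Sum>y\<in>S. \<phi> y * indicator (u -` {y}) x) = (\<Sum>y\<in>{u x}. \<phi> y * indicator (u -` {y}) x)"
      using fin by (intro sum.mono_neutral_right) (auto simp: S_def indicator_def)
    then show ?thesis by simp
  qed
  obtain h and n where h: "bij_betw h {0..<n} S" "n = card S"
    using ex_bij_betw_nat_finite[OF fin] by auto
  then have h: "bij_betw h {..<n} S" by (simp add: atLeast0LessThan)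
  define A where "A j = u -` {h j}" for j
  have hS: "h j \<in> S" if "j < n" for j using h that by (auto simp: bij_betw_def)
  have A: "A j \<in> sets borel \<and> bounded (A j)" if "j < n" for j
  proof
    have "u \<in> borel_measurable borel" using u by (rule borel_measurable_simple_function)
    then show "A j \<in> sets borel" unfolding A_def by (auto dest: measurable_sets[of _ _ _ "{h j}"])
    have "A j \<subseteq> cball 0 R" using hS[OF that] supp by (force simp: A_def S_def)
    then show "bounded (A j)" using bounded_cball bounded_subset by blast
  qed
  have disj: "disjoint_family_on A {..<n}"
    using h by (auto simp: disjoint_family_on_def A_def bij_betw_def inj_on_def)
  have expand': "\<phi> (u x) = (\<Sum>j<n. \<phi> (h j) * indicator (A j) x)" if "\<phi> 0 = 0" for \<phi> :: "ennreal \<Rightarrow> ennreal" and x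
    unfolding A_def expand[of \<phi>, OF that]
    by (rule sum.reindex_bij_betw[OF h, symmetric, of "\<lambda>y. \<phi> y * indicator (u -` {y}) x"])
  have "(\<Sum>i. u (X i \<omega>)) = (\<Sum>j<n. h j * point_count X (A j) \<omega>)" for \<omega>
  proof -
    have "(\<Sum>i. u (X i \<omega>)) = (\<Sum>i. \<Sum>j<n. h j * indicator (A j) (X i \<omega>))"
      by (subst expand'[of "\<lambda>y. y"]) simp_all
    also have "\<dots> = (\<Sum>j<n. \<Sum>i. h j * indicator (A j) (X i \<omega>))"
      by (rule suminf_sum) simp
    finally show ?thesis by (simp add: point_count_def)
  qed
  moreover have "(\<integral>\<^sup>+x. 1 - nexp (u x) \<partial>lborel) = (\<Sum>j<n. emeasure lborel (A j) * (1 - nexp (h j)))"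
  proof -
    have "(\<integral>\<^sup>+x. 1 - nexp (u x) \<partial>lborel) = (\<integral>\<^sup>+x. (\<Sum>j<n. (1 - nexp (h j)) * indicator (A j) x) \<partial>lborel)"
      by (subst expand'[of "\<lambda>y. 1 - nexp y"]) simp_all
    also have "\<dots> = (\<Sum>j<n. \<integral>\<^sup>+x. (1 - nexp (h j)) * indicator (A j) x \<partial>lborel)"
    proof (rule nn_integral_sum)
      fix j assume "j \<in> {..<n}"
      then have [measurable]: "A j \<in> sets borel" using A by auto
      show "(\<lambda>x. (1 - nexp (h j)) * indicator (A j) x) \<in> borel_measurable lborel" by measurable
    qed
    also have "\<dots> = (\<Sum>j<n. emeasure lborel (A j) * (1 - nexp (h j)))"
      using A by (intro sum.cong refl) (subst nn_integral_cmult_indicator, auto simp: mult.commute)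
    finally show ?thesis .
  qed
  ultimately show ?thesis
    using nexp_sum_point_count[of n A h] A disj dens by simp
qed

lemma laplace_functional:
  fixes u :: "real^2 \<Rightarrow> ennreal"
  assumes [measurable]: "u \<in> borel_measurable borel" and dens: "0 \<le> dens"
  shows "(\<integral>\<^sup>+\<omega>. nexp (\<Sum>i. u (X i \<omega>)) \<partial>M) = nexp (ennreal dens * (\<integral>\<^sup>+x. 1 - nexp (u x) \<partial>lborel))"
proof -
  note point_measurable[measurable]
  obtain f :: "nat \<Rightarrow> real^2 \<Rightarrow> ennreal" where f: "\<And>i. simple_function borel (f i)" "incseq f" "\<And>x. (SUP i. f i x) = u x"
    using borel_measurable_implies_simple_function_sequence'[of u borel] assms(1) by metis
  \<comment> \<open>Cutting off at radius i provides the bounded support and preserves monotone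
    convergence to u.\<close>
  define g where "g i x = f i x * indicator (cball 0 (real i)) x" for i x
  have gs: "simple_function borel (g i)" for i
    unfolding g_def by (intro simple_function_mult f simple_function_indicator) auto
  then have gm [measurable]: "g i \<in> borel_measurable borel" for i
    by (rule borel_measurable_simple_function)
  have mono: "incseq (\<lambda>i. g i x)" for x
    using f(2) by (auto simp: g_def incseq_def le_fun_def indicator_def)
  have lim: "(\<lambda>i. g i x) \<longlonglongrightarrow> u x" for x
  proof -
    obtain n where "norm x \<le> real n" using real_arch_simple by blast
    then have "eventually (\<lambda>i. f i x = g i x) sequentially"
      by (auto simp: eventually_sequentially g_def intro!: exI[of _ n])
    moreover have "(\<lambda>i. f i x) \<longlonglongrightarrow> u x"
      unfolding f(3)[symmetric] using f(2) by (intro LIMSEQ_SUP) (auto simp: incseq_def le_fun_def)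
    ultimately show ?thesis by (rule Lim_transform_eventually[rotated])
  qed
  have sup: "(SUP i. g i x) = u x" for x
    using LIMSEQ_unique[OF LIMSEQ_SUP[OF mono] lim] .
  have lim_sum: "(\<lambda>n. \<Sum>i. g n (X i \<omega>)) \<longlonglongrightarrow> (\<Sum>i. u (X i \<omega>))" for \<omega>
  proof -
    have "(\<Sum>i. u (X i \<omega>)) = (SUP n. \<Sum>i. g n (X i \<omega>))"
      unfolding sup[symmetric] by (rule ennreal_suminf_SUP_eq) (rule mono)
    moreover have "incseq (\<lambda>n. \<Sum>i. g n (X i \<omega>))"
      using mono by (auto simp: incseq_def intro!: suminf_le)
    ultimately show ?thesis by (simp add: LIMSEQ_SUP)
  qed
  have "(\<lambda>n. \<integral>\<^sup>+\<omega>. nexp (\<Sum>i. g n (X i \<omega>)) \<partial>M) \<longlonglongrightarrow> (\<integral>\<^sup>+\<omega>. nexp (\<Sum>i. u (X i \<omega>)) \<partial>M)"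
  proof (rule nn_integral_dominated_convergence[where w="\<lambda>_. 1"])
    show "AE \<omega> in M. (\<lambda>n. nexp (\<Sum>i. g n (X i \<omega>))) \<longlonglongrightarrow> nexp (\<Sum>i. u (X i \<omega>))"
      by (intro AE_I2 tendsto_nexp lim_sum)
  qed (auto simp: nexp_le_1 emeasure_space_1)
  moreover have "(\<lambda>n. nexp (ennreal dens * (\<integral>\<^sup>+x. 1 - nexp (g n x) \<partial>lborel)))
      \<longlonglongrightarrow> nexp (ennreal dens * (\<integral>\<^sup>+x. 1 - nexp (u x) \<partial>lborel))"
  proof (intro tendsto_nexp ennreal_tendsto_cmult nn_integral_LIMSEQ)
    show "incseq (\<lambda>n x. 1 - nexp (g n x))"
      using mono by (auto simp: incseq_def le_fun_def intro!: ennreal_minus_mono nexp_antimono)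
    show "(\<lambda>n. 1 - nexp (g n x)) \<longlonglongrightarrow> 1 - nexp (u x)" for x
      by (intro tendsto_diff_ennreal tendsto_const tendsto_nexp lim) auto
  qed auto
  moreover have "(\<integral>\<^sup>+\<omega>. nexp (\<Sum>i. g n (X i \<omega>)) \<partial>M) = nexp (ennreal dens * (\<integral>\<^sup>+x. 1 - nexp (g n x) \<partial>lborel))" for n
    by (rule laplace_functional_simple[OF gs _ dens, of "real n"]) (simp add: g_def)
  ultimately show ?thesis
    by (simp add: LIMSEQ_unique)
qed

end

subsection \<open>Independent marks\<close>

text \<open>Here \<open>\<omega>\<close> itself is regarded as a random variable with values in the
  sub-sigma-algebra N. The integrand may thus depend on infinitely many inputs at once while G is
  integrated out by Fubini.\<close>

lemma (in prob_space) nn_integral_indep_subalgebra: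
  assumes N: "space N = space M" "sets N \<subseteq> sets M" and G [measurable]: "G \<in> measurable M K"
    and indep: "\<And>A B. A \<in> sets N \<Longrightarrow> B \<in> sets K \<Longrightarrow>
      prob (A \<inter> (G -` B \<inter> space M)) = prob A * prob (G -` B \<inter> space M)"
    and f [measurable]: "f \<in> borel_measurable (N \<Otimes>\<^sub>M K)"
  shows "(\<integral>\<^sup>+\<omega>. f (\<omega>, G \<omega>) \<partial>M) = (\<integral>\<^sup>+\<omega>. \<integral>\<^sup>+g. f (\<omega>, g) \<partial>distr M K G \<partial>M)"
proof -
  have id [measurable]: "(\<lambda>\<omega>. \<omega>) \<in> measurable M N"
    using N by (auto intro!: measurableI dest: sets.sets_into_space)
  interpret D: prob_space "distr M K G" by (rule prob_space_distr) (rule G)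
  interpret D': prob_space "distr M N (\<lambda>\<omega>. \<omega>)" by (rule prob_space_distr) (rule id)
  have "distr M N (\<lambda>\<omega>. \<omega>) \<Otimes>\<^sub>M distr M K G = distr M (N \<Otimes>\<^sub>M K) (\<lambda>\<omega>. (\<omega>, G \<omega>))"
  proof (rule pair_measure_eqI)
    fix A B assume "A \<in> sets (distr M N (\<lambda>\<omega>. \<omega>))" "B \<in> sets (distr M K G)"
    then have [measurable]: "A \<in> sets N" "B \<in> sets K" by auto
    have "A \<in> sets M" using N \<open>A \<in> sets N\<close> by blast
    then have A: "A \<in> sets M" "A \<subseteq> space M" using sets.sets_into_space[of A M] by blast+
    have "emeasure (distr M (N \<Otimes>\<^sub>M K) (\<lambda>\<omega>. (\<omega>, G \<omega>))) (A \<times> B) = emeasure M (A \<inter> (G -` B \<inter> space M))"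
      using A by (subst emeasure_distr) (auto intro!: arg_cong[of _ _ "emeasure M"])
    also have "\<dots> = emeasure M A * emeasure M (G -` B \<inter> space M)"
      using indep[of A B] by (simp add: emeasure_eq_measure ennreal_mult)
    also have "\<dots> = emeasure (distr M N (\<lambda>\<omega>. \<omega>)) A * emeasure (distr M K G) B"
      using A by (simp add: emeasure_distr Int_absorb2)
    finally show "emeasure (distr M N (\<lambda>\<omega>. \<omega>)) A * emeasure (distr M K G) B
      = emeasure (distr M (N \<Otimes>\<^sub>M K) (\<lambda>\<omega>. (\<omega>, G \<omega>))) (A \<times> B)" ..
  qed (auto intro: sigma_finite_measure_axioms D.sigma_finite_measure_axioms D'.sigma_finite_measure_axioms)
  then have "(\<integral>\<^sup>+z. f z \<partial>distr M (N \<Otimes>\<^sub>M K) (\<lambda>\<omega>. (\<omega>, G \<omega>)))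
      = (\<integral>\<^sup>+z. f z \<partial>(distr M N (\<lambda>\<omega>. \<omega>) \<Otimes>\<^sub>M distr M K G))"
    by simp
  also have "\<dots> = (\<integral>\<^sup>+\<omega>. \<integral>\<^sup>+g. f (\<omega>, g) \<partial>distr M K G \<partial>distr M N (\<lambda>\<omega>. \<omega>))"
    by (rule D.nn_integral_fst[symmetric]) measurable
  also have "\<dots> = (\<integral>\<^sup>+\<omega>. \<integral>\<^sup>+g. f (\<omega>, g) \<partial>distr M K G \<partial>M)"
    by (subst nn_integral_distr) (auto intro!: D.borel_measurable_nn_integral)
  finally show ?thesis
    by (simp add: nn_integral_distr)
qed

text \<open>Independence is given for intersection-stable generators; collecting the two groups {k}
  and J lifts it to the sigma-algebra generated by J, as \<open>nn_integral_indep_subalgebra\<close>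
  asks.\<close>

lemma (in prob_space) nn_integral_indep_component:
  assumes indep: "indep_sets \<E> (insert k J)" and k: "k \<notin> J"
    and stable: "\<And>i. i \<in> insert k J \<Longrightarrow> Int_stable (\<E> i)"
    and G: "G \<in> measurable M K" "\<And>B. B \<in> sets K \<Longrightarrow> G -` B \<inter> space M \<in> \<E> k"
    and f: "f \<in> borel_measurable (sigma (space M) (\<Union>i\<in>J. \<E> i) \<Otimes>\<^sub>M K)"
  shows "(\<integral>\<^sup>+\<omega>. f (\<omega>, G \<omega>) \<partial>M) = (\<integral>\<^sup>+\<omega>. \<integral>\<^sup>+g. f (\<omega>, g) \<partial>distr M K G \<partial>M)"
proof (rule nn_integral_indep_subalgebra[OF _ _ G(1) _ f])
  let ?N = "sigma (space M) (\<Union>i\<in>J. \<E> i)"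
  have ev: "(\<Union>i\<in>J. \<E> i) \<subseteq> sets M"
    using indep by (auto simp: indep_sets_def)
  then have pow: "(\<Union>i\<in>J. \<E> i) \<subseteq> Pow (space M)"
    using sets.space_closed by blast
  then show "space ?N = space M" by simp
  show "sets ?N \<subseteq> sets M"
    using pow ev by (simp add: sets.sigma_sets_subset)
  fix A B assume A: "A \<in> sets ?N" and B: "B \<in> sets K"
  let ?I = "case_bool {k} J"
  have *: "indep_sets (\<lambda>j. sigma_sets (space M) (\<Union>i\<in>?I j. \<E> i)) UNIV"
  proof (rule indep_sets_collect_sigma)
    have "(\<Union>j. ?I j) = insert k J" by (auto simp: UNIV_bool)
    then show "indep_sets \<E> (\<Union>j. ?I j)" using indep by simp
    show "Int_stable (\<E> i)" if "i \<in> ?I j" for i j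
      using that stable by (auto split: bool.splits)
    show "disjoint_family_on ?I UNIV"
      using k by (auto simp: disjoint_family_on_def split: bool.splits)
  qed
  let ?A = "case_bool (G -` B \<inter> space M) A"
  have "prob (\<Inter>j\<in>UNIV. ?A j) = (\<Prod>j\<in>UNIV. prob (?A j))"
    using A G(2)[OF B] pow by (intro indep_setsD[OF *]) (auto split: bool.split intro: sigma_sets.Basic)
  then show "prob (A \<inter> (G -` B \<inter> space M)) = prob A * prob (G -` B \<inter> space M)"
    by (simp add: UNIV_bool Int_commute mult.commute)
qed

lemma Int_stable_generated_events: "Int_stable (generated_events M N f)"
proof (rule Int_stableI)
  fix a b assume "a \<in> generated_events M N f" "b \<in> generated_events M N f"
  then obtain A B where AB: "A \<in> sets N" "B \<in> sets N" "a = f -` A \<inter> space M" "b = f -` B \<inter> space M"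
    by (auto simp: generated_events_def)
  then have "a \<inter> b = f -` (A \<inter> B) \<inter> space M" by auto
  then show "a \<inter> b \<in> generated_events M N f"
    using AB by (auto simp: generated_events_def intro!: exI[of _ "A \<inter> B"])
qed

lemma measurable_sigma_generated:
  assumes "\<And>i. i \<in> J \<Longrightarrow> \<E> i \<subseteq> Pow (space M)" and "i \<in> J" and "generated_events M K f \<subseteq> \<E> i"
    and "f \<in> space M \<rightarrow> space K"
  shows "f \<in> measurable (sigma (space M) (\<Union>i\<in>J. \<E> i)) K"
proof (rule measurableI)
  have pow: "(\<Union>i\<in>J. \<E> i) \<subseteq> Pow (space M)" using assms by blast
  show "f x \<in> space K" if "x \<in> space (sigma (space M) (\<Union>i\<in>J. \<E> i))" for x
    using that assms(4) pow by (auto simp: space_measure_of)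
  fix B assume "B \<in> sets K"
  then have "f -` B \<inter> space M \<in> (\<Union>i\<in>J. \<E> i)"
    using assms(2,3) by (auto simp: generated_events_def)
  then show "f -` B \<inter> space (sigma (space M) (\<Union>i\<in>J. \<E> i)) \<in> sets (sigma (space M) (\<Union>i\<in>J. \<E> i))"
    using pow by simp
qed

lemma generated_events_component:
  "generated_events M (K i) (\<lambda>\<omega>. X i \<omega>) \<subseteq> generated_events M (\<Pi>\<^sub>M i\<in>UNIV. K i) (\<lambda>\<omega> i. X i \<omega>)"
  if "\<And>i. X i \<in> space M \<rightarrow> space (K i)"
proof
  fix a assume "a \<in> generated_events M (K i) (\<lambda>\<omega>. X i \<omega>)"
  then obtain B where B: "B \<in> sets (K i)" "a = X i -` B \<inter> space M"
    by (auto simp: generated_events_def)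
  let ?B = "(\<lambda>f. f i) -` B \<inter> space (\<Pi>\<^sub>M i\<in>UNIV. K i)"
  have "?B \<in> sets (\<Pi>\<^sub>M i\<in>UNIV. K i)"
    using B by (intro measurable_sets[OF measurable_component_singleton]) auto
  moreover have "a = (\<lambda>\<omega> i. X i \<omega>) -` ?B \<inter> space M"
    using B that by (auto simp: space_PiM PiE_iff)
  ultimately show "a \<in> generated_events M (\<Pi>\<^sub>M i\<in>UNIV. K i) (\<lambda>\<omega> i. X i \<omega>)"
    unfolding generated_events_def by blast
qed

text \<open>Common form of the stations and of the thinned devices. The index \<open>None\<close>
  stands for the whole enumeration of points and \<open>Some i\<close> for the i-th mark, so the
  marks are independent of the labelling as well as of the positions.\<close>

locale marked_ppp = homogeneous_ppp M dens X
  for M :: "'w measure" and dens :: real and X :: "nat \<Rightarrow> 'w \<Rightarrow> real^2" +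
  fixes G :: "nat \<Rightarrow> 'w \<Rightarrow> real" and law :: "real measure"
  assumes dens_nonneg: "0 \<le> dens"
    and G_measurable [measurable]: "\<And>i. G i \<in> borel_measurable M"
    and G_law: "\<And>i. distr M borel (G i) = law"
    and independent_marks: "indep_sets (\<lambda>c. case c of
          None \<Rightarrow> generated_events M (\<Pi>\<^sub>M i\<in>UNIV. borel) (\<lambda>\<omega> i. X i \<omega>)
        | Some i \<Rightarrow> generated_events M borel (G i)) UNIV"
begin

lemma sets_law [measurable_cong]: "sets law = sets borel"
  using G_law[of 0] by auto

sublocale law: prob_space law
  unfolding G_law[of 0, symmetric] by (rule prob_space_distr) simp

text \<open>The marks are integrated out one after another. \<open>Z m\<close> has its first m
  factors averaged; in the step everything except mark m is frozen, being measurable with respect to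
  the other components.\<close>

lemma laplace_marked_finite:
  assumes q [measurable]: "q \<in> borel_measurable (borel \<Otimes>\<^sub>M borel)"
  shows "(\<integral>\<^sup>+\<omega>. (\<Prod>i<n. nexp (q (X i \<omega>, G i \<omega>))) \<partial>M)
    = (\<integral>\<^sup>+\<omega>. (\<Prod>i<n. \<integral>\<^sup>+g. nexp (q (X i \<omega>, g)) \<partial>law) \<partial>M)"
proof -
  define h where "h x = (\<integral>\<^sup>+g. nexp (q (x, g)) \<partial>law)" for x
  have [measurable]: "h \<in> borel_measurable borel"
    unfolding h_def by (rule law.borel_measurable_nn_integral) measurable
  define Z where "Z m \<omega> = (\<Prod>i<m. h (X i \<omega>)) * (\<Prod>i=m..<n. nexp (q (X i \<omega>, G i \<omega>)))" for m \<omega>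
  have "(\<integral>\<^sup>+\<omega>. Z 0 \<omega> \<partial>M) = (\<integral>\<^sup>+\<omega>. Z m \<omega> \<partial>M)" if "m \<le> n" for m
    using that
  proof (induction m)
    case (Suc m)
    define \<E> where "\<E> c = (case c of None \<Rightarrow> generated_events M (\<Pi>\<^sub>M i\<in>UNIV. borel) (\<lambda>\<omega> i. X i \<omega>)
        | Some i \<Rightarrow> generated_events M borel (G i))" for c
    define J where "J = - {Some m}"
    define N where "N = sigma (space M) (\<Union>i\<in>J. \<E> i)"
    have pow: "\<E> i \<subseteq> Pow (space M)" for i
      by (auto simp: \<E>_def generated_events_def split: option.splits)
    have X_N [measurable]: "X i \<in> borel_measurable N" for i
      unfolding N_def
      using generated_events_component[of X M "\<lambda>_. borel" i]
      by (intro measurable_sigma_generated[of _ _ _ None] pow) (auto simp: J_def \<E>_def)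
    have G_N: "G i \<in> borel_measurable N" if "i \<noteq> m" for i
      unfolding N_def
      using that by (intro measurable_sigma_generated[of _ _ _ "Some i"] pow) (auto simp: J_def \<E>_def)
    define A where "A \<omega> = (\<Prod>i<m. h (X i \<omega>)) * (\<Prod>i=Suc m..<n. nexp (q (X i \<omega>, G i \<omega>)))" for \<omega>
    have "(\<lambda>\<omega>. \<Prod>i=Suc m..<n. nexp (q (X i \<omega>, G i \<omega>))) \<in> borel_measurable N"
    proof (rule borel_measurable_prod_ennreal)
      fix i assume "i \<in> {Suc m..<n}"
      then have [measurable]: "G i \<in> borel_measurable N" by (intro G_N) auto
      show "(\<lambda>\<omega>. nexp (q (X i \<omega>, G i \<omega>))) \<in> borel_measurable N" by measurable
    qed
    then have A_N [measurable]: "A \<in> borel_measurable N"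
      unfolding A_def by measurable
    define f where "f = (\<lambda>(\<omega>, g). A \<omega> * nexp (q (X m \<omega>, g)))"
    have fm: "f \<in> borel_measurable (N \<Otimes>\<^sub>M borel)" unfolding f_def by measurable
    have Z_m: "Z m \<omega> = f (\<omega>, G m \<omega>)" for \<omega>
      using Suc.prems by (simp add: Z_def A_def f_def prod.atLeast_Suc_lessThan mult_ac)
    have "(\<integral>\<^sup>+\<omega>. f (\<omega>, G m \<omega>) \<partial>M) = (\<integral>\<^sup>+\<omega>. \<integral>\<^sup>+g. f (\<omega>, g) \<partial>distr M borel (G m) \<partial>M)"
    proof (rule nn_integral_indep_component[where k="Some m" and J=J and \<E>=\<E>])
      have "insert (Some m) J = UNIV" by (auto simp: J_def)
      then show "indep_sets \<E> (insert (Some m) J)" using independent_marks by (simp add: \<E>_def[abs_def])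
      show "Int_stable (\<E> i)" for i
        by (auto simp: \<E>_def Int_stable_generated_events split: option.split)
      show "G m -` B \<inter> space M \<in> \<E> (Some m)" if "B \<in> sets borel" for B
        using that by (auto simp: \<E>_def generated_events_def)
    qed (use fm in \<open>auto simp: N_def J_def\<close>)
    also have "\<dots> = (\<integral>\<^sup>+\<omega>. Z (Suc m) \<omega> \<partial>M)"
      unfolding G_law f_def h_def Z_def A_def case_prod_conv
      by (subst nn_integral_cmult) (auto simp: h_def mult_ac)
    finally show ?case using Suc by (simp add: Z_m)
  qed simp
  from this[of n] show ?thesis
    by (simp add: Z_def h_def atLeast0LessThan)
qed

text \<open>The averaged factor h x lies in [0,1], so it is \<open>nexp (u x)\<close> for a suitable
  exponent u x, and the unmarked functional applies to u. Infinitely many marks are reached from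
  finite products, which are dominated by 1.\<close>

lemma laplace_marked:
  assumes q [measurable]: "q \<in> borel_measurable (borel \<Otimes>\<^sub>M borel)"
  shows "(\<integral>\<^sup>+\<omega>. nexp (\<Sum>i. q (X i \<omega>, G i \<omega>)) \<partial>M)
    = nexp (ennreal dens * (\<integral>\<^sup>+x. \<integral>\<^sup>+g. 1 - nexp (q (x, g)) \<partial>law \<partial>lborel))"
proof -
  note point_measurable[measurable]
  define h where "h x = (\<integral>\<^sup>+g. nexp (q (x, g)) \<partial>law)" for x
  have [measurable]: "h \<in> borel_measurable borel"
    unfolding h_def by (rule law.borel_measurable_nn_integral) measurable
  have h_le: "h x \<le> 1" for x
  proof -
    have "h x \<le> (\<integral>\<^sup>+g. 1 \<partial>law)" unfolding h_def by (intro nn_integral_mono) (simp add: nexp_le_1)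
    then show ?thesis by (simp add: law.emeasure_space_1)
  qed
  define u where "u x = nlog (enn2real (h x))" for x
  have [measurable]: "u \<in> borel_measurable borel" unfolding u_def by measurable
  have u: "nexp (u x) = h x" for x
    using h_le[of x] unfolding u_def
    by (subst nexp_nlog) (auto intro!: enn2real_leI simp: le_less_trans[OF h_le] top_unique less_top)
  have lim: "(\<lambda>n. \<integral>\<^sup>+\<omega>. (\<Prod>i<n. nexp (f i \<omega>)) \<partial>M) \<longlonglongrightarrow> (\<integral>\<^sup>+\<omega>. nexp (\<Sum>i. f i \<omega>) \<partial>M)"
    if [measurable]: "\<And>i. f i \<in> borel_measurable M" for f :: "nat \<Rightarrow> 'w \<Rightarrow> ennreal"
  proof (rule nn_integral_dominated_convergence[where w="\<lambda>_. 1"])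
    show "AE \<omega> in M. (\<lambda>n. \<Prod>i<n. nexp (f i \<omega>)) \<longlonglongrightarrow> nexp (\<Sum>i. f i \<omega>)"
      by (intro AE_I2 nexp_suminf)
  qed (auto simp: nexp_sum[symmetric] nexp_le_1 emeasure_space_1)
  have "(\<integral>\<^sup>+\<omega>. nexp (\<Sum>i. q (X i \<omega>, G i \<omega>)) \<partial>M) = (\<integral>\<^sup>+\<omega>. nexp (\<Sum>i. u (X i \<omega>)) \<partial>M)"
    by (rule LIMSEQ_unique[OF lim]) (use lim[of "\<lambda>i \<omega>. u (X i \<omega>)"] in \<open>simp_all add: laplace_marked_finite u h_def\<close>)
  also have "\<dots> = nexp (ennreal dens * (\<integral>\<^sup>+x. 1 - nexp (u x) \<partial>lborel))"
    by (rule laplace_functional[OF _ dens_nonneg]) simp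
  also have "(\<lambda>x. 1 - nexp (u x)) = (\<lambda>x. \<integral>\<^sup>+g. 1 - nexp (q (x, g)) \<partial>law)"
  proof -
    have "h x \<noteq> top" for x using h_le[of x] by (auto simp: top_unique)
    then show ?thesis
      unfolding u h_def by (subst nn_integral_diff) (auto simp: nexp_le_1 law.emeasure_space_1)
  qed
  finally show ?thesis .
qed

end

subsection \<open>Radial integration and integrals over the half-line\<close>

text \<open>Discs have area proportional to the squared radius, so
  \<open>c * (norm x)\<^sup>2\<close> pushes planar Lebesgue measure forward to pi / c times
  Lebesgue measure on the half-line.\<close>

lemma nn_integral_radial:
  fixes H :: "real \<Rightarrow> ennreal"
  assumes [measurable]: "H \<in> borel_measurable borel" and c: "0 < c"
  shows "(\<integral>\<^sup>+x. H (c * (norm (x :: real^2))\<^sup>2) \<partial>lborel) = ennreal (pi / c) * (\<integral>\<^sup>+w. H w * indicator {0<..} w \<partial>lborel)"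
proof -
  \<comment> \<open>Signs are reversed so that the upward rays \<open>{z<..}\<close>, on which the
    two measures are compared, correspond to discs of finite area.\<close>
  define D1 where "D1 = distr lborel borel (\<lambda>x :: real^2. - (c * (norm x)\<^sup>2))"
  define D2 where "D2 = density lborel (\<lambda>w :: real. ennreal (pi / c) * indicator {..<0} w)"
  have e1: "emeasure D1 {z<..} = ennreal (pi / c) * ennreal (max 0 (- z))" for z
  proof -
    have "emeasure D1 {z<..} = emeasure lborel {x :: real^2. c * (norm x)\<^sup>2 < - z}"
      unfolding D1_def by (subst emeasure_distr) (auto intro!: arg_cong[of _ _ "emeasure lborel"])
    also have "\<dots> = ennreal (pi / c) * ennreal (max 0 (- z))"
    proof (cases "z < 0")
      case True
      have "c * (norm x)\<^sup>2 < - z \<longleftrightarrow> norm x < sqrt (- z / c)" for x :: "real^2"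
      proof -
        have "c * (norm x)\<^sup>2 < - z \<longleftrightarrow> (norm x)\<^sup>2 < - z / c" using c by (simp add: field_simps)
        also have "\<dots> \<longleftrightarrow> norm x < sqrt (- z / c)"
          by (metis norm_ge_zero real_sqrt_abs2 real_sqrt_less_iff abs_of_nonneg power2_eq_square)
        finally show ?thesis .
      qed
      then have "{x :: real^2. c * (norm x)\<^sup>2 < - z} = ball 0 (sqrt (- z / c))"
        by (intro set_eqI) (simp only: mem_Collect_eq mem_ball_0)
      moreover have "emeasure lborel (ball (0 :: real^2) (sqrt (- z / c))) = ennreal (pi * (sqrt (- z / c))\<^sup>2)"
        using True c by (subst emeasure_ball) (simp_all add: unit_ball_vol_2 field_simps)
      moreover have "pi * (sqrt (- z / c))\<^sup>2 = pi / c * max 0 (- z)"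
        using True c by (subst real_sqrt_pow2) (auto simp: field_simps max_def)
      ultimately show ?thesis
        using True c by (metis divide_nonneg_nonneg ennreal_mult less_imp_le max.cobounded1 pi_ge_zero)
    next
      case False
      have "0 \<le> c * (norm x)\<^sup>2" for x :: "real^2" using c by simp
      then have "\<not> c * (norm x)\<^sup>2 < - z" for x :: "real^2"
        using False by (smt (verit))
      then show ?thesis using False by (simp add: max_def)
    qed
    finally show ?thesis .
  qed
  have e2: "emeasure D2 {z<..} = ennreal (pi / c) * ennreal (max 0 (- z))" for z
  proof -
    have "emeasure D2 {z<..} = (\<integral>\<^sup>+w. ennreal (pi / c) * indicator {z<..<0} w \<partial>lborel)"
      unfolding D2_def by (subst emeasure_density) (auto intro!: nn_integral_cong split: split_indicator)
    also have "\<dots> = ennreal (pi / c) * ennreal (max 0 (- z))"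
      by (subst nn_integral_cmult_indicator) (auto simp: max_def)
    finally show ?thesis .
  qed
  have "D1 = D2"
  proof (rule measure_eqI_lessThan)
    show "emeasure D1 {z<..} < \<infinity>" for z
      unfolding e1 by (simp add: ennreal_mult_less_top)
  qed (auto simp: e1 e2, auto simp: D1_def D2_def)
  have "(\<integral>\<^sup>+x. H (c * (norm (x :: real^2))\<^sup>2) \<partial>lborel) = (\<integral>\<^sup>+w. H (- w) \<partial>D1)"
    unfolding D1_def by (subst nn_integral_distr) auto
  also have "\<dots> = (\<integral>\<^sup>+w. ennreal (pi / c) * (H (- w) * indicator {..<0} w) \<partial>lborel)"
    unfolding \<open>D1 = D2\<close> D2_def by (subst nn_integral_density) (auto simp: mult_ac)
  also have "\<dots> = ennreal (pi / c) * (\<integral>\<^sup>+w. H (- w) * indicator {..<0} w \<partial>lborel)"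
    by (rule nn_integral_cmult) measurable
  also have "(\<integral>\<^sup>+w. H (- w) * indicator {..<0} w \<partial>lborel) = (\<integral>\<^sup>+w. H w * indicator {0<..} w \<partial>lborel)"
    by (subst nn_integral_real_affine[where c="-1" and t=0]) (auto intro!: nn_integral_cong split: split_indicator)
  finally show ?thesis .
qed

lemma nn_integral_half_line_scale:
  fixes f :: "real \<Rightarrow> ennreal"
  assumes [measurable]: "f \<in> borel_measurable borel" and c: "0 < c"
  shows "(\<integral>\<^sup>+w. f (c * w) * indicator {0<..} w \<partial>lborel) = ennreal (1 / c) * (\<integral>\<^sup>+w. f w * indicator {0<..} w \<partial>lborel)"
proof -
  have "(\<integral>\<^sup>+w. f w * indicator {0<..} w \<partial>lborel) = ennreal c * (\<integral>\<^sup>+w. f (c * w) * indicator {0<..} w \<partial>lborel)"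
    using c by (subst nn_integral_real_affine[where c=c and t=0])
      (auto intro!: arg_cong2[of _ _ _ _ "(*)"] nn_integral_cong split: split_indicator simp: zero_less_mult_iff)
  then show ?thesis
    using c by (simp add: mult.assoc[symmetric] ennreal_mult[symmetric])
qed

text \<open>Write 1 - exp (- y) as the integral of exp (- t) over [0, y] with y =
  \<open>w powr (- 1 / al)\<close> and exchange the integrals: the w > 0 with y \<ge> t form an
  interval of length \<open>t powr (- al)\<close>, which leaves the Gamma integral at 1 - al.
  General s is a rescaling of w by \<open>s powr (- al)\<close>.\<close>

lemma nn_integral_one_minus_nexp_powr:
  assumes al: "0 < al" "al < 1" and s: "0 < s"
  shows "(\<integral>\<^sup>+w. (1 - nexp (ennreal (s * w powr (- 1 / al)))) * indicator {0<..} w \<partial>lborel)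
    = ennreal (Gamma (1 - al) * s powr al)"
proof -
  define f where "f w = 1 - nexp (ennreal (w powr (- 1 / al)))" for w :: real
  have [measurable]: "f \<in> borel_measurable borel" unfolding f_def by measurable
  have layer: "f w * indicator {0<..} w
      = (\<integral>\<^sup>+t. ennreal (exp (- t)) * indicator {0<..} t * indicator {0<..t powr (- al)} w \<partial>lborel)" for w
  proof (cases "0 < w")
    case True
    have iff: "t \<le> w powr (- 1 / al) \<longleftrightarrow> w \<le> t powr (- al)" if t: "0 < t" for t
    proof -
      have y: "0 < w powr (- 1 / al)" using True by simp
      have "t \<le> w powr (- 1 / al) \<longleftrightarrow> (w powr (- 1 / al)) powr (- al) \<le> t powr (- al)"
      proof
        assume "t \<le> w powr (- 1 / al)"
        then show "(w powr (- 1 / al)) powr (- al) \<le> t powr (- al)"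
          using al t by (intro powr_mono2') auto
      next
        assume *: "(w powr (- 1 / al)) powr (- al) \<le> t powr (- al)"
        show "t \<le> w powr (- 1 / al)"
        proof (rule ccontr)
          assume "\<not> t \<le> w powr (- 1 / al)"
          then have "t powr (- al) < (w powr (- 1 / al)) powr (- al)"
            using al y by (intro powr_less_mono2_neg) auto
          then show False using * by simp
        qed
      qed
      then show ?thesis using True al by (simp add: powr_powr)
    qed
    have "f w = (\<integral>\<^sup>+t. ennreal (exp (- t)) * indicator {0..w powr (- 1 / al)} t \<partial>lborel)"
      by (subst nn_integral_FTC_Icc[where F="\<lambda>t. - exp (- t)"])
        (auto intro!: derivative_eq_intros simp: f_def nexp_ennreal ennreal_minus simp flip: ennreal_1)
    also have "\<dots> = (\<integral>\<^sup>+t. ennreal (exp (- t)) * indicator {0<..} t * indicator {0<..t powr (- al)} w \<partial>lborel)"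
    proof (rule nn_integral_cong_AE)
      have "AE t in lborel. t \<noteq> (0::real)" by (rule AE_lborel_singleton)
      then show "AE t in lborel. ennreal (exp (- t)) * indicator {0..w powr (- 1 / al)} t
          = ennreal (exp (- t)) * indicator {0<..} t * indicator {0<..t powr (- al)} w"
        by eventually_elim (use True iff in \<open>auto split: split_indicator\<close>)
    qed
    finally show ?thesis using True by simp
  qed auto
  have "(\<integral>\<^sup>+w. f w * indicator {0<..} w \<partial>lborel)
      = (\<integral>\<^sup>+t. \<integral>\<^sup>+w. ennreal (exp (- t)) * indicator {0<..} t * indicator {0<..t powr (- al)} w \<partial>lborel \<partial>lborel)"
    unfolding layer by (rule lborel_pair.Fubini') (measurable, unfold greaterThanAtMost_iff, measurable)
  also have "\<dots> = (\<integral>\<^sup>+t. ennreal (indicator {0..} t * t powr ((1 - al) - 1) / exp t) \<partial>lborel)"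
  proof (rule nn_integral_cong_AE)
    have "AE t in lborel. t \<noteq> (0::real)" by (rule AE_lborel_singleton)
    then show "AE t in lborel. (\<integral>\<^sup>+w. ennreal (exp (- t)) * indicator {0<..} t * indicator {0<..t powr (- al)} w \<partial>lborel)
      = ennreal (indicator {0..} t * t powr ((1 - al) - 1) / exp t)"
      by eventually_elim (auto simp: nn_integral_cmult_indicator ennreal_mult[symmetric] exp_minus divide_inverse mult.commute split: split_indicator)
  qed
  also have "\<dots> = ennreal (Gamma (1 - al))"
    using al by (intro Gamma_conv_nn_integral_real[symmetric]) simp
  finally have 1: "(\<integral>\<^sup>+w. f w * indicator {0<..} w \<partial>lborel) = ennreal (Gamma (1 - al))" .
  define c where "c = s powr (- al)"
  have c: "0 < c" using s by (simp add: c_def)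
  have "(\<integral>\<^sup>+w. (1 - nexp (ennreal (s * w powr (- 1 / al)))) * indicator {0<..} w \<partial>lborel)
      = (\<integral>\<^sup>+w. f (c * w) * indicator {0<..} w \<partial>lborel)"
    using s al by (intro nn_integral_cong) (auto simp: f_def c_def powr_mult powr_powr split: split_indicator)
  also have "\<dots> = ennreal (1 / c) * ennreal (Gamma (1 - al))"
    using c by (simp add: nn_integral_half_line_scale 1)
  also have "\<dots> = ennreal (Gamma (1 - al) * s powr al)"
    using s al by (simp add: c_def powr_minus ennreal_mult mult.commute less_imp_le Gamma_real_pos divide_inverse)
  finally show ?thesis .
qed

subsection \<open>The propagation process on the half-line\<close>

text \<open>A signal \<open>g / path_loss \<kappa> \<beta> \<bar>x\<bar>\<close> equals \<open>w powr (- \<beta> / 2)\<close> for \<open>w = prop_loss \<kappa> (2 / \<beta>) x g\<close>.  The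
  marked process becomes a homogeneous Poisson process on \<open>{0<..}\<close> in the coordinate \<open>w\<close>; points with
  mark \<open>0\<close> have \<open>w = 0\<close> by the convention for division by zero, hence the condition \<open>q 0 = 0\<close>.\<close>

definition prop_loss :: "real \<Rightarrow> real \<Rightarrow> real^2 \<Rightarrow> real \<Rightarrow> real" where
  "prop_loss \<kappa> \<alpha> x g = \<kappa>\<^sup>2 * (norm x)\<^sup>2 / g powr \<alpha>"

text \<open>For a fixed mark g > 0 the radial substitution with c =
  \<open>\<kappa>\<^sup>2 / g powr \<alpha>\<close> gives
  \<open>pi * g powr \<alpha> / \<kappa>\<^sup>2\<close> times an integral independent of g. Thus
  the mark law enters through its moment of order \<alpha>, which is the origin of the propagation
  constants.\<close>

lemma (in marked_ppp) laplace_prop_loss: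
  assumes \<kappa>: "0 < \<kappa>" and pos: "AE g in law. 0 \<le> g"
    and q [measurable]: "q \<in> borel_measurable borel" and q0: "q 0 = 0"
  shows "(\<integral>\<^sup>+\<omega>. nexp (\<Sum>i. q (prop_loss \<kappa> \<alpha> (X i \<omega>) (G i \<omega>))) \<partial>M)
    = nexp (ennreal (dens * pi / \<kappa>\<^sup>2) * (\<integral>\<^sup>+g. ennreal (g powr \<alpha>) \<partial>law)
        * (\<integral>\<^sup>+w. (1 - nexp (q w)) * indicator {0<..} w \<partial>lborel))"
proof -
  interpret P: pair_sigma_finite lborel law ..
  let ?I = "\<integral>\<^sup>+w. (1 - nexp (q w)) * indicator {0<..} w \<partial>lborel"
  define Q where "Q = (\<lambda>z. q (prop_loss \<kappa> \<alpha> (fst z) (snd z)))"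
  have [measurable]: "Q \<in> borel_measurable (borel \<Otimes>\<^sub>M borel)"
    unfolding Q_def prop_loss_def by measurable
  have "(\<integral>\<^sup>+\<omega>. nexp (\<Sum>i. Q (X i \<omega>, G i \<omega>)) \<partial>M)
      = nexp (ennreal dens * (\<integral>\<^sup>+x. \<integral>\<^sup>+g. 1 - nexp (Q (x, g)) \<partial>law \<partial>lborel))"
    by (rule laplace_marked) simp
  also have "(\<integral>\<^sup>+x. \<integral>\<^sup>+g. 1 - nexp (Q (x, g)) \<partial>law \<partial>lborel) = (\<integral>\<^sup>+g. \<integral>\<^sup>+x. 1 - nexp (Q (x, g)) \<partial>lborel \<partial>law)"
    by (rule P.Fubini'[symmetric]) measurable
  also have "\<dots> = (\<integral>\<^sup>+g. ennreal (pi / \<kappa>\<^sup>2) * ?I * ennreal (g powr \<alpha>) \<partial>law)"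
  proof (rule nn_integral_cong_AE, use pos in eventually_elim)
    fix g :: real assume g: "0 \<le> g"
    show "(\<integral>\<^sup>+x. 1 - nexp (Q (x, g)) \<partial>lborel) = ennreal (pi / \<kappa>\<^sup>2) * ?I * ennreal (g powr \<alpha>)"
    proof (cases "g = 0")
      case True
      then show ?thesis by (simp add: Q_def prop_loss_def q0)
    next
      case False
      define c where "c = \<kappa>\<^sup>2 / g powr \<alpha>"
      have c: "0 < c" using \<kappa> g False by (simp add: c_def)
      have "(\<integral>\<^sup>+x. 1 - nexp (Q (x, g)) \<partial>lborel) = (\<integral>\<^sup>+x. 1 - nexp (q (c * (norm (x :: real^2))\<^sup>2)) \<partial>lborel)"
        by (simp add: Q_def prop_loss_def c_def)
      also have "\<dots> = ennreal (pi / c) * ?I"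
        by (rule nn_integral_radial[where H="\<lambda>w. 1 - nexp (q w)"]) (use c in auto)
      also have "ennreal (pi / c) = ennreal (pi / \<kappa>\<^sup>2) * ennreal (g powr \<alpha>)"
        by (simp add: c_def ennreal_mult[symmetric])
      finally show ?thesis by (simp add: mult_ac)
    qed
  qed
  also have "\<dots> = ennreal (pi / \<kappa>\<^sup>2) * ?I * (\<integral>\<^sup>+g. ennreal (g powr \<alpha>) \<partial>law)"
    by (rule nn_integral_cmult) measurable
  also have "ennreal dens * \<dots> = ennreal (dens * pi / \<kappa>\<^sup>2) * (\<integral>\<^sup>+g. ennreal (g powr \<alpha>) \<partial>law) * ?I"
  proof -
    have "ennreal (dens * pi / \<kappa>\<^sup>2) = ennreal dens * ennreal (pi / \<kappa>\<^sup>2)"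
      using dens_nonneg by (simp add: ennreal_mult[symmetric])
    then show ?thesis by (simp only: mult_ac)
  qed
  finally show ?thesis by (simp add: Q_def)
qed

subsection \<open>Independence and Laplace transforms in the network\<close>

text \<open>Groups matching the variables to be separated: the two interferences belong to the first
  two groups, and the mark of the typical device must be independent of both together.\<close>

datatype side = Station_Side | Device_Side | Typical_Side

fun side_components :: "side \<Rightarrow> component set" where
  "side_components Station_Side = insert Station_Points (range Station_Mark)"
| "side_components Device_Side = insert Device_Points (range Device_Mark \<union> range Device_Active)"
| "side_components Typical_Side = {Typical_Mark}"

locale d2d_model = d2d_network M dens_B dens_D X Y \<beta> mark_law F E active E0
  for M :: "'w measure" and dens_B dens_D X Y \<beta> mark_law F E active E0 +
  fixes \<kappa> \<alpha> :: real
  assumes beta: "2 < \<beta>" and kappa: "0 < \<kappa>" and dens_B: "0 < dens_B" and dens_D: "0 < dens_D"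
    and alpha_eq: "\<alpha> = 2 / \<beta>"
begin

lemma alpha: "0 < \<alpha>" "\<alpha> < 1"
  using beta by (auto simp: alpha_eq)

definition component_events :: "real \<Rightarrow> component \<Rightarrow> 'w set set" where
  "component_events p c = (case c of
      Station_Points \<Rightarrow> generated_events M (\<Pi>\<^sub>M i\<in>UNIV. borel) (\<lambda>\<omega> i. X i \<omega>)
    | Station_Mark i \<Rightarrow> generated_events M borel (F i)
    | Device_Points \<Rightarrow> generated_events M (\<Pi>\<^sub>M i\<in>UNIV. borel) (\<lambda>\<omega> i. Y i \<omega>)
    | Device_Mark j \<Rightarrow> generated_events M borel (E j)
    | Device_Active j \<Rightarrow> generated_events M (count_space UNIV) (active p j)
    | Typical_Mark \<Rightarrow> generated_events M borel E0)"

definition side_events :: "real \<Rightarrow> side \<Rightarrow> 'w set set" where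
  "side_events p s = sigma_sets (space M) (\<Union>c\<in>side_components s. component_events p c)"

lemma X_measurable [measurable]: "X i \<in> borel_measurable M"
  by (rule stations.point_measurable)

lemma Y_measurable [measurable]: "Y i \<in> borel_measurable M"
  by (rule devices.point_measurable)

lemmas [measurable] = F_measurable

lemma E_measurable [measurable]: "E j \<in> borel_measurable M"
  using E_exponential[of j] by (simp add: distributed_def)

lemma E0_measurable [measurable]: "E0 \<in> borel_measurable M"
  using E0_exponential by (simp add: distributed_def)

lemma component_events_Pow: "component_events p c \<subseteq> Pow (space M)"
  by (auto simp: component_events_def generated_events_def split: component.splits)

lemma Int_stable_component_events: "Int_stable (component_events p c)"
  by (auto simp: component_events_def Int_stable_generated_events split: component.splits)

lemma indep_component_events: "p \<in> {0..1} \<Longrightarrow> stations.indep_sets (component_events p) UNIV"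
  using independence[of p] by (simp add: component_events_def[abs_def])

lemma indep_groups:
  assumes p: "p \<in> {0..1}" and "disjoint_family I"
  shows "stations.indep_sets (\<lambda>j. sigma_sets (space M) (\<Union>c\<in>I j. component_events p c)) UNIV"
proof (rule stations.indep_sets_collect_sigma)
  show "stations.indep_sets (component_events p) (\<Union>j. I j)"
    using indep_component_events[OF p] by (rule stations.indep_sets_mono_index[rotated]) simp
qed (rule Int_stable_component_events, fact)

lemma indep_side_events: "p \<in> {0..1} \<Longrightarrow> stations.indep_sets (side_events p) UNIV"
  unfolding side_events_def[abs_def]
proof (rule indep_groups)
  have "side_components s \<inter> side_components t = {}" if "s \<noteq> t" for s t
    using that by (cases s; cases t; auto)
  then show "disjoint_family side_components"
    by (auto simp: disjoint_family_on_def)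
qed

lemma component_subset_side: "c \<in> side_components s \<Longrightarrow> component_events p c \<subseteq> side_events p s"
  unfolding side_events_def by (intro subsetI sigma_sets.Basic UN_I)

lemma side_events_Pow: "side_events p s \<subseteq> Pow (space M)"
proof
  fix A assume "A \<in> side_events p s"
  moreover have "(\<Union>c\<in>side_components s. component_events p c) \<subseteq> Pow (space M)"
    using component_events_Pow by blast
  ultimately show "A \<in> Pow (space M)"
    unfolding side_events_def by (auto dest: sigma_sets_into_sp)
qed

lemma Int_stable_side_events: "Int_stable (side_events p s)"
proof -
  interpret sigma_algebra "space M" "side_events p s"
    unfolding side_events_def using component_events_Pow by (intro sigma_algebra_sigma_sets) blast
  show ?thesis by (auto simp: Int_stable_def)
qed

abbreviation side_algebra :: "real \<Rightarrow> side set \<Rightarrow> 'w measure" where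
  "side_algebra p J \<equiv> sigma (space M) (\<Union>s\<in>J. side_events p s)"

lemma measurable_side_algebra:
  assumes "generated_events M K f \<subseteq> component_events p c" "c \<in> side_components s" "s \<in> J"
    and "f \<in> space M \<rightarrow> space K"
  shows "f \<in> measurable (side_algebra p J) K"
proof (rule measurable_sigma_generated[of _ _ _ s])
  show "generated_events M K f \<subseteq> side_events p s"
    using assms(1) component_subset_side[OF assms(2)] by (rule order_trans)
qed (rule side_events_Pow, rule assms(3), rule assms(4))

lemma stations_side_measurable:
  assumes "Station_Side \<in> J"
  shows "X i \<in> borel_measurable (side_algebra p J)" "F i \<in> borel_measurable (side_algebra p J)"
proof -
  show "X i \<in> borel_measurable (side_algebra p J)"
    using generated_events_component[of X M "\<lambda>_. borel" i]
    by (intro measurable_side_algebra[OF _ _ assms, where c=Station_Points]) (simp_all add: component_events_def)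
  show "F i \<in> borel_measurable (side_algebra p J)"
    by (intro measurable_side_algebra[OF _ _ assms, where c="Station_Mark i"]) (simp_all add: component_events_def)
qed

lemma devices_side_measurable:
  assumes "Device_Side \<in> J"
  shows "Y i \<in> borel_measurable (side_algebra p J)" "E i \<in> borel_measurable (side_algebra p J)"
    "active p i \<in> measurable (side_algebra p J) (count_space UNIV)"
proof -
  show "Y i \<in> borel_measurable (side_algebra p J)"
    using generated_events_component[of Y M "\<lambda>_. borel" i]
    by (intro measurable_side_algebra[OF _ _ assms, where c=Device_Points]) (simp_all add: component_events_def)
  show "E i \<in> borel_measurable (side_algebra p J)"
    by (intro measurable_side_algebra[OF _ _ assms, where c="Device_Mark i"]) (simp_all add: component_events_def)
  show "active p i \<in> measurable (side_algebra p J) (count_space UNIV)"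
    by (intro measurable_side_algebra[OF _ _ assms, where c="Device_Active i"]) (simp_all add: component_events_def)
qed

lemma E0_side_measurable: "Typical_Side \<in> J \<Longrightarrow> E0 \<in> borel_measurable (side_algebra p J)"
  by (rule measurable_side_algebra[where c=Typical_Mark and s=Typical_Side]) (simp_all add: component_events_def)

abbreviation "IB \<equiv> interference_B \<kappa> \<beta> F X"
abbreviation "ID p \<equiv> interference_D \<kappa> \<beta> E Y active p"

lemma IB_side_measurable:
  assumes "Station_Side \<in> J"
  shows "IB \<in> borel_measurable (side_algebra p J)"
proof -
  note stations_side_measurable[OF assms, measurable]
  show ?thesis
    unfolding interference_B_def[abs_def] signal_def[abs_def] path_loss_def by measurable
qed

lemma ID_side_measurable:
  assumes "Device_Side \<in> J"
  shows "ID p \<in> borel_measurable (side_algebra p J)"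
proof -
  note devices_side_measurable[OF assms, measurable]
  show ?thesis
    unfolding interference_D_def[abs_def] signal_def[abs_def] path_loss_def by measurable
qed

lemma signal_measurable [measurable]:
  "signal \<kappa> \<beta> F X i \<in> borel_measurable M" "signal \<kappa> \<beta> E Y i \<in> borel_measurable M"
  unfolding signal_def[abs_def] path_loss_def by measurable

lemma IB_measurable [measurable]: "IB \<in> borel_measurable M"
  unfolding interference_B_def[abs_def] by measurable

lemma ID_measurable [measurable]:
  assumes "p \<in> {0..1}"
  shows "ID p \<in> borel_measurable M"
proof -
  note active_measurable[OF assms, measurable]
  show ?thesis unfolding interference_D_def[abs_def] by measurable
qed

lemma nn_integral_side:
  assumes p: "p \<in> {0..1}" and k: "k \<notin> J" and G [measurable]: "G \<in> measurable M K"
    and G_side: "G \<in> measurable (side_algebra p {k}) K"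
    and f: "f \<in> borel_measurable (side_algebra p J \<Otimes>\<^sub>M K)"
  shows "(\<integral>\<^sup>+\<omega>. f (\<omega>, G \<omega>) \<partial>M) = (\<integral>\<^sup>+\<omega>. \<integral>\<^sup>+g. f (\<omega>, g) \<partial>distr M K G \<partial>M)"
proof (rule stations.nn_integral_indep_component[OF _ k _ G _ f])
  show "stations.indep_sets (side_events p) (insert k J)"
    using indep_side_events[OF p] by (rule stations.indep_sets_mono_index[rotated]) simp
  show "G -` B \<inter> space M \<in> side_events p k" if "B \<in> sets K" for B
  proof -
    interpret sigma_algebra "space M" "side_events p k"
      unfolding side_events_def using component_events_Pow by (intro sigma_algebra_sigma_sets) blast
    have "G -` B \<inter> space (side_algebra p {k}) \<in> sets (side_algebra p {k})"
      by (rule measurable_sets[OF G_side that])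
    then show ?thesis
      using side_events_Pow by (simp add: sigma_sets_eq)
  qed
qed (rule Int_stable_side_events)

text \<open>Thinning is encoded by setting the mark of an inactive device to 0: its signal vanishes,
  while the underlying points remain the full process of density \<open>dens_D\<close>.\<close>

definition device_mark :: "real \<Rightarrow> nat \<Rightarrow> 'w \<Rightarrow> real" where
  "device_mark p j \<omega> = (if active p j \<omega> then E j \<omega> else 0)"

lemma device_mark_measurable [measurable]:
  assumes "p \<in> {0..1}"
  shows "device_mark p j \<in> borel_measurable M"
proof -
  note active_measurable[OF assms, measurable]
  show ?thesis unfolding device_mark_def[abs_def] by measurable
qed

text \<open>Mark and activity of one device are independent, so the law is a mixture of the
  exponential law and an atom at 0.\<close>

lemma nn_integral_device_mark:
  assumes p: "p \<in> {0..1}" and f [measurable]: "f \<in> borel_measurable borel"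
  shows "(\<integral>\<^sup>+\<omega>. f (device_mark p j \<omega>) \<partial>M)
    = ennreal p * (\<integral>\<^sup>+x. f x \<partial>density lborel (exponential_density 1)) + ennreal (1 - p) * f 0"
proof -
  note active_measurable[OF p, measurable]
  have E_law: "distr M borel (E j) = density lborel (exponential_density 1)"
    unfolding distributed_distr_eq_density[OF E_exponential[of j], symmetric] by (rule distr_cong) simp_all
  have "(\<integral>\<^sup>+\<omega>. f (device_mark p j \<omega>) \<partial>M) = (\<integral>\<^sup>+\<omega>. (\<lambda>(\<omega>, x). f (if active p j \<omega> then x else 0)) (\<omega>, E j \<omega>) \<partial>M)"
    by (simp add: device_mark_def)
  also have "\<dots> = (\<integral>\<^sup>+\<omega>. \<integral>\<^sup>+x. (\<lambda>(\<omega>, x). f (if active p j \<omega> then x else 0)) (\<omega>, x) \<partial>distr M borel (E j) \<partial>M)"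
  proof (rule stations.nn_integral_indep_component[where \<E>="component_events p" and k="Device_Mark j" and J="{Device_Active j}"])
    show "stations.indep_sets (component_events p) {Device_Mark j, Device_Active j}"
      using indep_component_events[OF p] by (rule stations.indep_sets_mono_index[rotated]) simp
    have [measurable]: "active p j \<in> measurable (sigma (space M) (\<Union>i\<in>{Device_Active j}. component_events p i)) (count_space UNIV)"
      by (rule measurable_sigma_generated[of _ _ _ "Device_Active j"])
        (rule component_events_Pow, simp_all add: component_events_def)
    show "(\<lambda>(\<omega>, x). f (if active p j \<omega> then x else 0))
        \<in> borel_measurable (sigma (space M) (\<Union>i\<in>{Device_Active j}. component_events p i) \<Otimes>\<^sub>M borel)"
      by measurable
  qed (auto simp: Int_stable_component_events, auto simp: component_events_def generated_events_def)
  also have "\<dots> = (\<integral>\<^sup>+\<omega>. (\<integral>\<^sup>+x. f x \<partial>density lborel (exponential_density 1)) * indicator {\<omega> \<in> space M. active p j \<omega>} \<omega>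
      + f 0 * indicator {\<omega> \<in> space M. \<not> active p j \<omega>} \<omega> \<partial>M)"
  proof (rule nn_integral_cong)
    fix \<omega> assume \<omega>: "\<omega> \<in> space M"
    have "(\<integral>\<^sup>+x. f 0 \<partial>distr M borel (E j)) = f 0"
      by (simp add: emeasure_distr stations.emeasure_space_1)
    then show "(\<integral>\<^sup>+x. (\<lambda>(\<omega>, x). f (if active p j \<omega> then x else 0)) (\<omega>, x) \<partial>distr M borel (E j))
      = (\<integral>\<^sup>+x. f x \<partial>density lborel (exponential_density 1)) * indicator {\<omega> \<in> space M. active p j \<omega>} \<omega>
      + f 0 * indicator {\<omega> \<in> space M. \<not> active p j \<omega>} \<omega>"
      using \<omega> by (cases "active p j \<omega>") (simp_all add: E_law)
  qed
  also have "\<dots> = (\<integral>\<^sup>+x. f x \<partial>density lborel (exponential_density 1)) * emeasure M {\<omega> \<in> space M. active p j \<omega>}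
      + f 0 * emeasure M {\<omega> \<in> space M. \<not> active p j \<omega>}"
    by (subst nn_integral_add) (auto simp: nn_integral_cmult_indicator)
  also have "emeasure M {\<omega> \<in> space M. active p j \<omega>} = ennreal p"
    using active_prob[OF p] by (simp add: stations.emeasure_eq_measure)
  also have "emeasure M {\<omega> \<in> space M. \<not> active p j \<omega>} = ennreal (1 - p)"
    using active_prob[OF p, of j] by (simp add: stations.emeasure_eq_measure stations.prob_neg)
  finally show ?thesis by (simp add: mult.commute)
qed

lemma device_mark_law:
  assumes p: "p \<in> {0..1}"
  shows "distr M borel (device_mark p j) = distr M borel (device_mark p 0)"
proof (rule measure_eqI)
  fix A :: "real set" assume "A \<in> sets (distr M borel (device_mark p j))"
  then have [measurable]: "A \<in> sets borel" by simp
  have "emeasure (distr M borel (device_mark p j)) A = (\<integral>\<^sup>+\<omega>. indicator A (device_mark p j \<omega>) \<partial>M)" for j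
    using device_mark_measurable[OF p, of j] by (subst nn_integral_distr[symmetric, where M'=borel]) auto
  then show "emeasure (distr M borel (device_mark p j)) A = emeasure (distr M borel (device_mark p 0)) A"
    by (simp add: nn_integral_device_mark[OF p])
qed simp

lemma marked_stations: "marked_ppp M dens_B X F mark_law"
proof
  let ?I = "case_option {Station_Points} (\<lambda>i. {Station_Mark i})"
  have "?I c \<inter> ?I d = {}" if "c \<noteq> d" for c d
    using that by (cases c; cases d) auto
  \<comment> \<open>The proportion 0 is an arbitrary choice: the station components are the same for
    every proportion.\<close>
  then have "stations.indep_sets (\<lambda>c. sigma_sets (space M) (\<Union>c\<in>?I c. component_events 0 c)) UNIV"
    by (intro indep_groups) (simp_all add: disjoint_family_on_def)
  then show "stations.indep_sets (\<lambda>c. case c of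
          None \<Rightarrow> generated_events M (\<Pi>\<^sub>M i\<in>UNIV. borel) (\<lambda>\<omega> i. X i \<omega>)
        | Some i \<Rightarrow> generated_events M borel (F i)) UNIV"
  proof (rule stations.indep_sets_mono_sets)
    show "(case c of None \<Rightarrow> generated_events M (\<Pi>\<^sub>M i\<in>UNIV. borel) (\<lambda>\<omega> i. X i \<omega>)
        | Some i \<Rightarrow> generated_events M borel (F i)) \<subseteq> sigma_sets (space M) (\<Union>c\<in>?I c. component_events 0 c)" for c
      by (cases c) (simp_all add: component_events_def subsetI sigma_sets.Basic)
  qed
qed (use dens_B F_law in auto)

lemma marked_devices:
  assumes p: "p \<in> {0..1}"
  shows "marked_ppp M dens_D Y (device_mark p) (distr M borel (device_mark p 0))"
proof
  \<comment> \<open>Mark and activity of device j share a group, because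
    \<open>device_mark p j\<close> depends on both.\<close>
  let ?I = "case_option {Device_Points} (\<lambda>j. {Device_Mark j, Device_Active j})"
  have "?I c \<inter> ?I d = {}" if "c \<noteq> d" for c d
    using that by (cases c; cases d) auto
  then have "stations.indep_sets (\<lambda>c. sigma_sets (space M) (\<Union>c\<in>?I c. component_events p c)) UNIV"
    by (intro indep_groups[OF p]) (simp add: disjoint_family_on_def)
  then show "stations.indep_sets (\<lambda>c. case c of
          None \<Rightarrow> generated_events M (\<Pi>\<^sub>M i\<in>UNIV. borel) (\<lambda>\<omega> i. Y i \<omega>)
        | Some j \<Rightarrow> generated_events M borel (device_mark p j)) UNIV"
  proof (rule stations.indep_sets_mono_sets)
    fix c :: "nat option"
    show "(case c of None \<Rightarrow> generated_events M (\<Pi>\<^sub>M i\<in>UNIV. borel) (\<lambda>\<omega> i. Y i \<omega>)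
        | Some j \<Rightarrow> generated_events M borel (device_mark p j))
      \<subseteq> sigma_sets (space M) (\<Union>c\<in>?I c. component_events p c)"
    proof (cases c)
      case None
      then show ?thesis by (simp add: component_events_def subsetI sigma_sets.Basic)
    next
      case (Some j)
      let ?N = "sigma (space M) (\<Union>c\<in>{Device_Mark j, Device_Active j}. component_events p c)"
      have pow: "(\<Union>c\<in>{Device_Mark j, Device_Active j}. component_events p c) \<subseteq> Pow (space M)"
        using component_events_Pow by blast
      have [measurable]: "active p j \<in> measurable ?N (count_space UNIV)"
        by (rule measurable_sigma_generated[of _ _ _ "Device_Active j"])
          (rule component_events_Pow, simp_all add: component_events_def)
      have [measurable]: "E j \<in> borel_measurable ?N"
        by (rule measurable_sigma_generated[of _ _ _ "Device_Mark j"])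
          (rule component_events_Pow, simp_all add: component_events_def)
      have "device_mark p j \<in> borel_measurable ?N"
        unfolding device_mark_def[abs_def] by measurable
      then have "device_mark p j -` B \<inter> space ?N \<in> sets ?N" if "B \<in> sets borel" for B
        using that by (rule measurable_sets)
      then show ?thesis
        using Some pow by (auto simp: generated_events_def)
    qed
  qed
qed (use dens_D p device_mark_law[OF p] in auto)

section \<open>Signals in the half-line coordinate and Laplace transforms of both
  interferences\<close>

abbreviation "aB \<equiv> prop_const_B \<kappa> \<beta> dens_B mark_law"
abbreviation "aD \<equiv> prop_const_D \<kappa> \<beta> dens_D"

definition station_loss :: "nat \<Rightarrow> 'w \<Rightarrow> real" where
  "station_loss i \<omega> = prop_loss \<kappa> \<alpha> (X i \<omega>) (F i \<omega>)"

lemma station_loss_side_measurable: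
  assumes "Station_Side \<in> J"
  shows "station_loss i \<in> borel_measurable (side_algebra p J)"
proof -
  note stations_side_measurable[OF assms, measurable]
  show ?thesis unfolding station_loss_def prop_loss_def by measurable
qed

lemma station_loss_measurable [measurable]: "station_loss i \<in> borel_measurable M"
  unfolding station_loss_def prop_loss_def by measurable

lemma signal_eq_prop_loss:
  assumes "0 \<le> G i \<omega>"
  shows "signal \<kappa> \<beta> G Z i \<omega> = ennreal (prop_loss \<kappa> \<alpha> (Z i \<omega>) (G i \<omega>) powr (- 1 / \<alpha>))"
\<comment> \<open>Both sides vanish here: by the conventions for division by zero and for powers of
  0, a zero mark or a point at the origin gives the signal 0.\<close>
proof (cases "G i \<omega> = 0 \<or> Z i \<omega> = 0")
  case True
  then show ?thesis using kappa by (auto simp: signal_def prop_loss_def path_loss_def)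
next
  case False
  define d where "d = \<kappa> * norm (Z i \<omega>)"
  have pos: "0 < G i \<omega>" "0 < d" using False assms kappa by (auto simp: d_def)
  have "prop_loss \<kappa> \<alpha> (Z i \<omega>) (G i \<omega>) powr (- 1 / \<alpha>) = (d powr 2 / G i \<omega> powr \<alpha>) powr (- 1 / \<alpha>)"
    using pos by (simp add: prop_loss_def d_def power_mult_distrib)
  also have "\<dots> = d powr (2 * (- 1 / \<alpha>)) / G i \<omega> powr (\<alpha> * (- 1 / \<alpha>))"
    using pos by (subst powr_divide) (simp_all only: powr_powr powr_ge_zero)
  also have "\<dots> = G i \<omega> / d powr \<beta>"
  proof -
    have "2 * (- 1 / \<alpha>) = - \<beta>" "\<alpha> * (- 1 / \<alpha>) = - 1" using beta by (simp_all add: alpha_eq)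
    then show ?thesis using pos by (simp only: powr_minus_divide powr_one) (simp add: field_simps)
  qed
  finally show ?thesis
    by (simp add: signal_def path_loss_def d_def)
qed

lemma F_nonneg: "AE \<omega> in M. \<forall>i. 0 < F i \<omega>"
proof -
  have "AE \<omega> in M. 0 < F i \<omega>" for i
    using F_pos unfolding F_law[of i, symmetric] by (rule AE_distrD[rotated]) (rule F_measurable)
  then show ?thesis by (simp add: AE_all_countable)
qed

lemma E_nonneg: "AE \<omega> in M. \<forall>j. 0 \<le> E j \<omega>"
proof -
  have "AE \<omega> in M. 0 \<le> E j \<omega>" for j
  proof -
    have "AE x in density lborel (exponential_density 1). 0 \<le> (x :: real)"
      by (subst AE_density) (auto simp: exponential_density_def)
    then show ?thesis
      unfolding distributed_distr_eq_density[OF E_exponential[of j], symmetric]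
      by (rule AE_distrD[rotated]) simp
  qed
  then show ?thesis by (simp add: AE_all_countable)
qed

lemma IB_eq: "AE \<omega> in M. IB \<omega> = (\<Sum>i. ennreal (station_loss i \<omega> powr (- 1 / \<alpha>)))"
  using F_nonneg by eventually_elim (simp add: interference_B_def station_loss_def signal_eq_prop_loss less_imp_le)

lemma laplace_stations:
  assumes [measurable]: "q \<in> borel_measurable borel" and q0: "q 0 = 0"
  shows "(\<integral>\<^sup>+\<omega>. nexp (\<Sum>i. q (station_loss i \<omega>)) \<partial>M)
    = nexp (ennreal aB * (\<integral>\<^sup>+w. (1 - nexp (q w)) * indicator {0<..} w \<partial>lborel))"
proof -
  interpret S: marked_ppp M dens_B X F mark_law by (rule marked_stations)
  have "(\<integral>\<^sup>+g. ennreal (g powr \<alpha>) \<partial>mark_law) = ennreal (LINT g|mark_law. g powr \<alpha>)"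
    using F_moment by (intro nn_integral_eq_integral) (auto simp: alpha_eq)
  then have "ennreal (dens_B * pi / \<kappa>\<^sup>2) * (\<integral>\<^sup>+g. ennreal (g powr \<alpha>) \<partial>mark_law) = ennreal aB"
    using dens_B by (simp add: ennreal_mult[symmetric] prop_const_B_def alpha_eq)
  moreover have "AE g in mark_law. 0 \<le> g" using F_pos by eventually_elim simp
  ultimately show ?thesis
    using S.laplace_prop_loss[OF kappa _ assms(1) q0, of \<alpha>] by (simp add: station_loss_def)
qed

lemma laplace_ID:
  assumes p: "p \<in> {0..1}" and s: "0 < s"
  shows "(\<integral>\<^sup>+\<omega>. nexp (ennreal s * ID p \<omega>) \<partial>M) = nexp (ennreal (p * aD * Gamma (1 - \<alpha>) * s powr \<alpha>))"
proof -
  interpret S: marked_ppp M dens_D Y "device_mark p" "distr M borel (device_mark p 0)"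
    by (rule marked_devices[OF p])
  define q where "q w = ennreal (s * w powr (- 1 / \<alpha>))" for w
  have [measurable]: "q \<in> borel_measurable borel" unfolding q_def by measurable
  have dm: "AE \<omega> in M. \<forall>j. 0 \<le> device_mark p j \<omega>"
    using E_nonneg by eventually_elim (auto simp: device_mark_def)
  have "AE g in distr M borel (device_mark p 0). 0 \<le> g"
    using dm p by (subst AE_distr_iff) (auto elim: eventually_mono)
  then have "(\<integral>\<^sup>+\<omega>. nexp (\<Sum>j. q (prop_loss \<kappa> \<alpha> (Y j \<omega>) (device_mark p j \<omega>))) \<partial>M)
    = nexp (ennreal (dens_D * pi / \<kappa>\<^sup>2) * (\<integral>\<^sup>+g. ennreal (g powr \<alpha>) \<partial>distr M borel (device_mark p 0))
        * (\<integral>\<^sup>+w. (1 - nexp (q w)) * indicator {0<..} w \<partial>lborel))"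
    using kappa by (intro S.laplace_prop_loss) (auto simp: q_def)
  \<comment> \<open>The atom at 0 carries no moment and the exponential law has moment
    \<open>Gamma (1 + \<alpha>)\<close>, so thinning appears as the factor p.\<close>
  also have "(\<integral>\<^sup>+g. ennreal (g powr \<alpha>) \<partial>distr M borel (device_mark p 0)) = ennreal (p * Gamma (1 + \<alpha>))"
  proof -
    have "(\<integral>\<^sup>+g. ennreal (g powr \<alpha>) \<partial>distr M borel (device_mark p 0))
        = ennreal p * (\<integral>\<^sup>+x. ennreal (x powr \<alpha>) \<partial>density lborel (exponential_density 1))"
      using p alpha nn_integral_device_mark[OF p, of "\<lambda>x. ennreal (x powr \<alpha>)" 0]
      by (subst nn_integral_distr) simp_all
    also have "(\<integral>\<^sup>+x. ennreal (x powr \<alpha>) \<partial>density lborel (exponential_density 1))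
        = (\<integral>\<^sup>+x. ennreal (indicator {0..} x * x powr ((1 + \<alpha>) - 1) / exp x) \<partial>lborel)"
      by (subst nn_integral_density)
        (auto simp: exponential_density_def ennreal_mult[symmetric] exp_minus divide_inverse mult.commute
          intro!: nn_integral_cong split: split_indicator)
    also have "\<dots> = ennreal (Gamma (1 + \<alpha>))"
      using alpha by (intro Gamma_conv_nn_integral_real[symmetric]) simp
    finally show ?thesis using p alpha by (simp add: ennreal_mult)
  qed
  also have "(\<integral>\<^sup>+w. (1 - nexp (q w)) * indicator {0<..} w \<partial>lborel) = ennreal (Gamma (1 - \<alpha>) * s powr \<alpha>)"
    unfolding q_def using alpha s by (rule nn_integral_one_minus_nexp_powr)
  also have "ennreal (dens_D * pi / \<kappa>\<^sup>2) * ennreal (p * Gamma (1 + \<alpha>)) * ennreal (Gamma (1 - \<alpha>) * s powr \<alpha>)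
      = ennreal (p * aD * Gamma (1 - \<alpha>) * s powr \<alpha>)"
    using p dens_D alpha
    by (simp add: ennreal_mult[symmetric] prop_const_D_def alpha_eq[symmetric] Gamma_real_pos less_imp_le mult_ac)
  also have "(\<integral>\<^sup>+\<omega>. nexp (\<Sum>j. q (prop_loss \<kappa> \<alpha> (Y j \<omega>) (device_mark p j \<omega>))) \<partial>M)
      = (\<integral>\<^sup>+\<omega>. nexp (ennreal s * ID p \<omega>) \<partial>M)"
  proof (rule nn_integral_cong_AE, use dm in eventually_elim)
    fix \<omega> assume nn: "\<forall>j. 0 \<le> device_mark p j \<omega>"
    have "q (prop_loss \<kappa> \<alpha> (Y j \<omega>) (device_mark p j \<omega>)) = ennreal s * (if active p j \<omega> then signal \<kappa> \<beta> E Y j \<omega> else 0)" for j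
    proof -
      have "q (prop_loss \<kappa> \<alpha> (Y j \<omega>) (device_mark p j \<omega>)) = ennreal s * signal \<kappa> \<beta> (device_mark p) Y j \<omega>"
        using s nn by (subst signal_eq_prop_loss) (auto simp: q_def ennreal_mult)
      then show ?thesis by (simp add: signal_def device_mark_def)
    qed
    then show "nexp (\<Sum>j. q (prop_loss \<kappa> \<alpha> (Y j \<omega>) (device_mark p j \<omega>))) = nexp (ennreal s * ID p \<omega>)"
      by (simp add: interference_D_def)
  qed
  finally show ?thesis .
qed

end

subsection \<open>The Campbell and Mecke formulas\<close>

text \<open>Difference quotients of \<open>nexp\<close> at 0 with step \<open>x / 2 ^ k\<close>: for halved steps monotonicity in \<open>k\<close> is
  the inequality \<open>1 - u\<^sup>2 \<le> 2 * (1 - u)\<close>, so that monotone convergence replaces differentiation.\<close>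

definition nexp_quot :: "nat \<Rightarrow> ennreal \<Rightarrow> ennreal" where
  "nexp_quot k x = ennreal (2 ^ k) * (1 - nexp (ennreal (1 / 2 ^ k) * x))"

lemma nexp_quot_measurable [measurable]: "nexp_quot k \<in> borel_measurable borel"
  unfolding nexp_quot_def by measurable

lemma nexp_quot_ennreal: "0 \<le> r \<Longrightarrow> nexp_quot k (ennreal r) = ennreal (2 ^ k * (1 - exp (- (r / 2 ^ k))))"
  by (simp add: nexp_quot_def nexp_ennreal ennreal_mult[symmetric] ennreal_minus flip: ennreal_1)

lemma nexp_quot_top: "nexp_quot k top = ennreal (2 ^ k)"
  by (simp add: nexp_quot_def ennreal_mult_top)

lemma nexp_quot_mono: "x \<le> y \<Longrightarrow> nexp_quot k x \<le> nexp_quot k y"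
  unfolding nexp_quot_def by (intro mult_left_mono ennreal_minus_mono nexp_antimono) auto

lemma incseq_nexp_quot: "incseq (\<lambda>k. nexp_quot k x)"
proof (rule incseq_SucI)
  fix k
  show "nexp_quot k x \<le> nexp_quot (Suc k) x"
  proof (cases x)
    case (real r)
    define u where "u = exp (- (r / 2 ^ Suc k))"
    have u: "0 \<le> u" "u \<le> 1" using real by (auto simp: u_def)
    have "exp (- (r / 2 ^ k)) = u * u" by (simp add: u_def mult_exp_exp field_simps)
    moreover have "1 - u * u \<le> 2 * (1 - u)" using zero_le_square[of "1 - u"] by (simp add: algebra_simps)
    ultimately have "2 ^ k * (1 - exp (- (r / 2 ^ k))) \<le> 2 ^ k * (2 * (1 - u))"
      by (intro mult_left_mono) auto
    then show ?thesis
      using real by (simp add: nexp_quot_ennreal u_def mult_ac ennreal_leI)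
  qed (simp add: nexp_quot_top ennreal_leI)
qed

lemma SUP_nexp_quot: "(SUP k. nexp_quot k x) = x"
proof -
  have "(\<lambda>k. nexp_quot k x) \<longlonglongrightarrow> x"
  proof (cases x)
    case (real r)
    have lower: "r / (1 + r / 2 ^ k) \<le> 2 ^ k * (1 - exp (- (r / 2 ^ k)))" for k
    proof -
      define y where "y = r / 2 ^ k"
      have y: "0 \<le> y" using real by (simp add: y_def)
      have "exp (- y) \<le> 1 / (1 + y)"
        using exp_ge_add_one_self[of y] y by (simp add: exp_minus divide_inverse le_imp_inverse_le)
      then have "y / (1 + y) \<le> 1 - exp (- y)"
        using y by (simp add: field_simps)
      then have "2 ^ k * (y / (1 + y)) \<le> 2 ^ k * (1 - exp (- y))"
        by (intro mult_left_mono) auto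
      then show ?thesis by (simp add: y_def)
    qed
    have upper: "2 ^ k * (1 - exp (- (r / 2 ^ k))) \<le> r" for k
    proof -
      have "1 - exp (- (r / 2 ^ k)) \<le> r / 2 ^ k"
        using exp_ge_add_one_self[of "- (r / 2 ^ k)"] by simp
      then have "2 ^ k * (1 - exp (- (r / 2 ^ k))) \<le> 2 ^ k * (r / 2 ^ k)"
        by (rule mult_left_mono) simp
      then show ?thesis by simp
    qed
    have "(\<lambda>k. r / 2 ^ k) \<longlonglongrightarrow> 0"
      using LIMSEQ_divide_realpow_zero[of 2 r] by simp
    then have "(\<lambda>k. r / (1 + r / 2 ^ k)) \<longlonglongrightarrow> r / (1 + 0)"
      by (intro tendsto_intros) auto
    then have lim: "(\<lambda>k. r / (1 + r / 2 ^ k)) \<longlonglongrightarrow> r" by simp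
    have "(\<lambda>k. 2 ^ k * (1 - exp (- (r / 2 ^ k)))) \<longlonglongrightarrow> r"
      by (rule real_tendsto_sandwich[OF _ _ lim tendsto_const]) (simp_all only: lower upper eventually_True)
    then show ?thesis
      using real by (simp add: nexp_quot_ennreal)
  next
    case top
    have "filterlim (\<lambda>k. 2 ^ k :: real) at_top sequentially"
      by (rule filterlim_at_top_mono[OF filterlim_real_sequentially]) (simp add: less_imp_le[OF of_nat_less_two_power])
    then show ?thesis
      using top by (simp add: nexp_quot_top ennreal_tendsto_top_eq_at_top)
  qed
  from LIMSEQ_unique[OF LIMSEQ_SUP[OF incseq_nexp_quot] this] show ?thesis .
qed

text \<open>The step \<open>1 / 2 ^ k\<close> occurs twice in the proof of Campbell's formula:
  inside the intensity integral c k and in the quotient around its exponential. Monotonicity in both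
  places lets the diagonal supremum replace the iterated one.\<close>

lemma SUP_nexp_quot_diagonal:
  assumes c: "incseq c"
  shows "(SUP k. nexp_quot k (c k)) = (SUP k. c k)"
proof (rule antisym)
  show "(SUP k. nexp_quot k (c k)) \<le> (SUP k. c k)"
  proof (rule SUP_mono)
    fix k
    have "nexp_quot k (c k) \<le> (SUP j. nexp_quot j (c k))" by (rule SUP_upper) simp
    then show "\<exists>m\<in>UNIV. nexp_quot k (c k) \<le> c m" unfolding SUP_nexp_quot by blast
  qed
  show "(SUP k. c k) \<le> (SUP k. nexp_quot k (c k))"
  proof (rule SUP_least)
    fix m
    have "c m = (SUP k. nexp_quot k (c m))" by (simp add: SUP_nexp_quot)
    also have "\<dots> \<le> (SUP k. nexp_quot k (c k))"
    proof (rule SUP_mono)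
      fix k
      have "nexp_quot k (c m) \<le> nexp_quot (max k m) (c m)"
        using incseq_nexp_quot[of "c m"] by (auto simp: incseq_def)
      also have "\<dots> \<le> nexp_quot (max k m) (c (max k m))"
        using c by (intro nexp_quot_mono) (auto simp: incseq_def)
      finally show "\<exists>j\<in>UNIV. nexp_quot k (c m) \<le> nexp_quot j (c j)" by blast
    qed
    finally show "c m \<le> (SUP k. nexp_quot k (c k))" .
  qed
qed

section \<open>Campbell's formula under an exponential tilt\<close>

context d2d_model
begin

definition total :: "real \<Rightarrow> 'w \<Rightarrow> ennreal" where
  "total p \<omega> = IB \<omega> + ID p \<omega>"

definition level :: "real \<Rightarrow> ennreal" where
  "level w = ennreal (w powr (- 1 / \<alpha>))"

lemma level_0 [simp]: "level 0 = 0"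
  by (simp add: level_def)

lemma level_measurable [measurable]: "level \<in> borel_measurable borel"
  unfolding level_def by measurable

lemma total_measurable [measurable]: "p \<in> {0..1} \<Longrightarrow> total p \<in> borel_measurable M"
  unfolding total_def[abs_def] by (intro borel_measurable_add) measurable

lemma laplace_joint:
  assumes p: "p \<in> {0..1}" and q [measurable]: "q \<in> borel_measurable borel" and q0: "q 0 = 0"
  shows "(\<integral>\<^sup>+\<omega>. nexp ((\<Sum>i. q (station_loss i \<omega>)) + s * ID p \<omega>) \<partial>M)
    = nexp (ennreal aB * (\<integral>\<^sup>+w. (1 - nexp (q w)) * indicator {0<..} w \<partial>lborel)) * (\<integral>\<^sup>+\<omega>. nexp (s * ID p \<omega>) \<partial>M)"
proof -
  note ID_measurable[OF p, measurable]
  let ?Z = "\<lambda>\<omega>. nexp (\<Sum>i. q (station_loss i \<omega>))"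
  have [measurable]: "station_loss i \<in> borel_measurable (side_algebra p {Station_Side})" for i
    by (rule station_loss_side_measurable) simp
  have "(\<integral>\<^sup>+\<omega>. (\<lambda>(\<omega>, x). ?Z \<omega> * nexp (s * x)) (\<omega>, ID p \<omega>) \<partial>M)
      = (\<integral>\<^sup>+\<omega>. \<integral>\<^sup>+x. (\<lambda>(\<omega>, x). ?Z \<omega> * nexp (s * x)) (\<omega>, x) \<partial>distr M borel (ID p) \<partial>M)"
  proof (rule nn_integral_side[OF p, where k=Device_Side and J="{Station_Side}"])
    show "ID p \<in> borel_measurable (side_algebra p {Device_Side})" by (rule ID_side_measurable) simp
    show "(\<lambda>(\<omega>, x). ?Z \<omega> * nexp (s * x)) \<in> borel_measurable (side_algebra p {Station_Side} \<Otimes>\<^sub>M borel)"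
      by measurable
  qed (simp, measurable)
  also have "\<dots> = (\<integral>\<^sup>+\<omega>. ?Z \<omega> \<partial>M) * (\<integral>\<^sup>+x. nexp (s * x) \<partial>distr M borel (ID p))"
    by (simp add: nn_integral_cmult nn_integral_multc)
  also have "(\<integral>\<^sup>+x. nexp (s * x) \<partial>distr M borel (ID p)) = (\<integral>\<^sup>+\<omega>. nexp (s * ID p \<omega>) \<partial>M)"
    by (rule nn_integral_distr) measurable
  finally show ?thesis
    by (simp add: nexp_add laplace_stations q0)
qed

text \<open>The exponent for s * level + g splits into the one for g = 0, which belongs to the
  unperturbed transform, and the one for g with the intensity tilted by
  \<open>nexp (s * level w)\<close>.\<close>

lemma laplace_total_perturbed:
  assumes p: "p \<in> {0..1}" and g [measurable]: "g \<in> borel_measurable borel" and g0: "g 0 = 0"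
  shows "(\<integral>\<^sup>+\<omega>. nexp (s * total p \<omega>) * nexp (\<Sum>i. g (station_loss i \<omega>)) \<partial>M)
    = (\<integral>\<^sup>+\<omega>. nexp (s * total p \<omega>) \<partial>M)
      * nexp (ennreal aB * (\<integral>\<^sup>+w. nexp (s * level w) * (1 - nexp (g w)) * indicator {0<..} w \<partial>lborel))"
proof -
  note ID_measurable[OF p, measurable]
  have *: "(\<integral>\<^sup>+\<omega>. nexp (s * total p \<omega>) * nexp (\<Sum>i. g (station_loss i \<omega>)) \<partial>M)
      = nexp (ennreal aB * (\<integral>\<^sup>+w. (1 - nexp (s * level w + g w)) * indicator {0<..} w \<partial>lborel)) * (\<integral>\<^sup>+\<omega>. nexp (s * ID p \<omega>) \<partial>M)"
    if [measurable]: "g \<in> borel_measurable borel" and "g 0 = 0" for g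
  proof -
    have "(\<integral>\<^sup>+\<omega>. nexp (s * total p \<omega>) * nexp (\<Sum>i. g (station_loss i \<omega>)) \<partial>M)
      = (\<integral>\<^sup>+\<omega>. nexp ((\<Sum>i. s * level (station_loss i \<omega>) + g (station_loss i \<omega>)) + s * ID p \<omega>) \<partial>M)"
    proof (rule nn_integral_cong_AE, use IB_eq in eventually_elim)
      fix \<omega> assume "IB \<omega> = (\<Sum>i. ennreal (station_loss i \<omega> powr (- 1 / \<alpha>)))"
      then have "s * total p \<omega> + (\<Sum>i. g (station_loss i \<omega>))
          = (\<Sum>i. s * level (station_loss i \<omega>) + g (station_loss i \<omega>)) + s * ID p \<omega>"
        by (simp add: total_def level_def distrib_left suminf_add[symmetric] ac_simps)
      then show "nexp (s * total p \<omega>) * nexp (\<Sum>i. g (station_loss i \<omega>))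
          = nexp ((\<Sum>i. s * level (station_loss i \<omega>) + g (station_loss i \<omega>)) + s * ID p \<omega>)"
        by (simp flip: nexp_add)
    qed
    also have "\<dots> = nexp (ennreal aB * (\<integral>\<^sup>+w. (1 - nexp (s * level w + g w)) * indicator {0<..} w \<partial>lborel)) * (\<integral>\<^sup>+\<omega>. nexp (s * ID p \<omega>) \<partial>M)"
      by (rule laplace_joint[OF p]) (use \<open>g 0 = 0\<close> in auto)
    finally show ?thesis .
  qed
  have split: "1 - nexp (x + y) = (1 - nexp x) + nexp x * (1 - nexp y)" for x y
  proof -
    obtain a b where "0 \<le> a" "a \<le> 1" "nexp x = ennreal a" "0 \<le> b" "b \<le> 1" "nexp y = ennreal b"
      using enn2real_nexp_bounds[of x] enn2real_nexp_bounds[of y] ennreal_enn2real_nexp by (metis atLeastAtMost_iff)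
    note ab = this
    have "1 - nexp (x + y) = ennreal ((1 - a) + a * (1 - b))"
      using ab by (simp add: nexp_add ennreal_mult[symmetric] ennreal_minus right_diff_distrib flip: ennreal_1)
    also have "\<dots> = ennreal (1 - a) + ennreal (a * (1 - b))"
      using ab by (intro ennreal_plus) auto
    also have "\<dots> = (1 - nexp x) + nexp x * (1 - nexp y)"
      using ab by (simp add: ennreal_mult ennreal_minus flip: ennreal_1)
    finally show ?thesis .
  qed
  have "(\<integral>\<^sup>+w. (1 - nexp (s * level w + g w)) * indicator {0<..} w \<partial>lborel)
    = (\<integral>\<^sup>+w. (1 - nexp (s * level w)) * indicator {0<..} w \<partial>lborel)
    + (\<integral>\<^sup>+w. nexp (s * level w) * (1 - nexp (g w)) * indicator {0<..} w \<partial>lborel)"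
    by (subst nn_integral_add[symmetric]) (auto simp: split distrib_right)
  then show ?thesis
    using *[OF g g0] *[of "\<lambda>_. 0"] by (simp add: distrib_left nexp_add ac_simps)
qed

text \<open>The derivative at 0 of \<open>laplace_total_perturbed\<close> along multiples of g,
  taken with the steps \<open>1 / 2 ^ k\<close>. The quotients increase in k on both sides, so
  monotone convergence gives an identity whose sides may be infinite.\<close>

lemma campbell:
  assumes p: "p \<in> {0..1}" and g [measurable]: "g \<in> borel_measurable borel" and g0: "g 0 = 0"
  shows "(\<integral>\<^sup>+\<omega>. nexp (s * total p \<omega>) * (\<Sum>i. g (station_loss i \<omega>)) \<partial>M)
    = (\<integral>\<^sup>+\<omega>. nexp (s * total p \<omega>) \<partial>M) * (ennreal aB * (\<integral>\<^sup>+w. nexp (s * level w) * g w * indicator {0<..} w \<partial>lborel))"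
proof -
  note total_measurable[OF p, measurable]
  let ?T = "\<lambda>\<omega>. nexp (s * total p \<omega>)"
  let ?\<phi> = "\<integral>\<^sup>+\<omega>. ?T \<omega> \<partial>M"
  define Q where "Q \<omega> = (\<Sum>i. g (station_loss i \<omega>))" for \<omega>
  have [measurable]: "Q \<in> borel_measurable M" unfolding Q_def by measurable
  define c where "c k = ennreal aB * (\<integral>\<^sup>+w. nexp (s * level w) * nexp_quot k (g w) * indicator {0<..} w \<partial>lborel)" for k
  have incseq_c: "incseq c"
    unfolding c_def using incseq_nexp_quot
    by (auto simp: incseq_def intro!: mult_left_mono mult_right_mono nn_integral_mono)
  have SUP_mult: "(SUP k. a * nexp_quot k x * b) = a * x * b" for a b x
    by (simp add: SUP_mult_left_ennreal[symmetric] SUP_mult_right_ennreal[symmetric] SUP_nexp_quot)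
  \<comment> \<open>At each finite step the identity is exact: replacing g by g / 2^k and
    linearising in the intensity integral by \<open>nexp_quot\<close> yields the exponent c k /
    2^k.\<close>
  have quot: "(\<integral>\<^sup>+\<omega>. ?T \<omega> * nexp_quot k (Q \<omega>) \<partial>M) = ?\<phi> * nexp_quot k (c k)" for k
  proof -
    let ?d = "ennreal (1 / 2 ^ k)" and ?D = "ennreal (2 ^ k)"
    have Dd: "?D * ?d = 1" by (simp add: ennreal_mult[symmetric])
    have "(\<integral>\<^sup>+w. nexp (s * level w) * (1 - nexp (?d * g w)) * indicator {0<..} w \<partial>lborel)
        = (\<integral>\<^sup>+w. ?d * (nexp (s * level w) * nexp_quot k (g w) * indicator {0<..} w) \<partial>lborel)"
    proof (rule nn_integral_cong)
      fix w
      have "?d * (nexp (s * level w) * nexp_quot k (g w) * indicator {0<..} w)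
          = (?D * ?d) * (nexp (s * level w) * (1 - nexp (?d * g w)) * indicator {0<..} w)"
        unfolding nexp_quot_def by (simp only: mult_ac)
      then show "nexp (s * level w) * (1 - nexp (?d * g w)) * indicator {0<..} w
          = ?d * (nexp (s * level w) * nexp_quot k (g w) * indicator {0<..} w)"
        by (simp add: Dd)
    qed
    also have "\<dots> = ?d * (\<integral>\<^sup>+w. nexp (s * level w) * nexp_quot k (g w) * indicator {0<..} w \<partial>lborel)"
      by (rule nn_integral_cmult) measurable
    finally have c: "ennreal aB * (\<integral>\<^sup>+w. nexp (s * level w) * (1 - nexp (?d * g w)) * indicator {0<..} w \<partial>lborel) = ?d * c k"
      by (simp add: c_def mult_ac)
    have "(\<integral>\<^sup>+\<omega>. ?T \<omega> * nexp_quot k (Q \<omega>) \<partial>M) = ?D * (\<integral>\<^sup>+\<omega>. ?T \<omega> - ?T \<omega> * nexp (\<Sum>i. ?d * g (station_loss i \<omega>)) \<partial>M)"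
      by (subst nn_integral_cmult[symmetric])
        (auto simp: nexp_quot_def Q_def ennreal_suminf_cmult mult_ac ennreal_right_diff_distrib intro!: nn_integral_cong)
    also have "(\<integral>\<^sup>+\<omega>. ?T \<omega> - ?T \<omega> * nexp (\<Sum>i. ?d * g (station_loss i \<omega>)) \<partial>M)
        = ?\<phi> - (\<integral>\<^sup>+\<omega>. ?T \<omega> * nexp (\<Sum>i. ?d * g (station_loss i \<omega>)) \<partial>M)"
    proof (rule nn_integral_diff)
      have "?T \<omega> * nexp x \<le> 1" for \<omega> x by (simp add: nexp_le_1 flip: nexp_add)
      then have "(\<integral>\<^sup>+\<omega>. ?T \<omega> * nexp (\<Sum>i. ?d * g (station_loss i \<omega>)) \<partial>M) \<le> (\<integral>\<^sup>+\<omega>. 1 \<partial>M)"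
        by (intro nn_integral_mono)
      then show "(\<integral>\<^sup>+\<omega>. ?T \<omega> * nexp (\<Sum>i. ?d * g (station_loss i \<omega>)) \<partial>M) \<noteq> \<infinity>"
        by (auto simp: stations.emeasure_space_1 top_unique)
      show "AE \<omega> in M. ?T \<omega> * nexp (\<Sum>i. ?d * g (station_loss i \<omega>)) \<le> ?T \<omega>"
        using mult_left_mono[OF nexp_le_1] by (intro AE_I2) (metis mult.right_neutral zero_le)
    qed measurable
    also have "(\<integral>\<^sup>+\<omega>. ?T \<omega> * nexp (\<Sum>i. ?d * g (station_loss i \<omega>)) \<partial>M) = ?\<phi> * nexp (?d * c k)"
      using laplace_total_perturbed[OF p, of "\<lambda>w. ?d * g w" s] g0 by (simp add: c)
    also have "?D * (?\<phi> - ?\<phi> * nexp (?d * c k)) = ?\<phi> * nexp_quot k (c k)"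
    proof -
      have "?\<phi> \<le> (\<integral>\<^sup>+\<omega>. 1 \<partial>M)" by (intro nn_integral_mono) (simp add: nexp_le_1)
      then have "?\<phi> < top" by (simp add: stations.emeasure_space_1 less_top[symmetric] top_unique) (metis ennreal_one_neq_top top_unique)
      then have "?\<phi> - ?\<phi> * nexp (?d * c k) = ?\<phi> * (1 - nexp (?d * c k))"
        by (simp add: ennreal_right_diff_distrib)
      then show ?thesis by (simp add: nexp_quot_def mult_ac)
    qed
    finally show ?thesis .
  qed
  have "(\<integral>\<^sup>+\<omega>. ?T \<omega> * Q \<omega> \<partial>M) = (\<integral>\<^sup>+\<omega>. (SUP k. ?T \<omega> * nexp_quot k (Q \<omega>)) \<partial>M)"
    by (simp add: SUP_mult_left_ennreal[symmetric] SUP_nexp_quot)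
  also have "\<dots> = (SUP k. \<integral>\<^sup>+\<omega>. ?T \<omega> * nexp_quot k (Q \<omega>) \<partial>M)"
    using incseq_nexp_quot
    by (intro nn_integral_monotone_convergence_SUP) (auto simp: incseq_def le_fun_def intro!: mult_left_mono)
  also have "\<dots> = ?\<phi> * (SUP k. nexp_quot k (c k))"
    by (simp add: quot SUP_mult_left_ennreal)
  also have "(SUP k. nexp_quot k (c k)) = (SUP k. c k)"
    by (rule SUP_nexp_quot_diagonal[OF incseq_c])
  also have "\<dots> = ennreal aB * (SUP k. \<integral>\<^sup>+w. nexp (s * level w) * nexp_quot k (g w) * indicator {0<..} w \<partial>lborel)"
    unfolding c_def by (rule SUP_mult_left_ennreal[symmetric])
  also have "(SUP k. \<integral>\<^sup>+w. nexp (s * level w) * nexp_quot k (g w) * indicator {0<..} w \<partial>lborel)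
      = (\<integral>\<^sup>+w. (SUP k. nexp (s * level w) * nexp_quot k (g w) * indicator {0<..} w) \<partial>lborel)"
    using incseq_nexp_quot
    by (intro nn_integral_monotone_convergence_SUP[symmetric])
      (auto simp: incseq_def le_fun_def intro!: mult_left_mono mult_right_mono)
  finally show ?thesis by (simp add: SUP_mult Q_def)
qed

definition rest :: "real \<Rightarrow> nat \<Rightarrow> 'w \<Rightarrow> ennreal" where
  "rest p i \<omega> = ID p \<omega> + (IB \<omega> - signal \<kappa> \<beta> F X i \<omega>)"

lemma rest_measurable [measurable]: "p \<in> {0..1} \<Longrightarrow> rest p i \<in> borel_measurable M"
  unfolding rest_def[abs_def] by (intro borel_measurable_add borel_measurable_minus_ennreal) measurable

lemma signal_le_IB: "signal \<kappa> \<beta> F X i \<omega> \<le> IB \<omega>"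
  unfolding interference_B_def using sum_le_suminf[of "\<lambda>i. signal \<kappa> \<beta> F X i \<omega>" "{i}"] by simp

lemma total_eq_rest: "total p \<omega> = rest p i \<omega> + signal \<kappa> \<beta> F X i \<omega>"
proof -
  have "IB \<omega> = (IB \<omega> - signal \<kappa> \<beta> F X i \<omega>) + signal \<kappa> \<beta> F X i \<omega>"
    by (rule diff_add_cancel_ennreal[OF signal_le_IB, symmetric])
  then show ?thesis unfolding total_def rest_def by (metis add.assoc add.commute)
qed

lemma signal_eq_level: "AE \<omega> in M. \<forall>i. signal \<kappa> \<beta> F X i \<omega> = level (station_loss i \<omega>) \<and> 0 < F i \<omega>"
  using F_nonneg by eventually_elim (simp add: signal_eq_prop_loss level_def station_loss_def less_imp_le)

text \<open>The rest is the total without the station's own signal, so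
  \<open>nexp (of_nat k * rest p i \<omega>)\<close> is
  \<open>nexp (of_nat k * total p \<omega>)\<close> times e at the loss of that station. The tilt in
  Campbell's formula is the inverse of e, so only the integral of G survives next to the moment of
  the total.\<close>

lemma mecke_moments:
  assumes p: "p \<in> {0..1}" and G [measurable]: "G \<in> borel_measurable borel" and G0: "G 0 = 0"
  shows "(\<integral>\<^sup>+\<omega>. (\<Sum>i. G (station_loss i \<omega>) * nexp (of_nat k * rest p i \<omega>)) \<partial>M)
    = (\<integral>\<^sup>+\<omega>. nexp (of_nat k * total p \<omega>) \<partial>M) * (ennreal aB * (\<integral>\<^sup>+w. G w * indicator {0<..} w \<partial>lborel))"
proof -
  define e where "e w = ennreal (exp (real k * w powr (- 1 / \<alpha>)))" for w
  have [measurable]: "e \<in> borel_measurable borel" unfolding e_def by measurable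
  have e: "nexp (of_nat k * level w) * e w = 1" for w
    by (simp add: level_def e_def ennreal_of_nat_eq_real_of_nat ennreal_mult[symmetric] nexp_ennreal mult_exp_exp)
  have "(\<integral>\<^sup>+\<omega>. (\<Sum>i. G (station_loss i \<omega>) * nexp (of_nat k * rest p i \<omega>)) \<partial>M)
    = (\<integral>\<^sup>+\<omega>. nexp (of_nat k * total p \<omega>) * (\<Sum>i. G (station_loss i \<omega>) * e (station_loss i \<omega>)) \<partial>M)"
  proof (rule nn_integral_cong_AE, use signal_eq_level in eventually_elim)
    fix \<omega> assume sg: "\<forall>i. signal \<kappa> \<beta> F X i \<omega> = level (station_loss i \<omega>) \<and> 0 < F i \<omega>"
    have "nexp (of_nat k * total p \<omega>) * (G (station_loss i \<omega>) * e (station_loss i \<omega>))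
        = G (station_loss i \<omega>) * nexp (of_nat k * rest p i \<omega>)" for i
    proof -
      have "nexp (of_nat k * total p \<omega>) = nexp (of_nat k * rest p i \<omega>) * nexp (of_nat k * level (station_loss i \<omega>))"
        using sg by (simp add: total_eq_rest[of p \<omega> i] distrib_left nexp_add)
      then have "nexp (of_nat k * total p \<omega>) * (G (station_loss i \<omega>) * e (station_loss i \<omega>))
        = G (station_loss i \<omega>) * nexp (of_nat k * rest p i \<omega>) * (nexp (of_nat k * level (station_loss i \<omega>)) * e (station_loss i \<omega>))"
        by (simp only: mult_ac)
      then show ?thesis by (simp add: e)
    qed
    then show "(\<Sum>i. G (station_loss i \<omega>) * nexp (of_nat k * rest p i \<omega>))
        = nexp (of_nat k * total p \<omega>) * (\<Sum>i. G (station_loss i \<omega>) * e (station_loss i \<omega>))"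
      by (simp flip: ennreal_suminf_cmult)
  qed
  also have "\<dots> = (\<integral>\<^sup>+\<omega>. nexp (of_nat k * total p \<omega>) \<partial>M) * (ennreal aB * (\<integral>\<^sup>+w. nexp (of_nat k * level w) * (G w * e w) * indicator {0<..} w \<partial>lborel))"
    by (rule campbell[OF p]) (simp_all add: G0)
  also have "(\<integral>\<^sup>+w. nexp (of_nat k * level w) * (G w * e w) * indicator {0<..} w \<partial>lborel) = (\<integral>\<^sup>+w. G w * indicator {0<..} w \<partial>lborel)"
    using e by (intro nn_integral_cong) (metis mult.left_commute mult.right_neutral)
  finally show ?thesis .
qed

end

lemma less_powr_neg_iff:
  fixes w y a :: real
  assumes "0 < w" "0 < y" "0 < a"
  shows "y < w powr (- 1 / a) \<longleftrightarrow> w < y powr (- a)"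
proof
  assume "y < w powr (- 1 / a)"
  then have "(w powr (- 1 / a)) powr (- a) < y powr (- a)"
    using assms by (intro powr_less_mono2_neg) auto
  then show "w < y powr (- a)" using assms by (simp add: powr_powr)
next
  assume "w < y powr (- a)"
  then have "(y powr (- a)) powr (- 1 / a) < w powr (- 1 / a)"
    using assms by (intro powr_less_mono2_neg) (auto simp: divide_neg_pos)
  then show "y < w powr (- 1 / a)" using assms by (simp add: powr_powr)
qed

text \<open>Removes the quotient from the coverage events. Extreme denominators fit the conventions:
  x / 0 is \<open>top\<close> unless x = 0, and x / \<open>top\<close> is 0.\<close>

lemma ennreal_less_divide_iff:
  fixes x r :: ennreal
  assumes "0 < \<tau>" "x < top"
  shows "ennreal \<tau> < x / r \<longleftrightarrow> ennreal \<tau> * r < x"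
proof (cases r)
  case top
  then show ?thesis using assms by (simp add: ennreal_mult_top)
next
  case (real r')
  obtain x' where x: "x = ennreal x'" "0 \<le> x'" using assms(2) by (cases x) auto
  show ?thesis
  proof (cases "r' = 0")
    case True
    then show ?thesis using real x by (cases "x' = 0") (auto simp: ennreal_divide_zero)
  next
    case False
    then have r: "0 < r'" using real by simp
    have "ennreal \<tau> < x / r \<longleftrightarrow> \<tau> < x' / r'"
      using assms real r x by (simp add: divide_ennreal ennreal_less_iff)
    also have "\<dots> \<longleftrightarrow> \<tau> * r' < x'" using r by (simp add: field_simps)
    also have "\<dots> \<longleftrightarrow> ennreal \<tau> * r < x"
      using assms real r x by (simp add: ennreal_mult[symmetric] ennreal_less_iff)
    finally show ?thesis .
  qed
qed

section \<open>Mecke's formula as an identity of measures\<close>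

context d2d_model
begin

text \<open>The reduced Campbell measure: each station contributes its loss together with exp (-
  rest), and the counting measure sums over stations. The exponential puts the second coordinate in
  [0,1], where moments determine measures, and nothing is lost because \<open>nlog\<close> inverts
  it.\<close>

definition mecke_measure :: "real \<Rightarrow> (real \<times> real) measure" where
  "mecke_measure p = density
     (distr (count_space UNIV \<Otimes>\<^sub>M M) (borel \<Otimes>\<^sub>M borel)
       (\<lambda>(i, \<omega>). (station_loss i \<omega>, enn2real (nexp (rest p i \<omega>)))))
     (\<lambda>z. indicator {0<..} (fst z))"

lemma sets_mecke_measure [measurable_cong]: "sets (mecke_measure p) = sets (borel \<Otimes>\<^sub>M borel)"
  by (simp add: mecke_measure_def)

lemma nn_integral_mecke_measure:
  assumes p: "p \<in> {0..1}" and H [measurable]: "H \<in> borel_measurable (borel \<Otimes>\<^sub>M borel)"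
  shows "(\<integral>\<^sup>+z. H z \<partial>mecke_measure p)
    = (\<integral>\<^sup>+\<omega>. (\<Sum>i. indicator {0<..} (station_loss i \<omega>) * H (station_loss i \<omega>, enn2real (nexp (rest p i \<omega>)))) \<partial>M)"
proof -
  note rest_measurable[OF p, measurable]
  let ?f = "\<lambda>(i, \<omega>). (station_loss i \<omega>, enn2real (nexp (rest p i \<omega>)))"
  have f [measurable]: "?f \<in> measurable (count_space UNIV \<Otimes>\<^sub>M M) (borel \<Otimes>\<^sub>M borel)"
    by (rule measurable_pair_measure_countable1) (auto intro!: measurable_Pair)
  have "(\<integral>\<^sup>+z. H z \<partial>mecke_measure p) = (\<integral>\<^sup>+z. indicator {0<..} (fst z) * H z \<partial>distr (count_space UNIV \<Otimes>\<^sub>M M) (borel \<Otimes>\<^sub>M borel) ?f)"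
    unfolding mecke_measure_def by (subst nn_integral_density) auto
  also have "\<dots> = (\<integral>\<^sup>+y. indicator {0<..} (fst (?f y)) * H (?f y) \<partial>(count_space UNIV \<Otimes>\<^sub>M M))"
    by (subst nn_integral_distr) auto
  also have "\<dots> = (\<integral>\<^sup>+i. \<integral>\<^sup>+\<omega>. indicator {0<..} (fst (?f (i, \<omega>))) * H (?f (i, \<omega>)) \<partial>M \<partial>count_space UNIV)"
    by (rule stations.nn_integral_fst[symmetric]) measurable
  also have "\<dots> = (\<Sum>i. \<integral>\<^sup>+\<omega>. indicator {0<..} (station_loss i \<omega>) * H (station_loss i \<omega>, enn2real (nexp (rest p i \<omega>))) \<partial>M)"
    by (simp add: nn_integral_count_space_nat)
  also have "\<dots> = (\<integral>\<^sup>+\<omega>. (\<Sum>i. indicator {0<..} (station_loss i \<omega>) * H (station_loss i \<omega>, enn2real (nexp (rest p i \<omega>)))) \<partial>M)"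
    by (rule nn_integral_suminf[symmetric]) measurable
  finally show ?thesis .
qed

text \<open>For a fixed set A of losses with finite intensity a, the measures \<mu> and \<nu> in the
  second coordinate are finite, live on [0,1] and have equal moments by
  \<open>mecke_moments\<close>; hence they coincide and can be evaluated at any B.\<close>

lemma mecke_rectangle_finite:
  assumes p: "p \<in> {0..1}" and A [measurable]: "A \<in> sets borel" and B [measurable]: "B \<in> sets borel"
    and fin: "emeasure lborel (A \<inter> {0<..}) < \<infinity>"
  shows "emeasure (mecke_measure p) (A \<times> B)
    = ennreal aB * emeasure lborel (A \<inter> {0<..}) * emeasure (distr M borel (\<lambda>\<omega>. enn2real (nexp (total p \<omega>)))) B"
proof -
  note rest_measurable[OF p, measurable] total_measurable[OF p, measurable]
  define a where "a = ennreal aB * emeasure lborel (A \<inter> {0<..})"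
  have a_fin: "a < top" using fin by (simp add: a_def ennreal_mult_less_top)
  define \<mu> where "\<mu> = distr (density (mecke_measure p) (\<lambda>z. indicator A (fst z))) borel snd"
  define \<nu> where "\<nu> = distr (density M (\<lambda>_. a)) borel (\<lambda>\<omega>. enn2real (nexp (total p \<omega>)))"
  have \<mu>: "(\<integral>\<^sup>+v. h v \<partial>\<mu>) = (\<integral>\<^sup>+\<omega>. (\<Sum>i. indicator (A \<inter> {0<..}) (station_loss i \<omega>) * h (enn2real (nexp (rest p i \<omega>)))) \<partial>M)"
    if [measurable]: "h \<in> borel_measurable borel" for h
  proof -
    have "(\<integral>\<^sup>+v. h v \<partial>\<mu>) = (\<integral>\<^sup>+z. indicator A (fst z) * h (snd z) \<partial>mecke_measure p)"
      unfolding \<mu>_def by (subst nn_integral_distr, measurable, subst nn_integral_density, measurable)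
    also have "\<dots> = (\<integral>\<^sup>+\<omega>. (\<Sum>i. indicator (A \<inter> {0<..}) (station_loss i \<omega>) * h (enn2real (nexp (rest p i \<omega>)))) \<partial>M)"
      by (subst nn_integral_mecke_measure[OF p])
        (measurable, auto intro!: nn_integral_cong suminf_cong split: split_indicator)
    finally show ?thesis .
  qed
  have \<nu>: "(\<integral>\<^sup>+v. h v \<partial>\<nu>) = a * (\<integral>\<^sup>+\<omega>. h (enn2real (nexp (total p \<omega>))) \<partial>M)"
    if [measurable]: "h \<in> borel_measurable borel" for h
    unfolding \<nu>_def by (subst nn_integral_distr, measurable, subst nn_integral_density, measurable, rule nn_integral_cmult, measurable)
  have mom: "(\<integral>\<^sup>+v. ennreal (v ^ k) \<partial>\<mu>) = (\<integral>\<^sup>+v. ennreal (v ^ k) \<partial>\<nu>)" for k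
  proof -
    have pow: "ennreal (enn2real (nexp x) ^ k) = nexp (of_nat k * x)" for x
      by (simp add: nexp_of_nat_mult flip: ennreal_power)
    have "(\<integral>\<^sup>+v. ennreal (v ^ k) \<partial>\<mu>)
        = (\<integral>\<^sup>+\<omega>. (\<Sum>i. indicator (A \<inter> {0<..}) (station_loss i \<omega>) * nexp (of_nat k * rest p i \<omega>)) \<partial>M)"
      by (subst \<mu>) (simp_all add: pow)
    also have "\<dots> = (\<integral>\<^sup>+\<omega>. nexp (of_nat k * total p \<omega>) \<partial>M) * (ennreal aB * (\<integral>\<^sup>+w. indicator (A \<inter> {0<..}) w * indicator {0<..} w \<partial>lborel))"
      by (rule mecke_moments[OF p]) auto
    also have "(\<integral>\<^sup>+w. indicator (A \<inter> {0<..}) w * indicator {0<..} w \<partial>lborel) = (\<integral>\<^sup>+w. indicator (A \<inter> {0<..}) w \<partial>lborel)"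
      by (intro nn_integral_cong) (auto split: split_indicator)
    also have "(\<integral>\<^sup>+\<omega>. nexp (of_nat k * total p \<omega>) \<partial>M) * (ennreal aB * \<dots>) = (\<integral>\<^sup>+v. ennreal (v ^ k) \<partial>\<nu>)"
      by (subst \<nu>) (simp_all add: pow a_def mult_ac)
    finally show ?thesis .
  qed
  have "emeasure \<nu> (space \<nu>) = a"
    using \<nu>[of "\<lambda>_. 1"] by (simp add: stations.emeasure_space_1)
  moreover have "emeasure \<mu> (space \<mu>) = emeasure \<nu> (space \<nu>)"
    using mom[of 0] by simp
  ultimately have fin: "finite_measure \<mu>" "finite_measure \<nu>"
    using a_fin by (auto intro!: finite_measureI)
  have "\<mu> = \<nu>"
  proof (rule finite_measure_eqI_moments[OF fin])
    have "(\<integral>\<^sup>+v. indicator (- {0..1}) v \<partial>\<mu>) = 0"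
      using enn2real_nexp_bounds by (subst \<mu>) (auto simp: nn_integral_0_iff_AE)
    then have "- {0..1} \<in> null_sets \<mu>"
      by (subst (asm) nn_integral_indicator) (auto simp: null_sets_def \<mu>_def)
    from AE_not_in[OF this] show "AE v in \<mu>. v \<in> {0..1}" by simp
    have "(\<integral>\<^sup>+v. indicator (- {0..1}) v \<partial>\<nu>) = 0"
      using enn2real_nexp_bounds by (subst \<nu>) auto
    then have "- {0..1} \<in> null_sets \<nu>"
      by (subst (asm) nn_integral_indicator) (auto simp: null_sets_def \<nu>_def)
    from AE_not_in[OF this] show "AE v in \<nu>. v \<in> {0..1}" by simp
  qed (simp_all add: \<mu>_def \<nu>_def mom[unfolded \<mu>_def \<nu>_def])
  have "emeasure (mecke_measure p) (A \<times> B) = (\<integral>\<^sup>+z. indicator (A \<times> B) z \<partial>mecke_measure p)"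
    by simp
  also have "\<dots> = (\<integral>\<^sup>+\<omega>. (\<Sum>i. indicator (A \<inter> {0<..}) (station_loss i \<omega>) * indicator B (enn2real (nexp (rest p i \<omega>)))) \<partial>M)"
    by (subst nn_integral_mecke_measure[OF p])
      (measurable, auto intro!: nn_integral_cong suminf_cong split: split_indicator)
  also have "\<dots> = (\<integral>\<^sup>+v. indicator B v \<partial>\<nu>)"
    unfolding \<open>\<mu> = \<nu>\<close>[symmetric] by (subst \<mu>) simp_all
  also have "\<dots> = a * (\<integral>\<^sup>+v. indicator B v \<partial>distr M borel (\<lambda>\<omega>. enn2real (nexp (total p \<omega>))))"
    by (subst \<nu>) (simp_all add: nn_integral_distr del: nn_integral_indicator)
  finally show ?thesis by (simp add: a_def)
qed

lemma sigma_finite_half_line: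
  "sigma_finite_measure (density lborel (\<lambda>w :: real. ennreal a * indicator {0<..} w))"
proof (subst sigma_finite_measure.sigma_finite_iff_density_finite[OF sigma_finite_lborel])
  show "AE w in lborel. ennreal a * indicator {0<..} (w :: real) \<noteq> \<infinity>"
    by (intro AE_I2) (simp split: split_indicator)
qed measurable

text \<open>The product form expresses that the rest is independent of the loss and distributed as
  the total. Sets A of infinite length are exhausted by the sets \<open>A' n\<close> of finite
  intensity, to which the moment argument applies.\<close>

lemma mecke:
  assumes p: "p \<in> {0..1}"
  shows "mecke_measure p = density lborel (\<lambda>w :: real. ennreal aB * indicator {0<..} w)
      \<Otimes>\<^sub>M distr M borel (\<lambda>\<omega>. enn2real (nexp (total p \<omega>)))"
proof (rule pair_measure_eqI[symmetric])
  note total_measurable[OF p, measurable]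
  let ?V = "distr M borel (\<lambda>\<omega>. enn2real (nexp (total p \<omega>)))"
  show "sigma_finite_measure (density lborel (\<lambda>w :: real. ennreal aB * indicator {0<..} w))"
    by (rule sigma_finite_half_line)
  have "prob_space ?V" by (rule stations.prob_space_distr) measurable
  then show "sigma_finite_measure ?V"
    by (simp add: prob_space_def finite_measure_def)
  show "sets (density lborel (\<lambda>w :: real. ennreal aB * indicator {0<..} w) \<Otimes>\<^sub>M ?V) = sets (mecke_measure p)"
    by (simp add: sets_mecke_measure cong: sets_pair_measure_cong)
  fix A B assume "A \<in> sets (density lborel (\<lambda>w :: real. ennreal aB * indicator {0<..} w))" "B \<in> sets ?V"
  then have [measurable]: "A \<in> sets borel" "B \<in> sets borel" by auto
  define A' where "A' n = A \<inter> {..real n}" for n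
  have [measurable]: "A' n \<in> sets borel" for n by (simp add: A'_def)
  have Un: "(\<Union>n. A' n) = A" using real_arch_simple by (auto simp: A'_def)
  have inc: "incseq A'" by (auto simp: incseq_def A'_def)
  have "emeasure (density lborel (\<lambda>w :: real. ennreal aB * indicator {0<..} w)) A = ennreal aB * emeasure lborel (A \<inter> {0<..})"
  proof (subst emeasure_density)
    have "(\<integral>\<^sup>+w. ennreal aB * indicator {0<..} w * indicator A w \<partial>lborel) = (\<integral>\<^sup>+w. ennreal aB * indicator (A \<inter> {0<..}) w \<partial>lborel)"
      by (intro nn_integral_cong) (auto split: split_indicator)
    then show "(\<integral>\<^sup>+w. ennreal aB * indicator {0<..} w * indicator A w \<partial>lborel) = ennreal aB * emeasure lborel (A \<inter> {0<..})"
      by (simp add: nn_integral_cmult_indicator)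
  qed auto
  also have "emeasure lborel (A \<inter> {0<..}) = (SUP n. emeasure lborel (A' n \<inter> {0<..}))"
    using inc Un by (subst SUP_emeasure_incseq) (auto simp: incseq_def intro!: arg_cong[of _ _ "emeasure lborel"])
  finally have "emeasure (density lborel (\<lambda>w :: real. ennreal aB * indicator {0<..} w)) A * emeasure ?V B
      = (SUP n. ennreal aB * emeasure lborel (A' n \<inter> {0<..}) * emeasure ?V B)"
    by (simp add: SUP_mult_left_ennreal SUP_mult_right_ennreal)
  also have "\<dots> = (SUP n. emeasure (mecke_measure p) (A' n \<times> B))"
  proof (rule SUP_cong[OF refl])
    fix n
    have "emeasure lborel (A' n \<inter> {0<..}) \<le> emeasure lborel {0..real n}"
      by (rule emeasure_mono) (auto simp: A'_def)
    then have "emeasure lborel (A' n \<inter> {0<..}) < \<infinity>" by (auto intro: le_less_trans)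
    then show "ennreal aB * emeasure lborel (A' n \<inter> {0<..}) * emeasure ?V B = emeasure (mecke_measure p) (A' n \<times> B)"
      by (simp add: mecke_rectangle_finite[OF p])
  qed
  also have "\<dots> = emeasure (mecke_measure p) (\<Union>n. A' n \<times> B)"
    using inc by (intro SUP_emeasure_incseq) (auto simp: sets_mecke_measure incseq_def)
  also have "(\<Union>n. A' n \<times> B) = A \<times> B" using Un by blast
  finally show "emeasure (density lborel (\<lambda>w :: real. ennreal aB * indicator {0<..} w)) A * emeasure ?V B
      = emeasure (mecke_measure p) (A \<times> B)" .
qed

lemma mecke_formula:
  assumes p: "p \<in> {0..1}" and H [measurable]: "(\<lambda>(w, t). H w t) \<in> borel_measurable (borel \<Otimes>\<^sub>M borel)"
  shows "(\<integral>\<^sup>+\<omega>. (\<Sum>i. indicator {0<..} (station_loss i \<omega>) * H (station_loss i \<omega>) (rest p i \<omega>)) \<partial>M)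
    = ennreal aB * (\<integral>\<^sup>+\<omega>. \<integral>\<^sup>+w. H w (total p \<omega>) * indicator {0<..} w \<partial>lborel \<partial>M)"
proof -
  note total_measurable[OF p, measurable]
  let ?V = "distr M borel (\<lambda>\<omega>. enn2real (nexp (total p \<omega>)))"
  let ?L = "density lborel (\<lambda>w :: real. ennreal aB * indicator {0<..} w)"
  interpret V: prob_space ?V by (rule stations.prob_space_distr) measurable
  interpret L: sigma_finite_measure ?L
    by (rule sigma_finite_half_line)
  interpret P: pair_sigma_finite ?L ?V ..
  \<comment> \<open>Composing with \<open>nlog\<close> returns from exp (- rest) to the rest
    itself.\<close>
  define h where "h = (\<lambda>z. H (fst z) (nlog (snd z)))"
  have h [measurable]: "h \<in> borel_measurable (borel \<Otimes>\<^sub>M borel)"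
    unfolding h_def by measurable
  have "(\<integral>\<^sup>+\<omega>. (\<Sum>i. indicator {0<..} (station_loss i \<omega>) * H (station_loss i \<omega>) (rest p i \<omega>)) \<partial>M)
      = (\<integral>\<^sup>+z. h z \<partial>mecke_measure p)"
    by (subst nn_integral_mecke_measure[OF p]) (simp_all add: h_def nlog_nexp)
  also have "\<dots> = (\<integral>\<^sup>+v. \<integral>\<^sup>+w. h (w, v) \<partial>?L \<partial>?V)"
    unfolding mecke[OF p] by (rule P.nn_integral_snd[symmetric]) measurable
  also have "\<dots> = (\<integral>\<^sup>+\<omega>. \<integral>\<^sup>+w. h (w, enn2real (nexp (total p \<omega>))) \<partial>?L \<partial>M)"
    by (rule nn_integral_distr) measurable
  also have "\<dots> = (\<integral>\<^sup>+\<omega>. ennreal aB * (\<integral>\<^sup>+w. H w (total p \<omega>) * indicator {0<..} w \<partial>lborel) \<partial>M)"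
  proof (rule nn_integral_cong)
    fix \<omega>
    have "(\<integral>\<^sup>+w. h (w, enn2real (nexp (total p \<omega>))) \<partial>?L) = (\<integral>\<^sup>+w. ennreal aB * (H w (total p \<omega>) * indicator {0<..} w) \<partial>lborel)"
      by (subst nn_integral_density) (auto simp: h_def nlog_nexp mult_ac)
    also have "\<dots> = ennreal aB * (\<integral>\<^sup>+w. H w (total p \<omega>) * indicator {0<..} w \<partial>lborel)"
      by (rule nn_integral_cmult) measurable
    finally show "(\<integral>\<^sup>+w. h (w, enn2real (nexp (total p \<omega>))) \<partial>?L) = ennreal aB * (\<integral>\<^sup>+w. H w (total p \<omega>) * indicator {0<..} w \<partial>lborel)" .
  qed
  also have "\<dots> = ennreal aB * (\<integral>\<^sup>+\<omega>. \<integral>\<^sup>+w. H w (total p \<omega>) * indicator {0<..} w \<partial>lborel \<partial>M)"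
    by (rule nn_integral_cmult) measurable
  finally show ?thesis .
qed

end

subsection \<open>Coverage probabilities\<close>

context d2d_model
begin

definition rate :: "real \<Rightarrow> real" where
  "rate p = (aB + p * aD) * Gamma (1 - \<alpha>)"

lemma aB_pos: "0 < aB"
proof -
  interpret S: marked_ppp M dens_B X F mark_law by (rule marked_stations)
  have "0 \<le> (LINT x|mark_law. x powr \<alpha>)" by simp
  moreover have "(LINT x|mark_law. x powr \<alpha>) \<noteq> 0"
  proof
    assume "(LINT x|mark_law. x powr \<alpha>) = 0"
    then have "AE x in mark_law. x powr \<alpha> = 0"
      using F_moment by (subst (asm) integral_nonneg_eq_0_iff_AE) (auto simp: alpha_eq)
    with F_pos have "AE x in mark_law. False" by eventually_elim simp
    then show False using S.law.AE_False by simp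
  qed
  ultimately have "0 < (LINT x|mark_law. x powr \<alpha>)" by linarith
  then show ?thesis
    using dens_B kappa by (simp add: prop_const_B_def alpha_eq)
qed

lemma aD_pos: "0 < aD"
  using dens_D kappa alpha by (simp add: prop_const_D_def alpha_eq[symmetric] Gamma_real_pos)

lemma rate_pos: "p \<in> {0..1} \<Longrightarrow> 0 < rate p"
  unfolding rate_def using aB_pos aD_pos alpha by (intro mult_pos_pos add_pos_nonneg Gamma_real_pos) auto

lemma laplace_total:
  assumes p: "p \<in> {0..1}" and s: "0 < s"
  shows "(\<integral>\<^sup>+\<omega>. nexp (ennreal s * total p \<omega>) \<partial>M) = ennreal (exp (- (rate p * s powr \<alpha>)))"
proof -
  have "(\<integral>\<^sup>+\<omega>. nexp (ennreal s * total p \<omega>) \<partial>M)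
      = (\<integral>\<^sup>+\<omega>. nexp ((\<Sum>i. ennreal s * level (station_loss i \<omega>)) + ennreal s * ID p \<omega>) \<partial>M)"
    by (rule nn_integral_cong_AE, use IB_eq in eventually_elim) (simp add: total_def level_def distrib_left)
  also have "\<dots> = nexp (ennreal aB * (\<integral>\<^sup>+w. (1 - nexp (ennreal s * level w)) * indicator {0<..} w \<partial>lborel))
      * nexp (ennreal (p * aD * Gamma (1 - \<alpha>) * s powr \<alpha>))"
    by (subst laplace_joint[OF p]) (simp_all add: laplace_ID[OF p s])
  also have "(\<integral>\<^sup>+w. (1 - nexp (ennreal s * level w)) * indicator {0<..} w \<partial>lborel) = ennreal (Gamma (1 - \<alpha>) * s powr \<alpha>)"
    using nn_integral_one_minus_nexp_powr[OF alpha s] s by (simp add: level_def ennreal_mult)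
  also have "nexp (ennreal aB * ennreal (Gamma (1 - \<alpha>) * s powr \<alpha>)) * nexp (ennreal (p * aD * Gamma (1 - \<alpha>) * s powr \<alpha>))
      = ennreal (exp (- (rate p * s powr \<alpha>)))"
  proof -
    have G: "0 < Gamma (1 - \<alpha>)" using alpha by (intro Gamma_real_pos) simp
    then have nn: "0 \<le> aB * (Gamma (1 - \<alpha>) * s powr \<alpha>)" "0 \<le> p * aD * Gamma (1 - \<alpha>) * s powr \<alpha>"
      using aB_pos aD_pos p by auto
    have "nexp (ennreal aB * ennreal (Gamma (1 - \<alpha>) * s powr \<alpha>)) * nexp (ennreal (p * aD * Gamma (1 - \<alpha>) * s powr \<alpha>))
        = nexp (ennreal (aB * (Gamma (1 - \<alpha>) * s powr \<alpha>) + p * aD * Gamma (1 - \<alpha>) * s powr \<alpha>))"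
      using nn aB_pos G by (simp add: nexp_add[symmetric] ennreal_mult[symmetric] ennreal_plus)
    also have "aB * (Gamma (1 - \<alpha>) * s powr \<alpha>) + p * aD * Gamma (1 - \<alpha>) * s powr \<alpha> = rate p * s powr \<alpha>"
      by (simp add: rate_def algebra_simps)
    finally show ?thesis
      using rate_pos[OF p] by (simp add: nexp_ennreal)
  qed
  finally show ?thesis .
qed

text \<open>The Laplace transform at large s bounds the probability of T = 0 from above, and at
  small s it bounds the probability of T < \<open>top\<close> from below. With s =
  \<open>t powr (1 / \<alpha>)\<close> it becomes the plain exponential exp (- rate * t), which
  takes every value in (0,1).\<close>

lemma total_finite_pos:
  assumes p: "p \<in> {0..1}"
  shows "AE \<omega> in M. 0 < total p \<omega> \<and> total p \<omega> < top"
proof -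
  note total_measurable[OF p, measurable]
  have lap: "(\<integral>\<^sup>+\<omega>. nexp (ennreal (t powr (1 / \<alpha>)) * total p \<omega>) \<partial>M) = ennreal (exp (- (rate p * t)))"
    if "0 < t" for t
    using laplace_total[OF p, of "t powr (1 / \<alpha>)"] that alpha by (simp add: powr_powr)
  let ?Z = "{\<omega> \<in> space M. total p \<omega> = 0}" and ?I = "{\<omega> \<in> space M. total p \<omega> < top}"
  have Z: "stations.prob ?Z \<le> exp (- (rate p * t))" if t: "0 < t" for t
  proof -
    have "ennreal (stations.prob ?Z) = (\<integral>\<^sup>+\<omega>. indicator ?Z \<omega> \<partial>M)"
      by (simp add: stations.emeasure_eq_measure)
    also have "\<dots> \<le> (\<integral>\<^sup>+\<omega>. nexp (ennreal (t powr (1 / \<alpha>)) * total p \<omega>) \<partial>M)"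
      by (intro nn_integral_mono) (auto split: split_indicator)
    finally show ?thesis by (simp add: lap[OF t])
  qed
  have I: "exp (- (rate p * t)) \<le> stations.prob ?I" if t: "0 < t" for t
  proof -
    have "(\<integral>\<^sup>+\<omega>. nexp (ennreal (t powr (1 / \<alpha>)) * total p \<omega>) \<partial>M) \<le> (\<integral>\<^sup>+\<omega>. indicator ?I \<omega> \<partial>M)"
    proof (rule nn_integral_mono)
      fix \<omega> assume "\<omega> \<in> space M"
      then show "nexp (ennreal (t powr (1 / \<alpha>)) * total p \<omega>) \<le> indicator ?I \<omega>"
        using t by (cases "total p \<omega> = top") (auto simp: ennreal_mult_top nexp_le_1 less_top)
    qed
    then show ?thesis by (simp add: lap[OF t] stations.emeasure_eq_measure)
  qed
  have "stations.prob ?Z = 0"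
  proof (rule ccontr)
    assume "stations.prob ?Z \<noteq> 0"
    then have z: "0 < stations.prob ?Z" by (simp add: less_le)
    \<comment> \<open>Chosen so that the transform equals half of the supposed positive
      probability.\<close>
    define t where "t = - ln (stations.prob ?Z / 2) / rate p"
    have "stations.prob ?Z / 2 < 1" using stations.prob_le_1[of ?Z] by linarith
    then have "0 < t" using z rate_pos[OF p] by (simp add: t_def divide_neg_pos)
    moreover have "exp (- (rate p * t)) = stations.prob ?Z / 2"
      using z rate_pos[OF p] by (simp add: t_def)
    ultimately show False using Z z by fastforce
  qed
  then have "AE \<omega> in M. total p \<omega> \<noteq> 0"
    by (subst (asm) stations.prob_eq_0) auto
  moreover have "stations.prob ?I = 1"
  proof (rule ccontr)
    assume "stations.prob ?I \<noteq> 1"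
    then have i: "stations.prob ?I < 1" using stations.prob_le_1[of ?I] by linarith
    \<comment> \<open>The midpoint between the supposed probability and 1; t below makes the
      transform equal to it.\<close>
    define m where "m = (1 + stations.prob ?I) / 2"
    have m: "0 < m" "m < 1" "stations.prob ?I < m"
      using i measure_nonneg[of M ?I] by (simp_all add: m_def add_pos_nonneg)
    define t where "t = - ln m / rate p"
    have "0 < t" using m rate_pos[OF p] by (simp add: t_def divide_neg_pos)
    moreover have "exp (- (rate p * t)) = m" using m rate_pos[OF p] by (simp add: t_def)
    ultimately show False using I m by fastforce
  qed
  then have "AE \<omega> in M. \<omega> \<in> ?I" by (rule stations.AE_prob_1)
  ultimately show ?thesis by eventually_elim (auto simp: zero_less_iff_neq_zero)
qed

text \<open>The constant is \<open>Gamma (1 + \<alpha>)\<close>, but only its positivity and finiteness matter.\<close>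

definition stable_const :: ennreal where
  "stable_const = (\<integral>\<^sup>+w. nexp (ennreal (w powr (1 / \<alpha>))) * indicator {0<..} w \<partial>lborel)"

definition total_moment :: "real \<Rightarrow> ennreal" where
  "total_moment p = (\<integral>\<^sup>+\<omega>. ennreal (enn2real (total p \<omega>) powr (- \<alpha>)) \<partial>M)"

text \<open>For t > 0 the integral of exp (- t * v^(1/\<alpha>)) over v > 0 is t^(-\<alpha>) times
  \<open>stable_const\<close>, by scaling. Exchanged with the expectation, it contains the Laplace
  transform at s = v^(1/\<alpha>), which is exp (- rate * v) and integrates to 1 / rate.\<close>

lemma total_moment_eq:
  assumes p: "p \<in> {0..1}"
  shows "total_moment p * stable_const = ennreal (1 / rate p)"
proof -
  note total_measurable[OF p, measurable]
  define f where "f v = nexp (ennreal (v powr (1 / \<alpha>)))" for v :: real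
  have [measurable]: "f \<in> borel_measurable borel" unfolding f_def by measurable
  have "total_moment p * stable_const = (\<integral>\<^sup>+\<omega>. ennreal (enn2real (total p \<omega>) powr (- \<alpha>)) * stable_const \<partial>M)"
    unfolding total_moment_def by (rule nn_integral_multc[symmetric]) measurable
  also have "\<dots> = (\<integral>\<^sup>+\<omega>. \<integral>\<^sup>+v. nexp (ennreal (v powr (1 / \<alpha>)) * total p \<omega>) * indicator {0<..} v \<partial>lborel \<partial>M)"
  proof (rule nn_integral_cong_AE, use total_finite_pos[OF p] in eventually_elim)
    fix \<omega> assume "0 < total p \<omega> \<and> total p \<omega> < top"
    then obtain t where t: "total p \<omega> = ennreal t" "0 < t" by (cases "total p \<omega>") auto
    define c where "c = t powr \<alpha>"
    have c: "0 < c" using t by (simp add: c_def)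
    have "(\<integral>\<^sup>+v. nexp (ennreal (v powr (1 / \<alpha>)) * total p \<omega>) * indicator {0<..} v \<partial>lborel) = (\<integral>\<^sup>+v. f (c * v) * indicator {0<..} v \<partial>lborel)"
      using t alpha by (intro nn_integral_cong)
        (auto simp: f_def c_def powr_mult powr_powr ennreal_mult[symmetric] mult.commute split: split_indicator)
    also have "\<dots> = ennreal (1 / c) * stable_const"
      using c by (simp add: nn_integral_half_line_scale stable_const_def f_def[symmetric])
    finally show "ennreal (enn2real (total p \<omega>) powr (- \<alpha>)) * stable_const
        = (\<integral>\<^sup>+v. nexp (ennreal (v powr (1 / \<alpha>)) * total p \<omega>) * indicator {0<..} v \<partial>lborel)"
      using t by (simp add: c_def powr_minus_divide)
  qed
  also have "\<dots> = (\<integral>\<^sup>+v. \<integral>\<^sup>+\<omega>. nexp (ennreal (v powr (1 / \<alpha>)) * total p \<omega>) * indicator {0<..} v \<partial>M \<partial>lborel)"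
  proof -
    interpret P: pair_sigma_finite lborel M ..
    show ?thesis by (rule P.Fubini') measurable
  qed
  also have "\<dots> = (\<integral>\<^sup>+v. ennreal (exp (- (rate p * v))) * indicator {0<..} v \<partial>lborel)"
  proof (rule nn_integral_cong)
    fix v :: real
    show "(\<integral>\<^sup>+\<omega>. nexp (ennreal (v powr (1 / \<alpha>)) * total p \<omega>) * indicator {0<..} v \<partial>M) = ennreal (exp (- (rate p * v))) * indicator {0<..} v"
      using laplace_total[OF p, of "v powr (1 / \<alpha>)"] alpha by (cases "0 < v") (simp_all add: powr_powr)
  qed
  also have "\<dots> = (\<integral>\<^sup>+v. ennreal (exp (- v)) * indicator {0<..} v \<partial>lborel) * ennreal (1 / rate p)"
    using nn_integral_half_line_scale[of "\<lambda>v. ennreal (exp (- v))" "rate p"] rate_pos[OF p] by (simp add: mult.commute)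
  also have "(\<integral>\<^sup>+v. ennreal (exp (- v)) * indicator {0<..} v \<partial>lborel) = (\<integral>\<^sup>+v. ennreal (indicator {0..} v * v powr (1 - 1) / exp v) \<partial>lborel)"
  proof (rule nn_integral_cong_AE)
    have "AE v in lborel. v \<noteq> (0::real)" by (rule AE_lborel_singleton)
    then show "AE v in lborel. ennreal (exp (- v)) * indicator {0<..} v = ennreal (indicator {0..} v * v powr (1 - 1) / exp v)"
      by eventually_elim (auto simp: exp_minus divide_inverse split: split_indicator)
  qed
  also have "\<dots> = 1"
    using Gamma_conv_nn_integral_real[of 1] by simp
  finally show ?thesis by simp
qed

text \<open>Read off from \<open>total_moment_eq\<close> at p = 0 instead of from the integral: a
  product that is positive and finite has no factor 0, and then no factor \<open>top\<close>
  either.\<close>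

lemma stable_const: "0 < stable_const" "stable_const < top"
proof -
  have r: "0 < ennreal (1 / rate 0)" "ennreal (1 / rate 0) < top" using rate_pos[of 0] by auto
  have *: "total_moment 0 * stable_const = ennreal (1 / rate 0)" by (rule total_moment_eq) simp
  show "0 < stable_const" using * r by (auto simp: zero_less_iff_neq_zero)
  have "total_moment 0 \<noteq> 0" using * r by (metis mult_zero_left less_irrefl)
  have "stable_const \<noteq> top"
  proof
    assume "stable_const = top"
    then have "ennreal (1 / rate 0) = top"
      using * \<open>total_moment 0 \<noteq> 0\<close> by (simp add: ennreal_mult_top)
    then show False using r by simp
  qed
  then show "stable_const < top" by (simp add: less_top)
qed

lemma total_moment_real:
  assumes p: "p \<in> {0..1}"
  shows "total_moment p = ennreal (1 / (enn2real stable_const * rate p))"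
proof -
  obtain c where c: "stable_const = ennreal c" "0 < c"
    using stable_const by (cases stable_const) auto
  have "total_moment p = total_moment p * ennreal c * ennreal (1 / c)"
    using c by (simp add: mult.assoc ennreal_mult[symmetric])
  also have "\<dots> = ennreal (1 / rate p) * ennreal (1 / c)"
    using total_moment_eq[OF p] c by simp
  finally show ?thesis
    using c rate_pos[OF p] by (simp add: ennreal_mult[symmetric] mult.commute)
qed

text \<open>For a threshold of at least 1, at most one station covers the origin, so that the coverage
  probability is the expected number of covering stations.\<close>

lemma coverage_B_eq:
  assumes p: "p \<in> {0..1}" and \<tau>: "1 \<le> \<tau>"
  shows "coverage_B M \<kappa> \<beta> F X E Y active \<tau> p
    = \<tau> powr (- \<alpha>) * aB / (enn2real stable_const * rate p)"
proof -
  note rest_measurable[OF p, measurable] total_measurable[OF p, measurable]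
  let ?S = "\<lambda>i \<omega>. signal \<kappa> \<beta> F X i \<omega>"
  define C where "C = {\<omega> \<in> space M. \<exists>i. ennreal \<tau> * rest p i \<omega> < ?S i \<omega>}"
  have [measurable]: "C \<in> sets M" unfolding C_def by measurable
  have S_fin: "?S i \<omega> < top" for i \<omega> by (simp add: signal_def)
  have event: "{\<omega> \<in> space M. (SUP i. ?S i \<omega> / (ID p \<omega> + (IB \<omega> - ?S i \<omega>))) > ennreal \<tau>} = C"
    using \<tau> ennreal_less_divide_iff[OF _ S_fin, of \<tau>] by (simp add: C_def less_SUP_iff rest_def)
  \<comment> \<open>Since \<tau> \<ge> 1, the signal of a covering station exceeds its rest, which
    contains the signal of every other station. Two covering stations would each be strictly
    stronger than the other.\<close>
  have unique: "i = j" if ij: "ennreal \<tau> * rest p i \<omega> < ?S i \<omega>" "ennreal \<tau> * rest p j \<omega> < ?S j \<omega>" for i j \<omega>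
  proof (rule ccontr)
    assume ne: "i \<noteq> j"
    have le: "?S j \<omega> < ?S i \<omega>" if "i \<noteq> j" "ennreal \<tau> * rest p i \<omega> < ?S i \<omega>" for i j
    proof -
      have "?S i \<omega> + ?S j \<omega> = (\<Sum>k\<in>{i, j}. ?S k \<omega>)" using that by simp
      also have "\<dots> \<le> IB \<omega>" unfolding interference_B_def by (intro sum_le_suminf) auto
      finally have "?S j \<omega> \<le> IB \<omega> - ?S i \<omega>"
        using S_fin[of i \<omega>] by (simp add: ennreal_le_minus_iff add.commute)
      also have "\<dots> \<le> rest p i \<omega>" unfolding rest_def by simp
      also have "\<dots> \<le> ennreal \<tau> * rest p i \<omega>"
        using \<tau> mult_right_mono[of 1 "ennreal \<tau>" "rest p i \<omega>"] by simp
      finally show ?thesis using that by simp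
    qed
    show False using le[OF ne ij(1)] le[OF ne[symmetric] ij(2)] by simp
  qed
  have count: "(\<Sum>i. indicator {\<omega>. ennreal \<tau> * rest p i \<omega> < ?S i \<omega>} \<omega>) = (indicator C \<omega> :: ennreal)"
    if "\<omega> \<in> space M" for \<omega>
  proof (cases "\<omega> \<in> C")
    case True
    then obtain i where i: "ennreal \<tau> * rest p i \<omega> < ?S i \<omega>" by (auto simp: C_def)
    have "(\<Sum>j. indicator {\<omega>. ennreal \<tau> * rest p j \<omega> < ?S j \<omega>} \<omega>)
        = (\<Sum>j\<in>{i}. indicator {\<omega>. ennreal \<tau> * rest p j \<omega> < ?S j \<omega>} \<omega> :: ennreal)"
      using unique i by (intro suminf_finite) (auto simp: indicator_def)
    then show ?thesis using True i by simp
  next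
    case False
    then show ?thesis using that by (simp add: C_def)
  qed
  define H where "H w t = (if ennreal \<tau> * t < level w then 1 else 0 :: ennreal)" for w t
  have [measurable]: "(\<lambda>(w, t). H w t) \<in> borel_measurable (borel \<Otimes>\<^sub>M borel)"
    unfolding H_def by measurable
  have "emeasure M C = (\<integral>\<^sup>+\<omega>. (\<Sum>i. indicator {\<omega>. ennreal \<tau> * rest p i \<omega> < ?S i \<omega>} \<omega>) \<partial>M)"
    by (simp add: count cong: nn_integral_cong)
  also have "\<dots> = (\<integral>\<^sup>+\<omega>. (\<Sum>i. indicator {0<..} (station_loss i \<omega>) * H (station_loss i \<omega>) (rest p i \<omega>)) \<partial>M)"
  proof (rule nn_integral_cong_AE, use signal_eq_level in eventually_elim)
    fix \<omega> assume sg: "\<forall>i. ?S i \<omega> = level (station_loss i \<omega>) \<and> 0 < F i \<omega>"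
    have "0 \<le> station_loss i \<omega>" for i by (simp add: station_loss_def prop_loss_def)
    \<comment> \<open>A station of loss 0 has signal 0 and covers nothing, so restricting to
      positive losses changes no term.\<close>
    then have "indicator {\<omega>. ennreal \<tau> * rest p i \<omega> < ?S i \<omega>} \<omega>
        = indicator {0<..} (station_loss i \<omega>) * H (station_loss i \<omega>) (rest p i \<omega>)" for i
      using sg by (cases "station_loss i \<omega> = 0") (auto simp: H_def indicator_def less_le)
    then show "(\<Sum>i. indicator {\<omega>. ennreal \<tau> * rest p i \<omega> < ?S i \<omega>} \<omega>)
        = (\<Sum>i. indicator {0<..} (station_loss i \<omega>) * H (station_loss i \<omega>) (rest p i \<omega>))"
      by simp
  qed
  also have "\<dots> = ennreal aB * (\<integral>\<^sup>+\<omega>. \<integral>\<^sup>+w. H w (total p \<omega>) * indicator {0<..} w \<partial>lborel \<partial>M)"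
    by (rule mecke_formula[OF p]) measurable
  also have "(\<integral>\<^sup>+\<omega>. \<integral>\<^sup>+w. H w (total p \<omega>) * indicator {0<..} w \<partial>lborel \<partial>M)
      = (\<integral>\<^sup>+\<omega>. ennreal (\<tau> powr (- \<alpha>)) * ennreal (enn2real (total p \<omega>) powr (- \<alpha>)) \<partial>M)"
  proof (rule nn_integral_cong_AE, use total_finite_pos[OF p] in eventually_elim)
    fix \<omega> assume "0 < total p \<omega> \<and> total p \<omega> < top"
    then obtain t where t: "total p \<omega> = ennreal t" "0 < t" by (cases "total p \<omega>") auto
    \<comment> \<open>For a fixed total t, the losses of covering signals fill an interval of length
      \<open>(\<tau> * t) powr (- \<alpha>)\<close>.\<close>
    have "H w (total p \<omega>) * indicator {0<..} w = indicator {0<..<(\<tau> * t) powr (- \<alpha>)} w" for w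
      using t \<tau> alpha less_powr_neg_iff[of w "\<tau> * t" \<alpha>]
      by (auto simp: H_def level_def ennreal_mult[symmetric] ennreal_less_iff split: split_indicator)
    then have "(\<integral>\<^sup>+w. H w (total p \<omega>) * indicator {0<..} w \<partial>lborel) = ennreal ((\<tau> * t) powr (- \<alpha>))"
      by simp
    then show "(\<integral>\<^sup>+w. H w (total p \<omega>) * indicator {0<..} w \<partial>lborel)
        = ennreal (\<tau> powr (- \<alpha>)) * ennreal (enn2real (total p \<omega>) powr (- \<alpha>))"
      using t \<tau> by (simp add: powr_mult ennreal_mult)
  qed
  also have "\<dots> = ennreal (\<tau> powr (- \<alpha>)) * total_moment p"
    unfolding total_moment_def by (rule nn_integral_cmult) measurable
  also have "ennreal aB * \<dots> = ennreal (\<tau> powr (- \<alpha>) * aB / (enn2real stable_const * rate p))"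
    using aB_pos rate_pos[OF p] by (simp add: total_moment_real[OF p] ennreal_mult[symmetric] mult_ac)
  finally have "stations.prob C = \<tau> powr (- \<alpha>) * aB / (enn2real stable_const * rate p)"
    using aB_pos rate_pos[OF p] by (simp add: measure_def)
  then show ?thesis
    by (simp add: coverage_B_def event)
qed

lemma coverage_D_eq:
  assumes p: "p \<in> {0..1}" and \<tau>: "0 < \<tau>" and r: "0 < r"
  shows "coverage_D M \<kappa> \<beta> F X E Y active E0 r \<tau> p = exp (- (rate p * ((\<kappa> * r)\<^sup>2 * \<tau> powr \<alpha>)))"
proof -
  note total_measurable[OF p, measurable]
  define l where "l = path_loss \<kappa> \<beta> r"
  have l: "0 < l" using kappa r by (simp add: l_def path_loss_def)
  \<comment> \<open>Origin of the factor \<open>(\<kappa> * r)\<^sup>2\<close>: the transform is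
    evaluated at s = \<tau> * l, and its exponent contains \<open>s powr \<alpha>\<close>.\<close>
  have l_powr: "l powr \<alpha> = (\<kappa> * r)\<^sup>2"
    using kappa r beta by (simp add: l_def path_loss_def powr_powr alpha_eq)
  define C where "C = {\<omega> \<in> space M. ennreal \<tau> < ennreal (E0 \<omega> / l) / total p \<omega>}"
  have [measurable]: "C \<in> sets M" unfolding C_def by measurable
  define f where "f = (\<lambda>(\<omega>, x). if ennreal \<tau> * total p \<omega> < ennreal (x / l) then 1 else 0 :: ennreal)"
  have side: "total p \<in> borel_measurable (side_algebra p {Station_Side, Device_Side})"
    unfolding total_def[abs_def]
    by (intro borel_measurable_add IB_side_measurable ID_side_measurable) auto
  have "emeasure M C = (\<integral>\<^sup>+\<omega>. indicator C \<omega> \<partial>M)" by simp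
  also have "\<dots> = (\<integral>\<^sup>+\<omega>. f (\<omega>, E0 \<omega>) \<partial>M)"
    using \<tau> by (intro nn_integral_cong) (auto simp: C_def f_def indicator_def ennreal_less_divide_iff)
  also have "\<dots> = (\<integral>\<^sup>+\<omega>. \<integral>\<^sup>+x. f (\<omega>, x) \<partial>distr M borel E0 \<partial>M)"
  proof (rule nn_integral_side[OF p, where k=Typical_Side and J="{Station_Side, Device_Side}"])
    show "E0 \<in> borel_measurable (side_algebra p {Typical_Side})" by (rule E0_side_measurable) simp
    note side [measurable]
    show "f \<in> borel_measurable (side_algebra p {Station_Side, Device_Side} \<Otimes>\<^sub>M borel)"
      unfolding f_def by measurable
  qed (simp, measurable)
  also have "\<dots> = (\<integral>\<^sup>+\<omega>. nexp (ennreal (\<tau> * l) * total p \<omega>) \<partial>M)"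
  proof (rule nn_integral_cong_AE, use total_finite_pos[OF p] in eventually_elim)
    fix \<omega> assume "0 < total p \<omega> \<and> total p \<omega> < top"
    then obtain t where t: "total p \<omega> = ennreal t" "0 < t" by (cases "total p \<omega>") auto
    have iff: "ennreal \<tau> * total p \<omega> < ennreal (x / l) \<longleftrightarrow> \<tau> * l * t < x" for x
    proof -
      have "ennreal \<tau> * total p \<omega> < ennreal (x / l) \<longleftrightarrow> \<tau> * t < x / l"
        using t \<tau> by (simp add: ennreal_mult[symmetric] ennreal_less_iff)
      then show ?thesis using l by (simp add: field_simps)
    qed
    have "(\<integral>\<^sup>+x. f (\<omega>, x) \<partial>distr M borel E0) = (\<integral>\<^sup>+y. f (\<omega>, E0 y) \<partial>M)"
      unfolding f_def case_prod_conv by (rule nn_integral_distr) measurable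
    also have "\<dots> = (\<integral>\<^sup>+y. indicator {y \<in> space M. \<tau> * l * t < E0 y} y \<partial>M)"
      by (intro nn_integral_cong) (auto simp: f_def iff split: split_indicator)
    also have "\<dots> = ennreal (stations.prob {y \<in> space M. \<tau> * l * t < E0 y})"
      by (simp add: stations.emeasure_eq_measure)
    also have "\<dots> = ennreal (exp (- (\<tau> * l * t)))"
      using stations.exponential_distributedD_gt[OF E0_exponential, of "\<tau> * l * t"] \<tau> l t by simp
    finally show "(\<integral>\<^sup>+x. f (\<omega>, x) \<partial>distr M borel E0) = nexp (ennreal (\<tau> * l) * total p \<omega>)"
      using \<tau> l t by (simp add: ennreal_mult[symmetric] nexp_ennreal)
  qed
  also have "\<dots> = ennreal (exp (- (rate p * (\<tau> * l) powr \<alpha>)))"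
    using \<tau> l by (intro laplace_total[OF p]) simp
  also have "(\<tau> * l) powr \<alpha> = (\<kappa> * r)\<^sup>2 * \<tau> powr \<alpha>"
    using \<tau> l by (simp add: powr_mult l_powr)
  finally have "stations.prob C = exp (- (rate p * ((\<kappa> * r)\<^sup>2 * \<tau> powr \<alpha>)))"
    by (simp add: measure_def)
  then show ?thesis
    by (simp add: coverage_D_def C_def l_def total_def)
qed

end

subsection \<open>Optimisation\<close>

text \<open>After division by \<open>p * exp (- (q / m))\<close> the claim is q / p \<le> exp ((q -
  p) / m). By 1 + x \<le> exp x it suffices that (q - p) * (1 / m - 1 / p) \<ge> 0: this is an
  equality at the free maximiser p = m, and otherwise both factors are nonpositive because p lies on
  the increasing branch.\<close>

lemma mult_exp_le:
  fixes m p q :: real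
  assumes "0 < m" "0 < p" "p \<le> m" and "p = m \<or> q \<le> p"
  shows "q * exp (- (q / m)) \<le> p * exp (- (p / m))"
proof -
  have "0 \<le> (q - p) * (1 / m - 1 / p)"
  proof (cases "p = m")
    case False
    then have "q - p \<le> 0" "1 / m - 1 / p \<le> 0" using assms by (auto simp: frac_le)
    then show ?thesis by (rule mult_nonpos_nonpos)
  qed simp
  then have "q / p \<le> 1 + (q / m - p / m)"
    using assms by (simp add: algebra_simps diff_divide_distrib)
  also have "\<dots> \<le> exp (q / m - p / m)" by (rule exp_ge_add_one_self)
  finally have "q \<le> p * exp (q / m - p / m)"
    using assms by (simp add: field_simps)
  then have "q * exp (- (q / m)) \<le> p * exp (q / m - p / m) * exp (- (q / m))"
    by (rule mult_right_mono) simp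
  also have "\<dots> = p * exp (- (p / m))"
    by (simp add: mult.assoc mult_exp_exp)
  finally show ?thesis .
qed

text \<open>At p = p1 the exponent of the throughput splits into the station part aB / (aD * p1) and
  the device part 1; the station part equals aB / aD exactly when p1 = 1.\<close>

theorem theorem6:
  fixes M :: "'w measure" and X Y :: "nat \<Rightarrow> 'w \<Rightarrow> real^2" and F E :: "nat \<Rightarrow> 'w \<Rightarrow> real"
    and active :: "real \<Rightarrow> nat \<Rightarrow> 'w \<Rightarrow> bool" and E0 :: "'w \<Rightarrow> real" and mark_law :: "real measure"
    and \<beta> \<kappa> dens_B dens_D r \<tau>\<^sub>D \<delta> :: real
  assumes "\<beta> > 2" and "\<kappa> > 0" and "dens_B > 0" and "dens_D > 0" and "r > 0" and "\<tau>\<^sub>D > 0"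
    and "0 \<le> \<delta>" and "\<delta> \<le> 1"
    and "d2d_network M dens_B dens_D X Y \<beta> mark_law F E active E0"
  shows "let aB = prop_const_B \<kappa> \<beta> dens_B mark_law;
             aD = prop_const_D \<kappa> \<beta> dens_D;
             PB = coverage_B M \<kappa> \<beta> F X E Y active;
             D = (\<lambda>p. p * dens_D * coverage_D M \<kappa> \<beta> F X E Y active E0 r \<tau>\<^sub>D p);
             p1 = p_opt1 \<kappa> \<beta> aD r \<tau>\<^sub>D;
             p2 = p_opt2 aB aD \<delta>;
             p = p_opt p1 p2;
             G = Gamma (1 - 2 / \<beta>)
         in is_arg_max D (\<lambda>q. q \<in> {0..1} \<and> (\<forall>\<tau>\<^sub>B\<ge>1. PB \<tau>\<^sub>B q \<ge> \<delta> * PB \<tau>\<^sub>B 0)) p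
          \<and> (p = 1 \<longrightarrow> D p = dens_D * exp (- ((aB + aD) * (\<kappa> * r)\<^sup>2 * G * \<tau>\<^sub>D powr (2 / \<beta>))))
          \<and> (p = p1 \<longrightarrow> D p = dens_D * exp (- (aB / (aD * p1))) * exp (- 1)
                                / (aD * (\<kappa> * r)\<^sup>2 * G * \<tau>\<^sub>D powr (2 / \<beta>)))
          \<and> (ereal p = p2 \<longrightarrow> D p = aB / aD * (1 / \<delta> - 1) * dens_D
                                * exp (- (aB * (\<kappa> * r)\<^sup>2 * G * \<tau>\<^sub>D powr (2 / \<beta>) / \<delta>)))"
proof -
  interpret d2d_model M dens_B dens_D X Y \<beta> mark_law F E active E0 \<kappa> "2 / \<beta>"
    using assms by (intro d2d_model.intro d2d_model_axioms.intro) auto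
  define aB where "aB = prop_const_B \<kappa> \<beta> dens_B mark_law"
  define aD where "aD = prop_const_D \<kappa> \<beta> dens_D"
  define G where "G = Gamma (1 - 2 / \<beta>)"
  define PB where "PB = coverage_B M \<kappa> \<beta> F X E Y active"
  define D where "D = (\<lambda>p. p * dens_D * coverage_D M \<kappa> \<beta> F X E Y active E0 r \<tau>\<^sub>D p)"
  define p1 where "p1 = p_opt1 \<kappa> \<beta> aD r \<tau>\<^sub>D"
  define p2 where "p2 = p_opt2 aB aD \<delta>"
  define p where "p = p_opt p1 p2"
  define b where "b = (\<kappa> * r)\<^sup>2 * G * \<tau>\<^sub>D powr (2 / \<beta>)"
  have aB: "0 < aB" and aD: "0 < aD" unfolding aB_def aD_def by (rule aB_pos, rule aD_pos)
  have G: "0 < G" unfolding G_def using alpha by (intro Gamma_real_pos) simp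
  have b: "0 < b" using assms G by (simp add: b_def)
  have p1: "p1 = 1 / (aD * b)"
    using assms by (simp add: p1_def p_opt1_def b_def G_def powr_minus_divide)
  then have p1_pos: "0 < p1" using aD b by simp
  have rate: "rate q = (aB + q * aD) * G" for q
    by (simp add: rate_def aB_def aD_def G_def)
  have D: "D q = q * dens_D * exp (- ((aB + q * aD) * b))" if "q \<in> {0..1}" for q
    using that assms by (simp add: D_def coverage_D_eq rate b_def mult_ac)
  \<comment> \<open>Separating the constant station part of the exponent leaves the function of
    \<open>mult_exp_le\<close> with m = p1.\<close>
  have D_shape: "D q = dens_D * exp (- (aB * b)) * (q * exp (- (q / p1)))" if "q \<in> {0..1}" for q
  proof -
    have "exp (- ((aB + q * aD) * b)) = exp (- (aB * b)) * exp (- (q / p1))"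
      by (simp add: p1 mult_exp_exp algebra_simps)
    then show ?thesis using that by (simp add: D)
  qed
  \<comment> \<open>The threshold enters through a positive factor K common to both sides, so all
    constraints are the same inequality; the threshold 1 shows that there is at least one.\<close>
  have feasible: "(\<forall>\<tau>\<^sub>B\<ge>1. PB \<tau>\<^sub>B q \<ge> \<delta> * PB \<tau>\<^sub>B 0) \<longleftrightarrow> ereal q \<le> p2" if q: "q \<in> {0..1}" for q
  proof -
    have rq: "0 < aB + q * aD" using aB aD q by (intro add_pos_nonneg) auto
    have c: "0 < enn2real stable_const" using stable_const by (simp add: enn2real_positive_iff)
    have PB: "PB \<tau> q' = (\<tau> powr (- (2 / \<beta>)) * aB / (enn2real stable_const * G)) * (1 / (aB + q' * aD))"
      if "q' \<in> {0..1}" "1 \<le> \<tau>" for \<tau> q'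
      using that by (simp add: PB_def coverage_B_eq rate aB_def[symmetric] mult_ac)
    have "PB \<tau> q \<ge> \<delta> * PB \<tau> 0 \<longleftrightarrow> \<delta> * (aB + q * aD) \<le> aB" if "1 \<le> \<tau>" for \<tau>
    proof -
      define K where "K = \<tau> powr (- (2 / \<beta>)) * aB / (enn2real stable_const * G)"
      have K: "0 < K" using that aB G c by (simp add: K_def)
      have "PB \<tau> q = K * (1 / (aB + q * aD))" "PB \<tau> 0 = K * (1 / (aB + 0 * aD))"
        unfolding K_def by (rule PB[OF q that], rule PB[OF _ that]) simp
      then have "PB \<tau> q \<ge> \<delta> * PB \<tau> 0 \<longleftrightarrow> K * (\<delta> / aB) \<le> K * (1 / (aB + q * aD))"
        by (simp add: mult.commute)
      also have "\<dots> \<longleftrightarrow> \<delta> / aB \<le> 1 / (aB + q * aD)" by (rule mult_le_cancel_left_pos[OF K])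
      also have "\<dots> \<longleftrightarrow> \<delta> * (aB + q * aD) \<le> aB" using aB rq by (simp add: field_simps)
      finally show ?thesis .
    qed
    then have "(\<forall>\<tau>\<^sub>B\<ge>1. PB \<tau>\<^sub>B q \<ge> \<delta> * PB \<tau>\<^sub>B 0) \<longleftrightarrow> \<delta> * (aB + q * aD) \<le> aB" by (auto intro: exI[of _ 1])
    also have "\<dots> \<longleftrightarrow> ereal q \<le> p2"
    proof (cases "\<delta> = 0")
      case False
      then have \<delta>: "0 < \<delta>" using assms by simp
      have "\<delta> * (aB + q * aD) \<le> aB \<longleftrightarrow> q * aD \<le> aB / \<delta> - aB" using \<delta> by (simp add: field_simps)
      also have "\<dots> \<longleftrightarrow> q \<le> (aB / \<delta> - aB) / aD" using aD by (simp add: pos_le_divide_eq)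
      also have "(aB / \<delta> - aB) / aD = aB / aD * (1 / \<delta> - 1)"
        using aD \<delta> by (simp add: field_simps)
      finally show ?thesis using False by (simp add: p2_def p_opt2_def)
    qed (use aB in \<open>simp add: p2_def p_opt2_def\<close>)
    finally show ?thesis .
  qed
  have p2_nonneg: "0 \<le> p2"
    using aB aD assms by (auto simp: p2_def p_opt2_def zero_ereal_def field_simps)
  \<comment> \<open>\<open>p2\<close> may be infinite, but the minimum with 1 is not, so the
    conversion to a real number loses nothing.\<close>
  have p_ereal: "ereal p = min 1 (min (ereal p1) p2)"
  proof -
    let ?m = "min 1 (min (ereal p1) p2)"
    have "?m \<noteq> \<infinity>" "0 \<le> ?m" using p1_pos p2_nonneg by (auto simp: min_def)
    then have "\<bar>?m\<bar> \<noteq> \<infinity>" by (cases ?m) auto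
    then show ?thesis unfolding p_def p_opt_def by (rule ereal_real')
  qed
  have p_le: "p \<le> 1" "p \<le> p1" "ereal p \<le> p2"
    using p_ereal by (metis ereal_less_eq(3) min.cobounded1 one_ereal_def)
      (metis p_ereal ereal_less_eq(3) min.cobounded1 min.coboundedI2, metis p_ereal min.cobounded2 min.coboundedI2)
  have p_nonneg: "0 \<le> p"
  proof -
    have "0 \<le> ereal p" unfolding p_ereal using p1_pos p2_nonneg by simp
    then show ?thesis by simp
  qed
  have p01: "p \<in> {0..1}" using p_le p_nonneg by simp
  have max: "D q \<le> D p" if q: "q \<in> {0..1}" and q2: "ereal q \<le> p2" for q
  proof -
    \<comment> \<open>If a feasible q exceeds p, then neither 1 nor p2 attains the minimum, so p1
      does.\<close>
    have or: "p = p1 \<or> q \<le> p"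
    proof (rule disjCI)
      assume "\<not> q \<le> p"
      then have "ereal p < ereal q" by simp
      then have "ereal p < 1" "ereal p < p2"
        using q less_le_trans[OF _ q2] by (auto simp: one_ereal_def)
      then show "p = p1" using p_ereal by (auto simp: min_def split: if_splits)
    qed
    have "q * exp (- (q / p1)) \<le> p * exp (- (p / p1))"
    \<comment> \<open>The value p = 0 occurs for \<delta> = 1, when only q = 0 is feasible;
      \<open>mult_exp_le\<close> treats positive p.\<close>
    proof (cases "p = 0")
      case True
      then show ?thesis using or p1_pos q by simp
    next
      case False
      then show ?thesis using or p_le p_nonneg p1_pos by (intro mult_exp_le) auto
    qed
    then show ?thesis
      unfolding D_shape[OF q] D_shape[OF p01] using assms by (intro mult_left_mono) auto
  qed
  have "is_arg_max D (\<lambda>q. q \<in> {0..1} \<and> (\<forall>\<tau>\<^sub>B\<ge>1. PB \<tau>\<^sub>B q \<ge> \<delta> * PB \<tau>\<^sub>B 0)) p"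
    unfolding is_arg_max_def using max feasible p01 p_le(3) by (meson not_less)
  moreover have "p = 1 \<longrightarrow> D p = dens_D * exp (- ((aB + aD) * (\<kappa> * r)\<^sup>2 * G * \<tau>\<^sub>D powr (2 / \<beta>)))"
    using D[OF p01] by (auto simp: b_def mult_ac)
  moreover have "p = p1 \<longrightarrow> D p = dens_D * exp (- (aB / (aD * p1))) * exp (- 1)
      / (aD * (\<kappa> * r)\<^sup>2 * G * \<tau>\<^sub>D powr (2 / \<beta>))"
  proof
    assume "p = p1"
    define K where "K = aD * (\<kappa> * r)\<^sup>2 * G * \<tau>\<^sub>D powr (2 / \<beta>)"
    have K: "aD * b = K" by (simp add: K_def b_def mult.assoc)
    have "aB / (aD * p1) = aB * b" using aD b by (simp add: p1)
    moreover have "D p = dens_D * exp (- (aB * b)) * (1 / K * exp (- 1))"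
      using D_shape[OF p01] \<open>p = p1\<close> p1_pos K p1 by simp
    ultimately show "D p = dens_D * exp (- (aB / (aD * p1))) * exp (- 1)
        / (aD * (\<kappa> * r)\<^sup>2 * G * \<tau>\<^sub>D powr (2 / \<beta>))"
      by (simp add: K_def[symmetric])
  qed
  moreover have "ereal p = p2 \<longrightarrow> D p = aB / aD * (1 / \<delta> - 1) * dens_D
      * exp (- (aB * (\<kappa> * r)\<^sup>2 * G * \<tau>\<^sub>D powr (2 / \<beta>) / \<delta>))"
  proof
    assume "ereal p = p2"
    \<comment> \<open>A real p cannot equal p2 = \<infinity>, which excludes \<delta> = 0.\<close>
    then have \<delta>: "\<delta> \<noteq> 0" and p: "p = aB / aD * (1 / \<delta> - 1)"
      by (auto simp: p2_def p_opt2_def split: if_splits)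
    \<comment> \<open>The coverage constraint is active at p2: the devices raise the total constant
      from aB to exactly aB / \<delta>.\<close>
    have "aB + p * aD = aB / \<delta>" using aD by (simp add: p field_simps)
    then show "D p = aB / aD * (1 / \<delta> - 1) * dens_D
        * exp (- (aB * (\<kappa> * r)\<^sup>2 * G * \<tau>\<^sub>D powr (2 / \<beta>) / \<delta>))"
      unfolding p[symmetric] using D[OF p01] by (simp add: b_def mult_ac)
  qed
  ultimately show ?thesis
    unfolding Let_def aB_def[symmetric] aD_def[symmetric] G_def[symmetric] PB_def[symmetric] D_def[symmetric]
      p1_def[symmetric] p2_def[symmetric] p_def[symmetric]
    by blast
qed

end
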